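(* Each of the Polish groups $\mathrm{AC}_+(I)$, $\mathrm{AC}_+(\mathbb S^1)$ and $\mathrm{AC}_{\mathbb Z}^{\mathrm{loc}}(\mathbb R)$ has a well-defined quasi-isometry type, i.e. each is generated by a subset which is coarsely bounded in it. For both $\mathrm{AC}_+(I)$ and $\mathrm{AC}_+(\mathbb S^1)$ the quasi-isometry type is trivial (equivalently, each of these two groups is a coarsely bounded group), and for $\mathrm{AC}_{\mathbb Z}^{\mathrm{loc}}(\mathbb R)$ the quasi-isometry type is that of $\mathbb Z$ (with its standard metric).
   Context: $I=[0,1]$; $\mathbb S^1$ is the group of complex numbers of norm $1$; $\pi:\mathbb R\to\mathbb S^1$ is $x\mapsto e^{2\pi i x}$; $d_{\mathbb S^1}(x,y)$ is the minimum distance between $\pi^{-1}(x)$ and $\pi^{-1}(y)$ in $\mathbb R$. A function on an interval is locally absolutely continuous if its restriction to every compact subinterval is absolutely continuous. For a homeomorphism $f:\mathbb S^1\to\mathbb S^1$, $\tilde f:\mathbb R\to\mathbb R$ is the unique homeomorphism with $\tilde f(0)\in[0,1)$ and $\pi\circ\tilde f=f\circ\pi$; $f$ is called absolutely continuous if $\tilde f$ is locally absolutely continuous. For $M=I$ or $M=\mathbb S^1$, $\mathrm{AC}_+(M)$ is the group (under composition) of orientation-preserving homeomorphisms $f:M\to M$ such that $f$ and $f^{-1}$ are absolutely continuous. $\mathrm{AC}_{\mathbb Z}^{\mathrm{loc}}(\mathbb R)$ is the group of homeomorphisms $f:\mathbb R\to\mathbb R$ such that $f(x+n)=f(x)+n$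 for all $x\in\mathbb R,n\in\mathbb Z$ and both $f$ and $f^{-1}$ are locally absolutely continuous. Topologies: $\mathrm{AC}_+(I)$ carries the topology of the metric $d_*(f,g)=\int_0^1|f'(t)-g'(t)|\,dt$ (a Polish group topology, due to Solecki). $\mathrm{AC}_{\mathbb Z}^{\mathrm{loc}}(\mathbb R)$ carries the topology of the metric $d_\infty+d_*$, where $d_\infty(f,g)=\sup_{x\in I}|f(x)-g(x)|$ and $d_*(f,g)=\int_0^1|f'(t)-g'(t)|\,dt$. $\mathrm{AC}_+(\mathbb S^1)$ carries the topology of the metric $d_\infty+d_*$, where $d_\infty(f,g)=\sup_{x\in\mathbb S^1}d_{\mathbb S^1}(f(x),g(x))$ and $d_*(f,g)=\int_0^1|\tilde f'(t)-\tilde g'(t)|\,dt$. These are Polish group topologies. A subset $S$ of a Polish group $G$ is coarsely bounded in $G$ if $S$ is bounded in every left-invariant metric on $G$ compatible with the topology; $G$ is a coarsely bounded group if it is coarsely bounded in itself. For a group $G$ generated by $S$, the word metric is $\rho_S(x,y)=\min\{k\ge 0 : x^{-1}y\in(S\cup S^{-1})^k\}$. If a Polish group $G$ is generated by a coarsely bounded subset, its quasi-isometry type is the quasi-isometry equivalence class of the metric space $(G,\rho_S)$ for any closed, coarsely bounded generating set $S$ (this is independent of $S$). The trivial quasi-isometry type is that of a one-point space. *)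

theory Defs
  imports "HOL-Analysis.Analysis" "HOL-Algebra.Bij" "HOL-Algebra.Generated_Groups"
begin

section \<open>Absolute continuity\<close>

text \<open>The finite set \<open>D\<close> of pairs of endpoints encodes a finite family of pairwise disjoint
  open subintervals of the interval from \<open>a\<close> to \<open>b\<close>. (The library constant
  \<^const>\<open>absolutely_continuous\<close> is about measures.)\<close>

definition abs_cont_on :: "real \<Rightarrow> real \<Rightarrow> (real \<Rightarrow> real) \<Rightarrow> bool" where
  "abs_cont_on a b f \<longleftrightarrow>
     (\<forall>\<epsilon>>0. \<exists>\<delta>>0. \<forall>D :: (real \<times> real) set.
        finite D \<and> (\<forall>(u, v)\<in>D. a \<le> u \<and> u < v \<and> v \<le> b) \<and>
        disjoint_family_on (\<lambda>(u, v). {u<..<v}) D \<and> (\<Sum>(u, v)\<in>D. v - u) < \<delta>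
        \<longrightarrow> (\<Sum>(u, v)\<in>D. \<bar>f v - f u\<bar>) < \<epsilon>)"

definition loc_abs_cont :: "(real \<Rightarrow> real) \<Rightarrow> bool" where
  "loc_abs_cont f \<longleftrightarrow> (\<forall>a b. a \<le> b \<longrightarrow> abs_cont_on a b f)"

section \<open>The circle\<close>

abbreviation circle :: "complex set" where
  "circle \<equiv> sphere 0 1"

definition circle_proj :: "real \<Rightarrow> complex" where
  "circle_proj x = exp (2 * of_real pi * \<i> * of_real x)"

definition circle_dist :: "complex \<Rightarrow> complex \<Rightarrow> real" where
  "circle_dist x y = setdist (circle_proj -` {x}) (circle_proj -` {y})"

definition circle_lift :: "(complex \<Rightarrow> complex) \<Rightarrow> real \<Rightarrow> real" where
  "circle_lift f = (THE F. (\<exists>G. homeomorphism UNIV UNIV F G) \<and> F 0 \<in> {0..<1} \<and>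
     (\<forall>x. circle_proj (F x) = f (circle_proj x)))"

section \<open>The three groups\<close>

text \<open>As in \<^const>\<open>BijGroup\<close>, a self-map of \<open>M\<close> is represented by a function that is
  \<^const>\<open>undefined\<close> outside \<open>M\<close>, and the group operation is composition.\<close>

definition AC_interval :: "(real \<Rightarrow> real) monoid" where
  "AC_interval = (BijGroup {0..1}) \<lparr>carrier :=
     {f \<in> extensional {0..1}. (\<exists>g. homeomorphism {0..1} {0..1} f g) \<and> strict_mono_on {0..1} f \<and>
        abs_cont_on 0 1 f \<and> abs_cont_on 0 1 (inv_into {0..1} f)}\<rparr>"

text \<open>A homeomorphism of the circle preserves orientation iff its lifts are increasing.\<close>

definition AC_circle :: "(complex \<Rightarrow> complex) monoid" where
  "AC_circle = (BijGroup circle) \<lparr>carrier :=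
     {f \<in> extensional circle. (\<exists>g. homeomorphism circle circle f g) \<and>
        strict_mono (circle_lift f) \<and>
        loc_abs_cont (circle_lift f) \<and> loc_abs_cont (circle_lift (inv_into circle f))}\<rparr>"

definition AC_line :: "(real \<Rightarrow> real) monoid" where
  "AC_line = (BijGroup UNIV) \<lparr>carrier :=
     {f. (\<exists>g. homeomorphism UNIV UNIV f g) \<and> (\<forall>x. \<forall>n::int. f (x + of_int n) = f x + of_int n) \<and>
        loc_abs_cont f \<and> loc_abs_cont (inv_into UNIV f)}\<rparr>"

section \<open>Their topologies\<close>

text \<open>An absolutely continuous function is differentiable only almost everywhere; the values of
  \<^const>\<open>deriv\<close> on the exceptional null set do not affect the integral.\<close>

definition deriv_L1_dist :: "(real \<Rightarrow> real) \<Rightarrow> (real \<Rightarrow> real) \<Rightarrow> real" where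
  "deriv_L1_dist f g = (LINT t:{0..1}|lebesgue. \<bar>deriv f t - deriv g t\<bar>)"

definition AC_interval_top :: "(real \<Rightarrow> real) topology" where
  "AC_interval_top = Metric_space.mtopology (carrier AC_interval) deriv_L1_dist"

definition AC_circle_dist :: "(complex \<Rightarrow> complex) \<Rightarrow> (complex \<Rightarrow> complex) \<Rightarrow> real" where
  "AC_circle_dist f g =
     (SUP x\<in>circle. circle_dist (f x) (g x)) + deriv_L1_dist (circle_lift f) (circle_lift g)"

definition AC_circle_top :: "(complex \<Rightarrow> complex) topology" where
  "AC_circle_top = Metric_space.mtopology (carrier AC_circle) AC_circle_dist"

text \<open>The case distinction is needed because \<^locale>\<open>Metric_space\<close> requires nonnegativity also
  outside the carrier, where the supremum may be one of an unbounded set.\<close>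

definition AC_line_dist :: "(real \<Rightarrow> real) \<Rightarrow> (real \<Rightarrow> real) \<Rightarrow> real" where
  "AC_line_dist f g =
     (if f \<in> carrier AC_line \<and> g \<in> carrier AC_line
      then (SUP x\<in>{0..1}. \<bar>f x - g x\<bar>) + deriv_L1_dist f g else 0)"

definition AC_line_top :: "(real \<Rightarrow> real) topology" where
  "AC_line_top = Metric_space.mtopology (carrier AC_line) AC_line_dist"

section \<open>Coarse geometry of topological groups\<close>

text \<open>A group \<open>G\<close> with a topology \<open>T\<close> on its carrier.\<close>

definition compatible_left_invariant ::
    "('a, 'b) monoid_scheme \<Rightarrow> 'a topology \<Rightarrow> ('a \<Rightarrow> 'a \<Rightarrow> real) \<Rightarrow> bool" where
  "compatible_left_invariant G T d \<longleftrightarrow>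
     Metric_space (carrier G) d \<and> Metric_space.mtopology (carrier G) d = T \<and>
     (\<forall>g\<in>carrier G. \<forall>x\<in>carrier G. \<forall>y\<in>carrier G. d (g \<otimes>\<^bsub>G\<^esub> x) (g \<otimes>\<^bsub>G\<^esub> y) = d x y)"

definition coarsely_bounded_in ::
    "('a, 'b) monoid_scheme \<Rightarrow> 'a topology \<Rightarrow> 'a set \<Rightarrow> bool" where
  "coarsely_bounded_in G T S \<longleftrightarrow> S \<subseteq> carrier G \<and>
     (\<forall>d. compatible_left_invariant G T d \<longrightarrow> Metric_space.mbounded (carrier G) d S)"

definition coarsely_bounded_group :: "('a, 'b) monoid_scheme \<Rightarrow> 'a topology \<Rightarrow> bool" where
  "coarsely_bounded_group G T \<longleftrightarrow> coarsely_bounded_in G T (carrier G)"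

primrec set_power :: "('a, 'b) monoid_scheme \<Rightarrow> 'a set \<Rightarrow> nat \<Rightarrow> 'a set" where
  "set_power G A 0 = {\<one>\<^bsub>G\<^esub>}"
| "set_power G A (Suc k) = set_power G A k <#>\<^bsub>G\<^esub> A"

definition word_dist :: "('a, 'b) monoid_scheme \<Rightarrow> 'a set \<Rightarrow> 'a \<Rightarrow> 'a \<Rightarrow> real" where
  "word_dist G S x y =
     real (LEAST k. inv\<^bsub>G\<^esub> x \<otimes>\<^bsub>G\<^esub> y \<in> set_power G (S \<union> set_inv\<^bsub>G\<^esub> S) k)"

definition quasi_isometric ::
    "'a set \<Rightarrow> ('a \<Rightarrow> 'a \<Rightarrow> real) \<Rightarrow> 'b set \<Rightarrow> ('b \<Rightarrow> 'b \<Rightarrow> real) \<Rightarrow> bool" where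
  "quasi_isometric X dX Y dY \<longleftrightarrow>
     (\<exists>f K C. f \<in> X \<rightarrow> Y \<and> K \<ge> 1 \<and> C \<ge> 0 \<and>
        (\<forall>x\<in>X. \<forall>x'\<in>X. dX x x' / K - C \<le> dY (f x) (f x') \<and> dY (f x) (f x') \<le> K * dX x x' + C) \<and>
        (\<forall>y\<in>Y. \<exists>x\<in>X. dY (f x) y \<le> C))"

definition generated_by_coarsely_bounded ::
    "('a, 'b) monoid_scheme \<Rightarrow> 'a topology \<Rightarrow> bool" where
  "generated_by_coarsely_bounded G T \<longleftrightarrow>
     (\<exists>S. coarsely_bounded_in G T S \<and> generate G S = carrier G)"

text \<open>The first conjunct ensures that the second one is not vacuous.\<close>

definition has_quasi_isometry_type ::
    "('a, 'b) monoid_scheme \<Rightarrow> 'a topology \<Rightarrow> 'c set \<Rightarrow> ('c \<Rightarrow> 'c \<Rightarrow> real) \<Rightarrow> bool" where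
  "has_quasi_isometry_type G T Y dY \<longleftrightarrow>
     (\<exists>S. closedin T S \<and> coarsely_bounded_in G T S \<and> generate G S = carrier G) \<and>
     (\<forall>S. closedin T S \<and> coarsely_bounded_in G T S \<and> generate G S = carrier G \<longrightarrow>
        quasi_isometric (carrier G) (word_dist G S) Y dY)"

end

(* The key point is purely algebraic (a Bergman property): every subadditive, inversion-invariant
   function L on the group of increasing homeomorphisms of the line that preserve null sets in both
   directions is bounded. An increasing homeomorphism is absolutely continuous iff it maps null sets
   to null sets, so this group is isomorphic to AC_+(I), and countable families of its elements with
   disjoint open supports can be glued freely. A commutator trick on such glued maps bounds L on maps
   supported near the integers; fragmentation extends this to maps of bounded displacement; and a
   single change of coordinates brings any given sequence of maps to bounded displacements.

   Applied to word lengths and to invariant metrics this yields the trivial quasi-isometry type of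
   AC_+(I), and also L f <= A |f 0| + B on the group on the line, of which AC_+(S^1) is the quotient
   by the integer translations. For the converse estimate on the line one needs a compatible
   left-invariant metric that controls f 0. The given metric is right-invariant by the chain rule and
   substitution, so precomposing it with inversion works once inversion is known to be continuous. *)

theory Submission
  imports Defs
begin

section \<open>Homeomorphisms of the line preserving null sets\<close>

text \<open>Null sets take the place of epsilon and delta because they survive infinite
  constructions: a countable union of null sets is null, whereas infinitely many moduli of absolute
  continuity need have no common bound. They are also respected by any diffeomorphism between the
  line and an open interval, however its derivative behaves at the ends. The line is preferred to
  the interval because translations, dilations and bounds on the displacement make sense there.

  Both contradiction arguments have the same shape. If \<open>L\<close> were unbounded, one could
  choose maps whose lengths exceed by \<open>i\<close> every quantity that depends on
  \<open>i\<close> and is fixed beforehand. One single map is then built that encodes or controls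
  the whole sequence. Its length is one real number, which cannot keep up with \<open>i\<close>.
  Since \<open>L\<close> is an arbitrary function, the same bound serves for all invariant metrics
  and all word lengths.\<close>

abbreviation rinv :: "(real \<Rightarrow> real) \<Rightarrow> real \<Rightarrow> real" where
  "rinv f \<equiv> inv_into UNIV f"

text \<open>Continuity is automatic for an increasing surjection of the line. Control of null sets
  in both directions makes the class closed under inversion, matching the demand that a map and its
  inverse be absolutely continuous.\<close>

definition NH :: "(real \<Rightarrow> real) set" where
  "NH = {f. strict_mono f \<and> surj f \<and> (\<forall>N. negligible N \<longrightarrow> negligible (f ` N) \<and> negligible (f -` N))}"

definition NH_on :: "real set \<Rightarrow> (real \<Rightarrow> real) set" where
  "NH_on E = {f \<in> NH. \<forall>x. x \<notin> E \<longrightarrow> f x = x}"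

lemma NH_bij: "f \<in> NH \<Longrightarrow> bij f"
  by (auto simp: NH_def bij_def strict_mono_imp_inj_on)

lemma NH_less: "f \<in> NH \<Longrightarrow> f x < f y \<longleftrightarrow> x < y"
  by (simp add: NH_def strict_mono_less)

lemma NH_le: "f \<in> NH \<Longrightarrow> f x \<le> f y \<longleftrightarrow> x \<le> y"
  by (simp add: NH_def strict_mono_less_eq)

lemma NH_eq: "f \<in> NH \<Longrightarrow> f x = f y \<longleftrightarrow> x = y"
  by (simp add: NH_def strict_mono_eq)

lemma NH_inv_f [simp]: "f \<in> NH \<Longrightarrow> rinv f (f x) = x"
  by (simp add: NH_bij bij_is_inj)

lemma NH_f_inv [simp]: "f \<in> NH \<Longrightarrow> f (rinv f x) = x"
  by (simp add: NH_bij bij_is_surj surj_f_inv_f)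

lemma NH_image: "f \<in> NH \<Longrightarrow> negligible N \<Longrightarrow> negligible (f ` N)"
  and NH_vimage: "f \<in> NH \<Longrightarrow> negligible N \<Longrightarrow> negligible (f -` N)"
  by (auto simp: NH_def)

lemma NHI:
  assumes "\<And>x y. x < y \<Longrightarrow> f x < f y" "\<And>y. \<exists>x. f x = y"
    "\<And>N. negligible N \<Longrightarrow> negligible (f ` N)" "\<And>N. negligible N \<Longrightarrow> negligible (f -` N)"
  shows "f \<in> NH"
  using assms unfolding NH_def surj_def by (auto simp: strict_mono_def) metis

lemma NH_continuous:
  assumes "f \<in> NH" shows "continuous_on UNIV f"
  using assms by (intro continuous_onI_mono) (auto simp: NH_le NH_bij bij_is_surj)

lemma NH_id [simp]: "id \<in> NH"
  by (auto simp: NH_def strict_mono_def)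

lemma NH_comp [simp]:
  assumes "f \<in> NH" "g \<in> NH" shows "f \<circ> g \<in> NH"
proof (rule NHI)
  show "\<exists>x. (f \<circ> g) x = y" for y
    using assms by (intro exI[of _ "rinv g (rinv f y)"]) simp
  show "negligible ((f \<circ> g) ` N)" if "negligible N" for N
    using that assms by (simp only: image_comp[symmetric] NH_image)
  show "negligible ((f \<circ> g) -` N)" if "negligible N" for N
    using that assms by (simp only: vimage_comp[symmetric] NH_vimage)
qed (use assms in \<open>auto simp: NH_less\<close>)

lemma NH_inv [simp]:
  assumes "f \<in> NH" shows "rinv f \<in> NH"
proof (rule NHI)
  show "rinv f x < rinv f y" if "x < y" for x y
    using that assms NH_less[of f "rinv f x" "rinv f y"] by simp
  show "\<exists>x. rinv f x = y" for y
    using assms NH_inv_f by blast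
  show "negligible (rinv f ` N)" if "negligible N" for N
    using that assms by (simp add: bij_vimage_eq_inv_image[symmetric] NH_bij NH_vimage)
  show "negligible (rinv f -` N)" if "negligible N" for N
  proof -
    have "rinv f -` N = f ` N"
      using assms by (metis NH_bij bij_imp_bij_inv bij_vimage_eq_inv_image inv_inv_eq)
    then show ?thesis using that assms by (simp add: NH_image)
  qed
qed

lemma NH_inv_le: "f \<in> NH \<Longrightarrow> rinv f x \<le> y \<longleftrightarrow> x \<le> f y"
  using NH_le[of f "rinv f x" y] by simp

lemma NH_le_inv: "f \<in> NH \<Longrightarrow> y \<le> rinv f x \<longleftrightarrow> f y \<le> x"
  using NH_le[of f y "rinv f x"] by simp

lemma NH_inv_comp: "f \<in> NH \<Longrightarrow> g \<in> NH \<Longrightarrow> rinv (f \<circ> g) = rinv g \<circ> rinv f"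
  by (simp add: NH_bij o_inv_distrib)

lemma NH_inv_inv: "f \<in> NH \<Longrightarrow> rinv (rinv f) = f"
  by (simp add: NH_bij inv_inv_eq)

lemma NH_funpow [simp]: "f \<in> NH \<Longrightarrow> f ^^ n \<in> NH"
proof (induction n)
  case 0
  then show ?case using NH_id by (simp add: id_def)
qed simp

section \<open>Membership criteria: bounds on slopes, maxima and minima\<close>

lemma negligible_bounded_slope_image:
  fixes f :: "real \<Rightarrow> real"
  assumes "negligible N" "\<And>x y. x \<in> N \<Longrightarrow> y \<in> N \<Longrightarrow> \<bar>f x - f y\<bar> \<le> B * \<bar>x - y\<bar>"
  shows "negligible (f ` N)"
proof (rule negligible_locally_Lipschitz_image[OF order_refl \<open>negligible N\<close>])
  fix x assume "x \<in> N"
  then show "\<exists>T B. open T \<and> x \<in> T \<and> (\<forall>y\<in>N \<inter> T. norm (f y - f x) \<le> B * norm (y - x))"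
    using assms(2) by (intro exI[of _ UNIV] exI[of _ B]) auto
qed

text \<open>The lower bound \<open>c\<close> on the slopes makes the inverse globally Lipschitz,
  which handles preimages. For images a Lipschitz bound on each of the countably many unit cells is
  enough; the bounds may grow from cell to cell, as they do for the piecewise affine maps used
  later.\<close>

lemma NH_expanding:
  assumes mono: "c > 0" "\<And>x y. x < y \<Longrightarrow> c * (y - x) \<le> f y - f x" and surj: "\<And>y. \<exists>x. f x = y"
    and lip: "\<And>k::int. \<exists>B. \<forall>x\<in>{real_of_int k..real_of_int k+1}. \<forall>y\<in>{real_of_int k..real_of_int k+1}. \<bar>f x - f y\<bar> \<le> B * \<bar>x - y\<bar>"
  shows "f \<in> NH"
proof (rule NHI)
  show less: "f x < f y" if "x < y" for x y
  proof -
    have "0 < c * (y - x)" using \<open>c > 0\<close> that by simp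
    then show ?thesis using mono(2)[OF that] by linarith
  qed
  show "\<exists>x. f x = y" for y by fact
  show "negligible (f ` N)" if "negligible N" for N
  proof -
    have "negligible (f ` (N \<inter> {real_of_int k..real_of_int k+1}))" for k :: int
    proof -
      obtain B where "\<forall>x\<in>{real_of_int k..real_of_int k+1}. \<forall>y\<in>{real_of_int k..real_of_int k+1}. \<bar>f x - f y\<bar> \<le> B * \<bar>x - y\<bar>"
        using lip by blast
      then show ?thesis
        using that by (intro negligible_bounded_slope_image[where B = B] negligible_Int) auto
    qed
    moreover have "f ` N \<subseteq> (\<Union>k::int. f ` (N \<inter> {real_of_int k..real_of_int k+1}))"
    proof
      fix y assume "y \<in> f ` N"
      then obtain x where "x \<in> N" "y = f x" by blast
      then show "y \<in> (\<Union>k::int. f ` (N \<inter> {real_of_int k..real_of_int k+1}))"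
        by (intro UN_I[of "\<lfloor>x\<rfloor>"] imageI) (auto simp: less_imp_le)
    qed
    moreover have "negligible (\<Union>k::int. f ` (N \<inter> {real_of_int k..real_of_int k+1}))"
      using calculation(1) by (intro negligible_countable_Union) auto
    ultimately show ?thesis by (blast intro: negligible_subset)
  qed
  show "negligible (f -` N)" if "negligible N" for N
  proof -
    have inj: "inj f" using less by (metis linorder_injI order_less_imp_not_eq)
    have sf: "f (rinv f y) = y" for y using surj by (metis surj_def surj_f_inv_f)
    have *: "\<bar>rinv f x - rinv f y\<bar> \<le> 1 / c * \<bar>x - y\<bar>" for x y
    proof -
      have "c * \<bar>a - b\<bar> \<le> \<bar>f a - f b\<bar>" for a b
        using mono(2)[of a b] mono(2)[of b a] less[of a b] less[of b a] by (cases a b rule: linorder_cases) auto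
      from this[of "rinv f x" "rinv f y"] show ?thesis
        using \<open>c > 0\<close> by (simp add: sf field_simps)
    qed
    have "f -` N = rinv f ` N"
      using inj surj by (metis bij_def bij_vimage_eq_inv_image surj_def)
    then show ?thesis
      using negligible_bounded_slope_image[OF that, of "rinv f" "1/c"] * by simp
  qed
qed

text \<open>The identity plus a contraction has all slopes between \<open>1 - \<kappa>\<close> and
  \<open>1 + \<kappa>\<close>.\<close>

lemma NH_perturb:
  assumes "\<kappa> < 1" and \<psi>: "\<And>x y. \<bar>\<psi> x - \<psi> y\<bar> \<le> \<kappa> * \<bar>x - y\<bar>"
  shows "(\<lambda>x. x + \<psi> x) \<in> NH"
proof (rule NH_expanding[where c = "1 - \<kappa>"])
  have k0: "\<kappa> \<ge> 0" using \<psi>[of 0 1] by simp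
  show "1 - \<kappa> > 0" using assms by simp
  show "(1 - \<kappa>) * (y - x) \<le> (y + \<psi> y) - (x + \<psi> x)" if "x < y" for x y
    using \<psi>[of x y] that by (simp add: algebra_simps abs_if split: if_splits)
  have cont: "continuous_on S (\<lambda>x. x + \<psi> x)" for S
  proof -
    have "\<kappa>-lipschitz_on S \<psi>"
      using \<psi> k0 by (intro lipschitz_onI) (auto simp: dist_real_def)
    then show ?thesis
      by (intro continuous_intros) (rule lipschitz_on_continuous_on)
  qed
  show "\<exists>x. x + \<psi> x = y" for y
  proof -
    \<comment> \<open>At distance \<open>R\<close> from 0 the drift of slope at least
      \<open>1 - \<kappa>\<close> outweighs both \<open>\<psi> 0\<close> and \<open>y\<close>, so
      the values at \<open>-R\<close> and \<open>R\<close> enclose \<open>y\<close>.\<close>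
    define R where "R = (\<bar>y\<bar> + \<bar>\<psi> 0\<bar>) / (1 - \<kappa>)"
    have R: "\<bar>y\<bar> + \<bar>\<psi> 0\<bar> = (1 - \<kappa>) * R" using assms(1) by (simp add: R_def)
    have "R \<ge> 0" using assms(1) by (simp add: R_def)
    have "-R + \<psi> (-R) \<le> y" "y \<le> R + \<psi> R"
      using \<psi>[of R 0] \<psi>[of "-R" 0] R \<open>R \<ge> 0\<close> by (simp_all add: algebra_simps abs_if split: if_splits)
    then show ?thesis
      using IVT'[of "\<lambda>x. x + \<psi> x" "-R" y R] cont \<open>R \<ge> 0\<close> by auto
  qed
  show "\<exists>B. \<forall>x\<in>{real_of_int k..real_of_int k+1}. \<forall>y\<in>{real_of_int k..real_of_int k+1}. \<bar>x + \<psi> x - (y + \<psi> y)\<bar> \<le> B * \<bar>x - y\<bar>" for k :: int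
  proof (intro exI ballI)
    fix x y
    show "\<bar>x + \<psi> x - (y + \<psi> y)\<bar> \<le> (1 + \<kappa>) * \<bar>x - y\<bar>"
      using \<psi>[of x y] by (simp add: algebra_simps)
  qed
qed

lemma NH_translation: "(\<lambda>x. x + a) \<in> NH"
  using NH_perturb[of 0 "\<lambda>_. a"] by simp

lemma NH_scaling:
  assumes "M > 0" shows "(\<lambda>x. M * x) \<in> NH"
proof (rule NH_expanding[where c = M])
  show "\<exists>x. M * x = y" for y using assms by (intro exI[of _ "y / M"]) simp
  show "\<exists>B. \<forall>x\<in>{real_of_int k..real_of_int k+1}. \<forall>y\<in>{real_of_int k..real_of_int k+1}. \<bar>M * x - M * y\<bar> \<le> B * \<bar>x - y\<bar>" for k :: int
    using assms by (intro exI[of _ M]) (auto simp: abs_mult simp flip: right_diff_distrib)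
qed (use assms in \<open>auto simp: algebra_simps\<close>)

text \<open>At every point the maximum is one of the two values, so images and preimages of null
  sets lie in the union of those for \<open>f\<close> and \<open>g\<close>. Together with
  \<open>NH_min\<close> this allows a map to be clamped between two others.\<close>

lemma NH_max:
  assumes "f \<in> NH" "g \<in> NH" shows "(\<lambda>x. max (f x) (g x)) \<in> NH"
proof (rule NHI)
  show "max (f x) (g x) < max (f y) (g y)" if "x < y" for x y
    using that NH_less[OF assms(1), of x y] NH_less[OF assms(2), of x y] by auto
  show "\<exists>x. max (f x) (g x) = y" for y
  \<comment> \<open>The value \<open>y\<close> is attained at the smaller of the two preimages,
    where the other map has not yet exceeded \<open>y\<close>.\<close>
  proof (cases "rinv f y \<le> rinv g y")
    case True
    then show ?thesis using assms by (intro exI[of _ "rinv f y"]) (simp add: NH_le_inv max_def)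
  next
    case False
    then have "f (rinv g y) \<le> y" using assms NH_le_inv[of f "rinv g y" y] by simp
    then show ?thesis using assms by (intro exI[of _ "rinv g y"]) (simp add: max_def)
  qed
  show "negligible ((\<lambda>x. max (f x) (g x)) ` N)" if "negligible N" for N
    by (rule negligible_subset[of "f ` N \<union> g ` N"]) (use that assms in \<open>auto simp: NH_image max_def\<close>)
  show "negligible ((\<lambda>x. max (f x) (g x)) -` N)" if "negligible N" for N
    by (rule negligible_subset[of "f -` N \<union> g -` N"])
      (use that assms in \<open>auto simp: NH_vimage max_def split: if_splits\<close>)
qed

lemma NH_min:
  assumes "f \<in> NH" "g \<in> NH" shows "(\<lambda>x. min (f x) (g x)) \<in> NH"
proof (rule NHI)
  show "min (f x) (g x) < min (f y) (g y)" if "x < y" for x y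
    using that NH_less[OF assms(1), of x y] NH_less[OF assms(2), of x y] by auto
  show "\<exists>x. min (f x) (g x) = y" for y
  proof (cases "rinv f y \<le> rinv g y")
    case True
    then have "y \<le> f (rinv g y)" using assms by (simp add: NH_inv_le)
    then show ?thesis using assms by (intro exI[of _ "rinv g y"]) (simp add: min_def)
  next
    case False
    then have "y \<le> g (rinv f y)" using assms NH_inv_le[of g y "rinv f y"] by simp
    then show ?thesis using assms by (intro exI[of _ "rinv f y"]) (simp add: min_def)
  qed
  show "negligible ((\<lambda>x. min (f x) (g x)) ` N)" if "negligible N" for N
    by (rule negligible_subset[of "f ` N \<union> g ` N"]) (use that assms in \<open>auto simp: NH_image min_def\<close>)
  show "negligible ((\<lambda>x. min (f x) (g x)) -` N)" if "negligible N" for N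
    by (rule negligible_subset[of "f -` N \<union> g -` N"])
      (use that assms in \<open>auto simp: NH_vimage min_def split: if_splits\<close>)
qed

subsection \<open>Supports\<close>

lemma NH_on_NH: "f \<in> NH_on E \<Longrightarrow> f \<in> NH"
  by (simp add: NH_on_def)

lemma NH_on_fix: "f \<in> NH_on E \<Longrightarrow> x \<notin> E \<Longrightarrow> f x = x"
  by (simp add: NH_on_def)

lemma NH_on_inv:
  assumes "f \<in> NH_on E" shows "rinv f \<in> NH_on E"
  using assms by (auto simp: NH_on_def) (metis NH_inv_f)

lemma NH_on_mem:
  assumes "f \<in> NH_on E" shows "f x \<in> E \<longleftrightarrow> x \<in> E"
  using assms by (metis NH_eq NH_on_NH NH_on_fix)

lemma NH_on_funpow: "f \<in> NH_on E \<Longrightarrow> f ^^ n \<in> NH_on E"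
  unfolding NH_on_def by (induction n) auto

definition conj_by :: "(real \<Rightarrow> real) \<Rightarrow> (real \<Rightarrow> real) \<Rightarrow> real \<Rightarrow> real" where
  "conj_by h f = h \<circ> f \<circ> rinv h"

lemma conj_by_NH_on:
  assumes "h \<in> NH" "f \<in> NH_on E" shows "conj_by h f \<in> NH_on (h ` E)"
proof -
  have "rinv h x \<notin> E" if "x \<notin> h ` E" for x
    using that imageI[of "rinv h x" E h] NH_f_inv[OF assms(1), of x] by auto
  then show ?thesis
    using assms by (auto simp: NH_on_def conj_by_def)
qed

lemma NH_open_image: "h \<in> NH \<Longrightarrow> open E \<Longrightarrow> open (h ` E)"
  by (metis NH_bij NH_continuous NH_inv bij_imp_bij_inv bij_vimage_eq_inv_image inv_inv_eq open_vimage)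

section \<open>Gluing maps with disjoint open supports\<close>

definition glue :: "('i \<Rightarrow> real set) \<Rightarrow> ('i \<Rightarrow> real \<Rightarrow> real) \<Rightarrow> real \<Rightarrow> real" where
  "glue E f x = (if \<exists>j. x \<in> E j then f (THE j. x \<in> E j) x else x)"

lemma glue_in:
  assumes "disjoint_family E" "x \<in> E j" shows "glue E f x = f j x"
proof -
  have "(THE j. x \<in> E j) = j"
    using assms by (intro the_equality) (auto simp: disjoint_family_on_def)
  then show ?thesis using assms by (auto simp: glue_def)
qed

lemma glue_out: "(\<And>j. x \<notin> E j) \<Longrightarrow> glue E f x = x"
  by (simp add: glue_def)

text \<open>Each \<open>f j\<close> maps \<open>E j\<close> onto itself, so the pieces never collide
  and surjectivity is checked piecewise. Countability of the index type is what keeps images and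
  preimages of null sets null. Only monotonicity across two different supports needs an
  argument.\<close>

lemma glue_NH:
  fixes E :: "'i::countable \<Rightarrow> real set"
  assumes disj: "disjoint_family E" and op: "\<And>j. open (E j)" and f: "\<And>j. f j \<in> NH_on (E j)"
  shows "glue E f \<in> NH"
proof (rule NHI)
  note in_E = glue_in[OF disj]
  have cases: "(\<exists>j. x \<in> E j \<and> glue E f x = f j x) \<or> (\<forall>j. x \<notin> E j) \<and> glue E f x = x" for x
    using in_E glue_out by metis
  have sep: "f i x < f j y" if "x < y" "x \<in> E i" "y \<in> E j" "i \<noteq> j" for x y i j
  proof -
    \<comment> \<open>By connectedness two disjoint open sets that both meet the interval cannot
      cover it. A point \<open>z\<close> outside both is fixed by both maps and separates the two
      values.\<close>
    have "\<not> {x..y} \<subseteq> E i \<union> E j"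
    proof
      assume sub: "{x..y} \<subseteq> E i \<union> E j"
      have "E i \<inter> {x..y} = {} \<or> E j \<inter> {x..y} = {}"
        using sub disj \<open>i \<noteq> j\<close> by (intro connectedD[OF connected_Icc op op]) (auto simp: disjoint_family_on_def)
      moreover have "x \<in> E i \<inter> {x..y}" "y \<in> E j \<inter> {x..y}" using that by auto
      ultimately show False by blast
    qed
    then obtain z where z: "x \<le> z" "z \<le> y" "z \<notin> E i" "z \<notin> E j" by fastforce
    then have "x < z" "z < y" using that by (auto simp: order.order_iff_strict)
    then have "f i x < f i z" "f j z < f j y" by (simp_all add: NH_less[OF NH_on_NH[OF f]])
    then show ?thesis using z NH_on_fix[OF f, of z i] NH_on_fix[OF f, of z j] by simp
  qed
  show "glue E f x < glue E f y" if "x < y" for x y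
  proof -
    have fl: "f j x < f j y" for j using that by (simp add: NH_less[OF NH_on_NH[OF f]])
    consider i j where "x \<in> E i" "glue E f x = f i x" "y \<in> E j" "glue E f y = f j y"
      | i where "x \<in> E i" "glue E f x = f i x" "\<And>j. y \<notin> E j" "glue E f y = y"
      | j where "y \<in> E j" "glue E f y = f j y" "\<And>j. x \<notin> E j" "glue E f x = x"
      | "glue E f x = x" "glue E f y = y"
      using cases[of x] cases[of y] by auto
    then show ?thesis
    proof cases
      case (1 i j)
      then show ?thesis using sep[of x y i j] fl[of i] that by (cases "i = j") auto
    next
      case (2 i)
      then show ?thesis using fl[of i] NH_on_fix[OF f, of y i] by simp
    next
      case (3 j)
      then show ?thesis using fl[of j] NH_on_fix[OF f, of x j] by simp
    qed (use that in simp)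
  qed
  show "\<exists>x. glue E f x = y" for y
  proof (cases "\<exists>j. y \<in> E j")
    case True
    then obtain j where "y \<in> E j" by blast
    then have "rinv (f j) y \<in> E j" using NH_on_mem[OF NH_on_inv[OF f]] by blast
    then show ?thesis
      by (intro exI[of _ "rinv (f j) y"]) (simp add: in_E NH_f_inv[OF NH_on_NH[OF f]])
  qed (metis glue_out)
  show "negligible (glue E f ` N)" if "negligible N" for N
  proof (rule negligible_subset)
    show "negligible (N \<union> (\<Union>j. f j ` N))"
      using that f by (intro negligible_Un negligible_countable_Union) (auto intro: NH_image NH_on_NH)
    show "glue E f ` N \<subseteq> N \<union> (\<Union>j. f j ` N)"
      using cases by (fastforce simp: image_iff)
  qed
  show "negligible (glue E f -` N)" if "negligible N" for N
  proof (rule negligible_subset)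
    show "negligible (N \<union> (\<Union>j. f j -` N))"
      using that f by (intro negligible_Un negligible_countable_Union) (auto intro: NH_vimage NH_on_NH)
    show "glue E f -` N \<subseteq> N \<union> (\<Union>j. f j -` N)"
    proof
      fix x assume "x \<in> glue E f -` N"
      then show "x \<in> N \<union> (\<Union>j. f j -` N)" using cases[of x] by auto
    qed
  qed
qed

section \<open>Displacing maps\<close>

definition dist_int :: "real \<Rightarrow> real" where
  "dist_int x = \<bar>x - of_int (round x)\<bar>"

lemma dist_int_le: "dist_int x \<le> \<bar>x - of_int m\<bar>"
  by (simp add: dist_int_def round_diff_minimal)

lemma dist_int_nonneg [simp]: "0 \<le> dist_int x"
  by (simp add: dist_int_def)

lemma dist_int_le_half: "dist_int x \<le> 1/2"
  using of_int_round_abs_le[of x] by (simp add: dist_int_def abs_minus_commute)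

lemma dist_int_diff: "\<bar>dist_int x - dist_int y\<bar> \<le> \<bar>x - y\<bar>"
proof -
  have "dist_int a \<le> \<bar>a - b\<bar> + dist_int b" for a b
    using dist_int_le[of a "round b"] unfolding dist_int_def by linarith
  from this[of x y] this[of y x] show ?thesis by linarith
qed

lemma dist_int_near:
  assumes "\<bar>x - of_int m\<bar> \<le> 1/2" shows "dist_int x = \<bar>x - of_int m\<bar>"
proof (cases "round x = m")
  case False
  then have "\<bar>real_of_int (round x) - of_int m\<bar> \<ge> 1"
    by (simp flip: of_int_diff of_int_abs)
  then show ?thesis
    using assms dist_int_le[of x m] unfolding dist_int_def by linarith
qed (simp add: dist_int_def)

lemma dist_int_obtain:
  obtains m :: int where "dist_int x = \<bar>x - of_int m\<bar>" "\<bar>x - of_int m\<bar> \<le> 1/2"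
  using dist_int_le_half[of x] by (auto simp: dist_int_def)

lemma dist_int_half: "dist_int (x + 1/2) = 1/2 - dist_int x"
proof -
  obtain m where m: "dist_int x = \<bar>x - of_int m\<bar>" "\<bar>x - of_int m\<bar> \<le> 1/2"
    by (rule dist_int_obtain)
  show ?thesis
    using m dist_int_near[of "x + 1/2" m] dist_int_near[of "x + 1/2" "m + 1"] by (cases "x \<ge> m") auto
qed

lemma dist_int_add_int: "dist_int (x + of_int n) = dist_int x"
proof -
  obtain m where m: "dist_int x = \<bar>x - of_int m\<bar>" "\<bar>x - of_int m\<bar> \<le> 1/2"
    by (rule dist_int_obtain)
  then show ?thesis using dist_int_near[of "x + of_int n" "m + n"] by simp
qed

lemma continuous_on_dist_int: "continuous_on S dist_int"
proof -
  have "1-lipschitz_on S dist_int"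
    using dist_int_diff by (intro lipschitz_onI) (auto simp: dist_real_def)
  then show ?thesis by (rule lipschitz_on_continuous_on)
qed

lemma open_dist_int_less: "open {x. dist_int x < r}"
  by (intro open_Collect_less continuous_on_dist_int continuous_on_const)

text \<open>A move to the right by a tent function centred at every integer. The factor 1/2 keeps
  the slope of the tent at most 1/2, so that the map is increasing.\<close>

definition push :: "real \<Rightarrow> real \<Rightarrow> real" where
  "push \<rho> x = x + max 0 (\<rho> - dist_int x) / 2"

lemma push_NH: "push \<rho> \<in> NH"
proof -
  have "(\<lambda>x. x + max 0 (\<rho> - dist_int x) / 2) \<in> NH"
  proof (rule NH_perturb[of "1/2"])
    fix x y
    show "\<bar>max 0 (\<rho> - dist_int x) / 2 - max 0 (\<rho> - dist_int y) / 2\<bar> \<le> 1/2 * \<bar>x - y\<bar>"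
      using dist_int_diff[of x y] by (auto simp: max_def abs_if split: if_splits)
  qed simp
  then show ?thesis by (simp add: push_def[abs_def])
qed

lemma push_fix: "dist_int x \<ge> \<rho> \<Longrightarrow> push \<rho> x = x"
  by (simp add: push_def)

lemma push_ge: "push \<rho> x \<ge> x + (\<rho> - dist_int x) / 2" "push \<rho> x \<ge> x"
  by (simp_all add: push_def max_def field_simps)

lemma push_NH_on: "push \<rho> \<in> NH_on {x. dist_int x < \<rho>}"
  by (auto simp: NH_on_def push_NH push_fix)

text \<open>A suitable power of \<open>push \<rho>\<close> carries the whole
  \<open>\<rho>'\<close>-neighbourhood of each integer to the right of itself. The next half-integer
  is a fixed point, since its distance to the integers is \<open>1/2 \<ge> \<rho>\<close>, so
  further iterates can neither return nor reach the neighbourhood of the next integer.\<close>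

lemma displacing_map:
  assumes "0 < \<rho>'" "\<rho>' < \<rho>" "\<rho> \<le> 1/2"
  obtains h where "h \<in> NH_on {x. dist_int x < \<rho>}"
    "\<And>j x. dist_int x < \<rho>' \<Longrightarrow> dist_int ((h ^^ Suc j) x) \<ge> \<rho>'"
proof -
  let ?t = "push \<rho>" and ?d = "(\<rho> - \<rho>') / 2"
  have "?d > 0" using assms by simp
  from reals_Archimedean3[OF this] have "\<exists>n::nat. 2 * \<rho>' < n * ?d" by (rule spec)
  \<comment> \<open>Inside the neighbourhood, which has width \<open>2 * \<rho>'\<close>, every
    application of \<open>push \<rho>\<close> advances by at least \<open>?d\<close>. Hence
    \<open>n\<close> steps are enough to leave it.\<close>
  then obtain n :: nat where n: "2 * \<rho>' < n * ?d" by (rule exE)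
  then have "n > 0" using assms by (cases n) auto
  have iter: "min (m + \<rho>') (x + k * ?d) \<le> (?t ^^ k) x \<and> (?t ^^ k) x \<le> m + 1/2"
    if "\<bar>x - of_int m\<bar> < \<rho>'" for x k and m :: int
  proof (induction k)
    case 0
    then show ?case using that assms by auto
  next
    case (Suc k)
    define y where "y = (?t ^^ k) x"
    have y: "min (m + \<rho>') (x + k * ?d) \<le> y" "y \<le> m + 1/2" using Suc by (simp_all add: y_def)
    have "dist_int (of_int m + 1/2) = 1/2"
      using dist_int_near[of "of_int m + 1/2" m] by simp
    then have "?t (of_int m + 1/2) = of_int m + 1/2" using assms by (simp add: push_fix)
    then have "?t y \<le> of_int m + 1/2"
      using NH_le[OF push_NH, of \<rho> y "of_int m + 1/2"] y by simp
    moreover have "min (m + \<rho>') (x + Suc k * ?d) \<le> ?t y"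
    proof (cases "y \<ge> m + \<rho>'")
      case True
      then show ?thesis using push_ge(2)[of y \<rho>] by linarith
    next
      case False
      then have ge: "x + k * ?d \<le> y" using y by auto
      moreover have "k * ?d \<ge> 0" using assms by simp
      ultimately have "\<bar>y - of_int m\<bar> < \<rho>'" using that False by auto
      then have "dist_int y < \<rho>'" using dist_int_le[of y m] by simp
      then have "?t y \<ge> y + ?d" using push_ge(1)[of y \<rho>] by (auto simp: field_simps)
      moreover have "Suc k * ?d = k * ?d + ?d" by (simp add: distrib_right)
      ultimately show ?thesis using ge by linarith
    qed
    ultimately show ?case by (simp add: y_def)
  qed
  show thesis
  proof (rule that[of "?t ^^ n"])
    show "?t ^^ n \<in> NH_on {x. dist_int x < \<rho>}" by (intro NH_on_funpow push_NH_on)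
    fix j x assume x: "dist_int x < \<rho>'"
    obtain m where m: "dist_int x = \<bar>x - of_int m\<bar>" by (rule dist_int_obtain)
    let ?k = "Suc j * n"
    have "n * ?d \<le> ?k * ?d" using assms by (intro mult_right_mono) auto
    then have "m + \<rho>' \<le> x + ?k * ?d" using m x n by linarith
    then have "m + \<rho>' \<le> (?t ^^ ?k) x" "(?t ^^ ?k) x \<le> m + 1/2"
      using iter[of x m ?k] m x by auto
    then have "dist_int ((?t ^^ ?k) x) \<ge> \<rho>'"
      using dist_int_near[of "(?t ^^ ?k) x" m] assms by simp
    then show "dist_int (((?t ^^ n) ^^ Suc j) x) \<ge> \<rho>'"
      by (metis funpow_mult mult.commute)
  qed
qed

section \<open>Length functions are bounded\<close>

text \<open>The distance to the identity in a left-invariant metric and the word length for a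
  generating set are the intended instances.\<close>

locale NH_length =
  fixes L :: "(real \<Rightarrow> real) \<Rightarrow> real"
  assumes L_comp: "f \<in> NH \<Longrightarrow> g \<in> NH \<Longrightarrow> L (f \<circ> g) \<le> L f + L g"
    and L_inv: "f \<in> NH \<Longrightarrow> L (rinv f) \<le> L f"
begin

lemma L_comp3:
  assumes "f \<in> NH" "g \<in> NH" "h \<in> NH" shows "L (f \<circ> g \<circ> h) \<le> L f + L g + L h"
  using L_comp[of "f \<circ> g" h] L_comp[of f g] assms by simp

text \<open>A change of coordinates by a fixed \<open>h\<close> costs only a constant, so that
  boundedness may be proved in whatever coordinates are convenient.\<close>

lemma L_conj_le:
  assumes "h \<in> NH" "f \<in> NH" shows "L f \<le> L (conj_by h f) + 2 * L h"
proof -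
  have "f = rinv h \<circ> conj_by h f \<circ> h"
    using assms by (auto simp: conj_by_def)
  moreover have "conj_by h f \<in> NH" using assms by (simp add: conj_by_def)
  ultimately show ?thesis
    using L_comp3[of "rinv h" "conj_by h f" h] L_inv[of h] assms by simp
qed

text \<open>If \<open>s\<close> displaces \<open>E\<close> inside \<open>D\<close> and \<open>c\<close> displaces \<open>D\<close>, then any sequence \<open>f i\<close> supported in
  \<open>E\<close> can be encoded in a single map \<open>F\<close>, acting as a copy of \<open>f i\<close> on all sets
  \<open>c\<^sup>i (s\<^sup>k E)\<close>. The copy of \<open>s\<close> on \<open>c\<^sup>i D\<close> shifts only the \<open>i\<close>-th row, so its commutator with \<open>F\<close>
  is a conjugate of \<open>f i\<close>. Hence the length of \<open>f i\<close> cannot grow arbitrarily fast.\<close>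

lemma bounded_on_displaced:
  assumes c: "c \<in> NH" and s: "s \<in> NH_on D" and ED: "E \<subseteq> D" and opE: "open E"
    and sE: "\<And>j x. x \<in> E \<Longrightarrow> (s ^^ Suc j) x \<notin> E"
    and cD: "\<And>j x. x \<in> D \<Longrightarrow> (c ^^ Suc j) x \<notin> D"
  obtains C where "\<And>f. f \<in> NH_on E \<Longrightarrow> L f \<le> C"
proof (rule ccontr)
  assume "\<not> thesis"
  have unbdd: "\<exists>f\<in>NH_on E. L f > C" for C
  proof (rule ccontr)
    assume "\<not> (\<exists>f\<in>NH_on E. L f > C)"
    then have "L f \<le> C" if "f \<in> NH_on E" for f using that by (auto simp: not_less)
    then have thesis by (rule that)
    with \<open>\<not> thesis\<close> show False ..
  qed
  have sNH: "s \<in> NH" using s by (rule NH_on_NH)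
  define si where "si i = conj_by (c ^^ i) s" for i :: nat
  \<comment> \<open>The right-hand side anticipates the final estimate: apart from the constant
    \<open>2 * L F\<close> it contains exactly the terms that will bound \<open>L (f i)\<close>,
    plus \<open>i\<close>.\<close>
  have "\<forall>i::nat. \<exists>f. f \<in> NH_on E \<and> L f > 2 * L (si i) + 2 * L (c ^^ i) + real i"
    using unbdd by blast
  from choice[OF this] obtain f where fE: "\<And>i. f i \<in> NH_on E"
    and fbig: "\<And>i. L (f i) > 2 * L (si i) + 2 * L (c ^^ i) + real i"
    by blast
  have fNH: "f i \<in> NH" for i using fE NH_on_NH by blast
  define h where "h p = (c ^^ fst p) \<circ> (s ^^ snd p)" for p :: "nat \<times> nat"
  define Ep where "Ep p = h p ` E" for p
  define fp where "fp p = conj_by (h p) (f (fst p))" for p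
  have hNH: "h p \<in> NH" for p using c sNH by (simp add: h_def)
  have siNH: "si i \<in> NH" for i using c sNH by (simp add: si_def conj_by_def)
  have si_on: "si i \<in> NH_on ((c ^^ i) ` D)" for i
    using c s by (simp add: si_def conj_by_NH_on)
  have disj_c: "(c ^^ i) x \<noteq> (c ^^ j) y" if "x \<in> D" "y \<in> D" "i < j" for i j x y
  proof
    assume eq: "(c ^^ i) x = (c ^^ j) y"
    obtain k where k: "j = i + Suc k" using \<open>i < j\<close> less_iff_Suc_add by auto
    have "(c ^^ i) x = (c ^^ i) ((c ^^ Suc k) y)" using eq unfolding k funpow_add by simp
    then have "x = (c ^^ Suc k) y" by (simp only: NH_eq[OF NH_funpow[OF c]])
    then show False using cD that by blast
  qed
  have disj_s: "(s ^^ i) x \<noteq> (s ^^ j) y" if "x \<in> E" "y \<in> E" "i < j" for i j x y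
  proof
    assume eq: "(s ^^ i) x = (s ^^ j) y"
    obtain k where k: "j = i + Suc k" using \<open>i < j\<close> less_iff_Suc_add by auto
    have "(s ^^ i) x = (s ^^ i) ((s ^^ Suc k) y)" using eq unfolding k funpow_add by simp
    then have "x = (s ^^ Suc k) y" by (simp only: NH_eq[OF NH_funpow[OF sNH]])
    then show False using sE that by blast
  qed
  have sD: "(s ^^ k) x \<in> D" if "x \<in> D" for k x
    using NH_on_mem[OF NH_on_funpow[OF s], of k x] that by simp
  have Ep_sub: "Ep p \<subseteq> (c ^^ fst p) ` D" for p
    using sD ED by (auto simp: Ep_def h_def)
  have rows: "(c ^^ i) ` D \<inter> (c ^^ j) ` D = {}" if "i \<noteq> j" for i j
  proof (rule ccontr)
    assume "(c ^^ i) ` D \<inter> (c ^^ j) ` D \<noteq> {}"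
    then obtain x y where "x \<in> D" "y \<in> D" "(c ^^ i) x = (c ^^ j) y" by blast
    then show False
      using that disj_c[of x y i j] disj_c[of y x j i] by (cases i j rule: linorder_cases) auto
  qed
  have disj: "disjoint_family Ep"
    unfolding disjoint_family_on_def
  proof (intro ballI impI)
    fix p q :: "nat \<times> nat" assume "p \<noteq> q"
    show "Ep p \<inter> Ep q = {}"
    proof (rule ccontr)
      assume "Ep p \<inter> Ep q \<noteq> {}"
      then obtain z where z: "z \<in> Ep p" "z \<in> Ep q" by blast
      obtain x y where xy: "x \<in> E" "z = h p x" "y \<in> E" "z = h q y"
        using z unfolding Ep_def by blast
      have "z \<in> (c ^^ fst p) ` D \<inter> (c ^^ fst q) ` D"
        using z Ep_sub[of p] Ep_sub[of q] by blast
      then have fst: "fst p = fst q" using rows[of "fst p" "fst q"] by auto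
      then have ne: "snd p \<noteq> snd q" using \<open>p \<noteq> q\<close> by (simp add: prod_eq_iff)
      have "(c ^^ fst q) ((s ^^ snd p) x) = (c ^^ fst q) ((s ^^ snd q) y)"
        using xy fst by (simp add: h_def)
      then have "(s ^^ snd p) x = (s ^^ snd q) y"
        by (simp only: NH_eq[OF NH_funpow[OF c]])
      then show False
        using ne disj_s[of x y "snd p" "snd q"] disj_s[of y x "snd q" "snd p"] xy
        by (cases "snd p" "snd q" rule: linorder_cases) auto
    qed
  qed
  have fpE: "fp p \<in> NH_on (Ep p)" for p
    using hNH fE by (simp add: fp_def Ep_def conj_by_NH_on)
  have opEp: "open (Ep p)" for p
    using hNH opE by (simp add: Ep_def NH_open_image)
  define F where "F = glue Ep fp"
  have FNH: "F \<in> NH" unfolding F_def by (intro glue_NH disj opEp fpE)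
  have Fin: "F x = fp p x" if "x \<in> Ep p" for x p
    unfolding F_def using disj that by (rule glue_in)
  have Fout: "F x = x" if "\<And>p. x \<notin> Ep p" for x
    unfolding F_def using that by (rule glue_out)
  have fph: "fp p (h p e) = h p (f (fst p) e)" for p e
    using hNH by (simp add: fp_def conj_by_def)
  have sih: "si i (h (i, k) e) = h (i, Suc k) e" for i k e
    using c by (simp add: si_def conj_by_def h_def)
  have si_Ep: "si i x \<in> Ep (i, Suc k)" if "x \<in> Ep (i, k)" for i k x
    using that sih by (auto simp: Ep_def)
  have si_Ep': "x \<in> Ep (i, k)" if "si i x \<in> Ep (i, Suc k)" for i k x
  proof -
    from that have "si i x \<in> h (i, Suc k) ` E" by (simp only: Ep_def)
    then obtain e where e: "e \<in> E" "si i x = h (i, Suc k) e" by blast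
    then have "si i x = si i (h (i, k) e)" by (simp add: sih)
    then have "x = h (i, k) e" by (simp only: NH_eq[OF siNH])
    then show ?thesis using e by (auto simp: Ep_def)
  qed
  \<comment> \<open>Conjugating \<open>F\<close> by the shift \<open>si i\<close> moves the copies
    in row \<open>i\<close> from column \<open>k\<close> to column \<open>Suc k\<close> and leaves
    all other rows alone. Column 0 becomes empty, and \<open>fp (i, 0)\<close> is precisely the
    missing copy.\<close>
  have key: "F (si i x) = fp (i, 0) (si i (F x))" for i x
  proof -
    have f0: "fp (i, 0) y = y" if "y \<notin> Ep (i, 0)" for y
      using NH_on_fix[OF fpE] that by blast
    have other: "si i y = y" if "y \<in> Ep p" "fst p \<noteq> i" for y p
      using that rows[of i "fst p"] Ep_sub[of p] by (intro NH_on_fix[OF si_on]) blast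
    have not0: "y \<notin> Ep (i, 0)" if "y \<in> Ep p" "p \<noteq> (i, 0)" for y p
      using that disjoint_family_onD[OF disj, of p "(i, 0)"] by blast
    show ?thesis
    proof (cases "\<exists>p. x \<in> Ep p")
      case True
      then obtain i' k where x: "x \<in> Ep (i', k)" by auto
      have Fx: "F x = fp (i', k) x" using x by (rule Fin)
      have FxE: "F x \<in> Ep (i', k)" using x NH_on_mem[OF fpE] by (simp add: Fx)
      show ?thesis
      proof (cases "i' = i")
        case True
        obtain e where e: "e \<in> E" "x = h (i, k) e" using x True by (auto simp: Ep_def)
        have 1: "si i x \<in> Ep (i, Suc k)" "si i (F x) \<in> Ep (i, Suc k)"
          using x FxE True si_Ep by auto
        have "F (si i x) = fp (i, Suc k) (h (i, Suc k) e)" using Fin[OF 1(1)] e by (simp add: sih)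
        also have "\<dots> = h (i, Suc k) (f i e)" by (simp add: fph)
        also have "\<dots> = si i (F x)"
        proof -
          have "F x = h (i, k) (f i e)" using Fx True e(2) by (simp add: fph)
          then show ?thesis by (simp only: sih)
        qed
        also have "\<dots> = fp (i, 0) (si i (F x))" using f0 not0[OF 1(2)] by simp
        finally show ?thesis .
      next
        case False
        then have "si i x = x" "si i (F x) = F x" using other[OF x] other[OF FxE] by auto
        moreover have "F x \<notin> Ep (i, 0)" using not0[OF FxE] False by auto
        ultimately show ?thesis using f0 by simp
      qed
    next
      case False
      then have Fx: "F x = x" using Fout by blast
      show ?thesis
      proof (cases "si i x \<in> Ep (i, 0)")
        case True
        then show ?thesis using Fin[OF True] Fx by simp
      next
        case notin: False
        have "si i x \<notin> Ep p" for p
        proof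
          assume p: "si i x \<in> Ep p"
          show False
          proof (cases "fst p = i")
            case True
            then obtain k where "p = (i, Suc k)" using p notin by (cases p; cases "snd p") auto
            then show False using si_Ep' p False by blast
          next
            case F: False
            then have "si i (si i x) = si i x" using other[OF p] by blast
            then have "si i x = x" by (simp only: NH_eq[OF siNH])
            then have "x \<in> Ep p" using p by (simp only:)
            then show False using False by blast
          qed
        qed
        then have "F (si i x) = si i x" by (rule Fout)
        then show ?thesis using f0[OF notin] Fx by simp
      qed
    qed
  qed
  have bound: "L (f i) \<le> 2 * L F + 2 * L (si i) + 2 * L (c ^^ i)" for i
  proof -
    have "fp (i, 0) = (F \<circ> si i \<circ> rinv F) \<circ> rinv (si i)"
    proof
      fix y
      have "F (si i (rinv F (rinv (si i) y))) = fp (i, 0) y"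
        using FNH siNH by (subst key) simp
      then show "fp (i, 0) y = ((F \<circ> si i \<circ> rinv F) \<circ> rinv (si i)) y" by simp
    qed
    then have "L (fp (i, 0)) \<le> L (F \<circ> si i \<circ> rinv F) + L (rinv (si i))"
      using FNH siNH by (simp only:) (intro L_comp NH_comp NH_inv)
    also have "\<dots> \<le> (L F + L (si i) + L (rinv F)) + L (rinv (si i))"
      using FNH siNH by (intro add_right_mono L_comp3 NH_inv)
    also have "\<dots> \<le> 2 * L F + 2 * L (si i)"
      using L_inv[OF FNH] L_inv[OF siNH[of i]] by simp
    finally have "L (fp (i, 0)) \<le> 2 * L F + 2 * L (si i)" .
    moreover have "fp (i, 0) = conj_by (c ^^ i) (f i)" by (simp add: fp_def h_def)
    moreover have "L (f i) \<le> L (conj_by (c ^^ i) (f i)) + 2 * L (c ^^ i)"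
      using c fNH by (intro L_conj_le) auto
    ultimately show ?thesis by simp
  qed
  obtain i :: nat where "2 * L F < real i" using reals_Archimedean2 by blast
  then show False using bound[of i] fbig[of i] by simp
qed

text \<open>Three nested neighbourhoods of the integers are used: \<open>s\<close> lives on the one
  of radius 9/20 and displaces the one of radius 4/10, while \<open>c\<close> lives on the one of
  radius 1/2 and displaces the one of radius 9/20. The radius 4/10 is \<open>1/2 - 1/10\<close>, so
  that this neighbourhood together with its translate by 1/2 covers the line with room to
  spare.\<close>

lemma bounded_near_integers:
  obtains C where "\<And>f. f \<in> NH_on {x. dist_int x < 4/10} \<Longrightarrow> L f \<le> C"
proof -
  obtain s where s: "s \<in> NH_on {x. dist_int x < 9/20}"
    "\<And>j x. dist_int x < 4/10 \<Longrightarrow> dist_int ((s ^^ Suc j) x) \<ge> 4/10"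
    by (rule displacing_map[of "4/10" "9/20"]) auto
  obtain c where c: "c \<in> NH_on {x. dist_int x < 1/2}"
    "\<And>j x. dist_int x < 9/20 \<Longrightarrow> dist_int ((c ^^ Suc j) x) \<ge> 9/20"
    by (rule displacing_map[of "9/20" "1/2"]) auto
  show thesis
  proof (rule bounded_on_displaced[OF NH_on_NH[OF c(1)] s(1)])
    show "(s ^^ Suc j) x \<notin> {x. dist_int x < 4/10}" if "x \<in> {x. dist_int x < 4/10}" for j x
      using s(2)[of x j] that by simp
    show "(c ^^ Suc j) x \<notin> {x. dist_int x < 9/20}" if "x \<in> {x. dist_int x < 9/20}" for j x
      using c(2)[of x j] that by simp
  qed (use that open_dist_int_less[of "4/10"] in auto)
qed

text \<open>Clamping \<open>f\<close> between \<open>push (4/10)\<close> and its inverse does not change it near the integers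
  and makes it trivial away from them.\<close>

lemma bounded_displacement_tenth:
  obtains C where "\<And>f. f \<in> NH \<Longrightarrow> (\<And>x. \<bar>f x - x\<bar> \<le> 1/10) \<Longrightarrow> L f \<le> C"
proof -
  obtain C where C: "\<And>f. f \<in> NH_on {x. dist_int x < 4/10} \<Longrightarrow> L f \<le> C"
    by (rule bounded_near_integers) blast
  let ?T = "\<lambda>x::real. x + - (1/2)"
  have T: "?T \<in> NH" by (rule NH_translation)
  have invT: "rinv ?T x = x + 1/2" for x
    using NH_inv_f[OF T, of "x + 1/2"] by simp
  have "L f \<le> 2 * C + 2 * L ?T" if f: "f \<in> NH" and disp: "\<And>x. \<bar>f x - x\<bar> \<le> 1/10" for f
  proof -
    let ?u = "push (4/10)"
    define g where "g = (\<lambda>x. max (rinv ?u x) (min (f x) (?u x)))"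
    define g' where "g' = rinv g \<circ> f"
    have gNH: "g \<in> NH"
      unfolding g_def using f push_NH[of "4/10"] by (intro NH_max NH_min NH_inv)
    have "g x = x" if "dist_int x \<ge> 4/10" for x
    proof -
      have "?u x = x" using that by (rule push_fix)
      moreover from this have "rinv ?u x = x" using NH_inv_f[OF push_NH, of "4/10" x] by simp
      ultimately show ?thesis by (simp add: g_def)
    qed
    then have g: "g \<in> NH_on {x. dist_int x < 4/10}" using gNH by (auto simp: NH_on_def not_less)
    \<comment> \<open>Within 1/10 of an integer the clamps are inactive. There
      \<open>push (4/10)\<close> moves \<open>x\<close> by at least 3/20, and it moves
      \<open>x - 1/10\<close>, which is within 2/10 of an integer, by at least 1/10;
      \<open>f\<close> moves points by at most 1/10.\<close>
    have gf: "g x = f x" if "dist_int x \<le> 1/10" for x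
    proof -
      have "dist_int (x - 1/10) \<le> 2/10" using dist_int_diff[of x "x - 1/10"] that by linarith
      then have "x \<le> ?u (x - 1/10)" using push_ge(1)[of "x - 1/10" "4/10"] by argo
      then have "rinv ?u x \<le> x - 1/10" by (simp only: NH_inv_le[OF push_NH])
      moreover have "x - 1/10 \<le> f x" using disp[of x] by linarith
      ultimately have "rinv ?u x \<le> f x" by (rule order_trans)
      moreover have "f x \<le> ?u x" using push_ge(1)[of x "4/10"] that disp[of x] by argo
      ultimately show ?thesis by (simp add: g_def)
    qed
    have g'NH: "g' \<in> NH" unfolding g'_def using gNH f by simp
    have "g' x = x" if "dist_int x \<le> 1/10" for x
      using gNH by (simp add: g'_def gf[OF that, symmetric])
    \<comment> \<open>The distances of \<open>x\<close> and \<open>x + 1/2\<close> to the integers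
      add up to 1/2. Hence the remainder, trivial near the integers, becomes after translation by
      1/2 a map supported near them, to which the constant \<open>C\<close> applies again.\<close>
    then have "g' (x + 1/2) = x + 1/2" if "dist_int x \<ge> 4/10" for x
      using that dist_int_half[of x] by simp
    then have "conj_by ?T g' x = x" if "dist_int x \<ge> 4/10" for x
      using that unfolding conj_by_def o_apply invT by simp
    moreover have "conj_by ?T g' \<in> NH" using g'NH T by (simp add: conj_by_def)
    ultimately have "L (conj_by ?T g') \<le> C" by (intro C) (auto simp: NH_on_def not_less)
    then have "L g' \<le> C + 2 * L ?T" using L_conj_le[OF T g'NH] by simp
    moreover have "f = g \<circ> g'" using gNH by (auto simp: g'_def)
    moreover have "L (g \<circ> g') \<le> L g + L g'" using gNH g'NH by (rule L_comp)
    ultimately show ?thesis using C[OF g] by simp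
  qed
  then show thesis by (rule that)
qed

text \<open>Conjugation by the dilation of factor \<open>1 / (10 * r)\<close> scales displacements
  from \<open>r\<close> down to 1/10.\<close>

lemma bounded_displacement:
  assumes "r > 0"
  obtains C where "\<And>f. f \<in> NH \<Longrightarrow> (\<And>x. \<bar>f x - x\<bar> \<le> r) \<Longrightarrow> L f \<le> C"
proof -
  obtain C where C: "\<And>f. f \<in> NH \<Longrightarrow> (\<And>x. \<bar>f x - x\<bar> \<le> 1/10) \<Longrightarrow> L f \<le> C"
    by (rule bounded_displacement_tenth) blast
  define m where "m = (\<lambda>x. 1 / (10 * r) * x)"
  have m: "m \<in> NH" unfolding m_def using assms by (intro NH_scaling) simp
  have invm: "rinv m x = 10 * r * x" for x
    using NH_inv_f[OF m, of "10 * r * x"] assms by (simp add: m_def)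
  have "L f \<le> C + 2 * L m" if f: "f \<in> NH" and disp: "\<And>x. \<bar>f x - x\<bar> \<le> r" for f
  proof -
    have "\<bar>conj_by m f x - x\<bar> \<le> 1/10" for x
    proof -
      have "conj_by m f x = 1 / (10 * r) * f (10 * r * x)"
        by (simp only: conj_by_def o_apply invm) (simp only: m_def)
      then have "conj_by m f x - x = (f (10 * r * x) - 10 * r * x) / (10 * r)"
        using assms by (simp add: diff_divide_distrib)
      then have "\<bar>conj_by m f x - x\<bar> = \<bar>f (10 * r * x) - 10 * r * x\<bar> / (10 * r)"
        using assms by (simp add: abs_divide)
      also have "\<dots> \<le> r / (10 * r)"
        using assms by (intro divide_right_mono disp) simp
      finally show ?thesis using assms by simp
    qed
    then have "L (conj_by m f) \<le> C" using f m by (intro C) (auto simp: conj_by_def)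
    then show ?thesis using L_conj_le[OF m f] by simp
  qed
  then show thesis by (rule that)
qed

end

section \<open>Taming sequences of maps\<close>

definition interp :: "(int \<Rightarrow> real) \<Rightarrow> real \<Rightarrow> real" where
  "interp q x = q \<lfloor>x\<rfloor> + (x - \<lfloor>x\<rfloor>) * (q (\<lfloor>x\<rfloor> + 1) - q \<lfloor>x\<rfloor>)"

lemma interp_of_int [simp]: "interp q (of_int k) = q k"
  by (simp add: interp_def)

lemma interp_on_unit:
  assumes "real_of_int k \<le> x" "x \<le> real_of_int k + 1"
  shows "interp q x = q k + (x - k) * (q (k + 1) - q k)"
proof (cases "x = real_of_int k + 1")
  case True
  then have "\<lfloor>x\<rfloor> = k + 1" by simp
  then show ?thesis using True by (simp add: interp_def)
next
  case False
  then have "\<lfloor>x\<rfloor> = k" using assms by (simp add: floor_eq_iff)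
  then show ?thesis by (simp add: interp_def)
qed

text \<open>Gaps of at least 1 between consecutive nodes make all slopes at least 1. On each cell
  the map is affine, hence Lipschitz there, even if the slopes are unbounded as a whole.\<close>

lemma interp_NH:
  assumes q: "\<And>k. q (k + 1) \<ge> q k + 1"
  shows "interp q \<in> NH"
proof (rule NH_expanding[where c = 1])
  have q_le: "q j + (k - j) \<le> q k" if "j \<le> k" for j k
    using that
  proof (induction k rule: int_ge_induct)
    case (step i)
    then show ?case using q[of i] by simp
  qed simp
  show "1 * (y - x) \<le> interp q y - interp q x" if "x < y" for x y
  proof -
    \<comment> \<open>The claim says that \<open>?d\<close> is nondecreasing. On a cell it lies
      between its values at the two endpoints, and along the integers it is nondecreasing; this
      settles the case of points in different cells.\<close>
    let ?d = "\<lambda>t. interp q t - t"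
    have lo: "q \<lfloor>t\<rfloor> - \<lfloor>t\<rfloor> \<le> ?d t" for t
    proof -
      have "(t - \<lfloor>t\<rfloor>) * 1 \<le> (t - \<lfloor>t\<rfloor>) * (q (\<lfloor>t\<rfloor> + 1) - q \<lfloor>t\<rfloor>)"
        using q[of "\<lfloor>t\<rfloor>"] by (intro mult_left_mono) auto
      then show ?thesis by (simp add: interp_def)
    qed
    have up: "?d t \<le> q (\<lfloor>t\<rfloor> + 1) - (\<lfloor>t\<rfloor> + 1)" for t
    proof -
      have "(1 - (t - \<lfloor>t\<rfloor>)) * 1 \<le> (1 - (t - \<lfloor>t\<rfloor>)) * (q (\<lfloor>t\<rfloor> + 1) - q \<lfloor>t\<rfloor>)"
        using q[of "\<lfloor>t\<rfloor>"] by (intro mult_left_mono) (auto, linarith)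
      then show ?thesis by (simp add: interp_def algebra_simps)
    qed
    show ?thesis
    proof (cases "\<lfloor>x\<rfloor> = \<lfloor>y\<rfloor>")
      case True
      have "(y - x) * 1 \<le> (y - x) * (q (\<lfloor>x\<rfloor> + 1) - q \<lfloor>x\<rfloor>)"
        using q[of "\<lfloor>x\<rfloor>"] that by (intro mult_left_mono) auto
      then show ?thesis using True by (simp add: interp_def algebra_simps)
    next
      case False
      then have "\<lfloor>x\<rfloor> + 1 \<le> \<lfloor>y\<rfloor>" using floor_mono[of x y] that by simp
      from q_le[OF this] have "q (\<lfloor>x\<rfloor> + 1) - (\<lfloor>x\<rfloor> + 1) \<le> q \<lfloor>y\<rfloor> - \<lfloor>y\<rfloor>" by simp
      then show ?thesis using lo[of y] up[of x] by simp
    qed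
  qed
  show "\<exists>x. interp q x = y" for y
  proof -
    have "q (- \<lceil>\<bar>y - q 0\<bar>\<rceil>) \<le> y"
    proof -
      have "- \<lceil>\<bar>y - q 0\<bar>\<rceil> \<le> 0" by (simp add: le_ceiling_iff)
      from q_le[OF this] have "q (- \<lceil>\<bar>y - q 0\<bar>\<rceil>) + \<lceil>\<bar>y - q 0\<bar>\<rceil> \<le> q 0" by simp
      then show ?thesis using le_of_int_ceiling[of "\<bar>y - q 0\<bar>"] by linarith
    qed
    moreover have "k \<le> \<lceil>\<bar>y - q 0\<bar>\<rceil>" if "q k \<le> y" for k
    proof (cases "k \<ge> 0")
      case True
      then have "k \<le> y - q 0" using q_le[of 0 k] that by simp
      also have "\<dots> \<le> \<lceil>\<bar>y - q 0\<bar>\<rceil>" using le_of_int_ceiling[of "\<bar>y - q 0\<bar>"] by linarith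
      finally show ?thesis by simp
    next
      case False
      have "\<lceil>\<bar>y - q 0\<bar>\<rceil> \<ge> 0" by simp
      then show ?thesis using False by linarith
    qed
    \<comment> \<open>The indices with \<open>q k \<le> y\<close> are nonempty and bounded above.
      Were there no last one, an upward induction would contradict the bound.\<close>
    ultimately obtain k where k: "q k \<le> y" "\<not> q (k + 1) \<le> y"
    proof -
      assume *: "q (- \<lceil>\<bar>y - q 0\<bar>\<rceil>) \<le> y" "\<And>k. q k \<le> y \<Longrightarrow> k \<le> \<lceil>\<bar>y - q 0\<bar>\<rceil>"
        and th: "\<And>k. q k \<le> y \<Longrightarrow> \<not> q (k + 1) \<le> y \<Longrightarrow> thesis"
      show thesis
      proof (rule ccontr)
        assume "\<not> thesis"
        then have st: "q (k + 1) \<le> y" if "q k \<le> y" for k using th[of k] that by blast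
        have ge: "q k \<le> y" if "k \<ge> - \<lceil>\<bar>y - q 0\<bar>\<rceil>" for k
          using that by (induction k rule: int_ge_induct) (use *(1) st in auto)
        have "0 \<le> \<lceil>\<bar>y - q 0\<bar>\<rceil>" by simp
        then have "q (\<lceil>\<bar>y - q 0\<bar>\<rceil> + 1) \<le> y" by (intro ge) linarith
        then show False using *(2) by fastforce
      qed
    qed
    define x where "x = k + (y - q k) / (q (k + 1) - q k)"
    have pos: "q (k + 1) - q k > 0" using q[of k] by simp
    have "k \<le> x" "x \<le> k + 1" using k pos by (simp_all add: x_def field_simps)
    then have "interp q x = y" using pos by (simp add: interp_on_unit) (simp add: x_def)
    then show ?thesis ..
  qed
  show "\<exists>B. \<forall>x\<in>{real_of_int k..real_of_int k + 1}. \<forall>y\<in>{real_of_int k..real_of_int k + 1}.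
      \<bar>interp q x - interp q y\<bar> \<le> B * \<bar>x - y\<bar>" for k
  proof (intro exI ballI)
    fix x y assume "x \<in> {real_of_int k..real_of_int k + 1}" "y \<in> {real_of_int k..real_of_int k + 1}"
    then have "interp q x - interp q y = (q (k + 1) - q k) * (x - y)"
      using interp_on_unit[of k x q] interp_on_unit[of k y q] by (simp add: algebra_simps)
    then show "\<bar>interp q x - interp q y\<bar> \<le> \<bar>q (k + 1) - q k\<bar> * \<bar>x - y\<bar>"
      by (simp add: abs_mult)
  qed
qed simp

text \<open>A single change of coordinates tames a whole sequence: the points \<open>q k\<close> are chosen so sparse
  that \<open>f n\<close> moves \<open>q k\<close> to a point between \<open>q (k - 1)\<close> and \<open>q (k + 1)\<close> as soon as \<open>\<bar>k\<bar> \<ge> n\<close>.\<close>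

lemma common_taming:
  assumes f: "\<And>n::nat. f n \<in> NH"
  obtains \<gamma> where "\<gamma> \<in> NH" "\<And>n x. \<bar>conj_by \<gamma> (f n) x - x\<bar> \<le> 2 * real n + 2"
proof -
  \<comment> \<open>The inverses are included for the bounds towards the centre: for positive
    \<open>k\<close> the inequality \<open>q (k - 1) \<le> f n (q k)\<close> amounts to
    \<open>rinv (f n) (q (k - 1)) \<le> q k\<close>. Since step \<open>Suc k\<close> of
    \<open>p\<close> takes account only of the maps with index at most \<open>Suc k\<close>, the
    control of \<open>f n\<close> starts at \<open>\<bar>k\<bar> \<ge> n\<close>.\<close>
  define a where "a n y = \<bar>f n y\<bar> + \<bar>f n (- y)\<bar> + \<bar>rinv (f n) y\<bar> + \<bar>rinv (f n) (- y)\<bar>" for n y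
  define p where "p = rec_nat 0 (\<lambda>k y. 1 + y + (\<Sum>n\<le>Suc k. a n y))"
  have p0: "p 0 = 0" and pS: "p (Suc k) = 1 + p k + (\<Sum>n\<le>Suc k. a n (p k))" for k
    by (simp_all add: p_def)
  have a0: "a n y \<ge> 0" for n y by (simp add: a_def)
  have p_nonneg: "p k \<ge> 0" for k
    by (induction k) (auto simp: p0 pS a0 intro!: add_nonneg_nonneg sum_nonneg)
  have p_step: "p (Suc k) \<ge> p k + 1" for k
    using sum_nonneg[of "{..Suc k}" "\<lambda>n. a n (p k)"] a0 by (simp add: pS)
  have p_a: "a n (p k) \<le> p (Suc k)" if "n \<le> Suc k" for n k
  proof -
    have "a n (p k) \<le> (\<Sum>n\<le>Suc k. a n (p k))"
      using that a0 by (intro member_le_sum) auto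
    then show ?thesis using p_nonneg[of k] by (simp add: pS)
  qed
  define q where "q k = (if k \<ge> 0 then p (nat k) else - p (nat (- k)))" for k
  have q_pos: "q (int m) = p m" and q_neg: "q (- int m) = - p m" for m
    using p0 by (auto simp: q_def)
  have int_cases2: "(\<exists>m. k = int m) \<or> (\<exists>m. k = - int (Suc m))" for k
    by (metis int_cases)
  have q_step: "q (k + 1) \<ge> q k + 1" for k
    using int_cases2[of k]
  proof (elim disjE exE)
    fix m assume k: "k = int m"
    then have "k + 1 = int (Suc m)" by simp
    then show ?thesis using p_step[of m] by (simp only: k q_pos)
  next
    fix m assume k: "k = - int (Suc m)"
    then have "k + 1 = - int m" by simp
    then show ?thesis using p_step[of m] by (simp only: k q_neg)
  qed
  define g where "g = interp q"
  have g: "g \<in> NH" unfolding g_def by (rule interp_NH) (rule q_step)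
  have gk: "g (of_int k) = q k" for k by (simp add: g_def)
  have up: "f n (q k) \<le> q (k + 1)" if "\<bar>k\<bar> \<ge> int n" for n k
    using int_cases2[of k]
  proof (elim disjE exE)
    fix m assume k: "k = int m"
    then have "k + 1 = int (Suc m)" by simp
    moreover have "n \<le> Suc m" using that k by simp
    ultimately show ?thesis using p_a[of n m] by (simp only: k q_pos) (simp add: a_def)
  next
    fix m assume k: "k = - int (Suc m)"
    then have k1: "k + 1 = - int m" by simp
    have "n \<le> Suc m" using that k by simp
    then have "- p (Suc m) \<le> rinv (f n) (- p m)" using p_a[of n m] by (simp add: a_def)
    then have "f n (- p (Suc m)) \<le> - p m" using f by (simp add: NH_le_inv)
    then show ?thesis by (simp only: k1) (simp only: k q_neg)
  qed
  have lo: "q (k - 1) \<le> f n (q k)" if "\<bar>k\<bar> \<ge> int n" for n k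
  proof -
    have "(\<exists>m. k = int (Suc m)) \<or> (\<exists>m. k = - int m)"
      by (metis int_cases3 of_nat_0 minus_zero neg_0_equal_iff_equal old.nat.exhaust zero_less_iff_neq_zero of_nat_0_less_iff)
    then show ?thesis
    proof (elim disjE exE)
      fix m assume k: "k = int (Suc m)"
      then have k1: "k - 1 = int m" by simp
      have "n \<le> Suc m" using that k by simp
      then have "rinv (f n) (p m) \<le> p (Suc m)" using p_a[of n m] by (simp add: a_def)
      then have "p m \<le> f n (p (Suc m))" using f by (simp add: NH_inv_le)
      then show ?thesis by (simp only: k1) (simp only: k q_pos)
    next
      fix m assume k: "k = - int m"
      then have k1: "k - 1 = - int (Suc m)" by simp
      have "n \<le> Suc m" using that k by simp
      then have "- p (Suc m) \<le> f n (- p m)" using p_a[of n m] by (simp add: a_def)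
      then show ?thesis by (simp only: k1) (simp only: k q_neg)
    qed
  qed
  let ?h = "\<lambda>n. conj_by (rinv g) (f n)"
  have h: "?h n x = rinv g (f n (g x))" for n x
    using g by (simp add: conj_by_def NH_inv_inv)
  have hup: "?h n (of_int k) \<le> of_int k + 1" if "\<bar>k\<bar> \<ge> int n" for n k
    using g up[OF that] gk[of "k + 1"] by (simp add: h NH_inv_le gk)
  have hlo: "of_int k - 1 \<le> ?h n (of_int k)" if "\<bar>k\<bar> \<ge> int n" for n k
    using g lo[OF that] gk[of "k - 1"] by (simp add: h NH_le_inv gk)
  have hmono: "x \<le> y \<Longrightarrow> ?h n x \<le> ?h n y" for n x y
    using g f by (simp add: h NH_le)
  \<comment> \<open>Outside the interval from \<open>-n\<close> to \<open>n\<close> a point is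
    compared with neighbouring integers, which move by at most 1. Inside, monotonicity confines its
    image to the interval from \<open>-n - 1\<close> to \<open>n + 1\<close>, so the displacement is
    less than \<open>2 * n + 1\<close>.\<close>
  have "\<bar>?h n x - x\<bar> \<le> 2 * real n + 2" for n x
  proof -
    consider "x \<ge> n" | "x \<le> - n" | "- n < x" "x < n" by linarith
    then show ?thesis
    proof cases
      case 1
      then have "int n \<le> \<lfloor>x\<rfloor>" by (simp add: le_floor_iff)
      then have fl: "int n \<le> \<lfloor>x\<rfloor>" "int n \<le> \<bar>\<lfloor>x\<rfloor>\<bar>" "int n \<le> \<bar>\<lfloor>x\<rfloor> + 1\<bar>"
        by linarith+
      have "\<lfloor>x\<rfloor> - 1 \<le> ?h n x"
        using hlo[of n "\<lfloor>x\<rfloor>"] hmono[of "\<lfloor>x\<rfloor>" x n] fl by simp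
      moreover have "?h n x \<le> \<lfloor>x\<rfloor> + 2"
        using hup[of n "\<lfloor>x\<rfloor> + 1"] hmono[of x "\<lfloor>x\<rfloor> + 1" n] fl by simp
      ultimately show ?thesis by linarith
    next
      case 2
      then have "\<lceil>x\<rceil> \<le> - int n" by (simp add: ceiling_le_iff)
      then have fl: "int n \<le> \<bar>\<lceil>x\<rceil>\<bar>" "int n \<le> \<bar>\<lceil>x\<rceil> - 1\<bar>" by linarith+
      have "?h n x \<le> \<lceil>x\<rceil> + 1"
        using hup[of n "\<lceil>x\<rceil>"] hmono[of x "\<lceil>x\<rceil>" n] fl by simp
      moreover have "\<lceil>x\<rceil> - 2 \<le> ?h n x"
        using hlo[of n "\<lceil>x\<rceil> - 1"] hmono[of "\<lceil>x\<rceil> - 1" x n] fl by simp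
      ultimately show ?thesis by linarith
    next
      case 3
      have "?h n x \<le> n + 1"
        using hup[of n "int n"] hmono[of x n n] 3 by simp
      moreover have "- n - 1 \<le> ?h n x"
        using hlo[of n "- int n"] hmono[of "- n" x n] 3 by simp
      ultimately show ?thesis using 3 by linarith
    qed
  qed
  then show thesis using g by (intro that[of "rinv g"]) auto
qed

context NH_length begin

text \<open>If \<open>L\<close> were unbounded, \<open>f n\<close> could be chosen longer than
  \<open>K n + n\<close>, where \<open>K n\<close> bounds the length of all maps of displacement at
  most \<open>2 * n + 2\<close>. A common \<open>\<gamma>\<close> brings every \<open>f n\<close>
  under its bound \<open>K n\<close> at the fixed price \<open>2 * L \<gamma>\<close>, which would
  then exceed every \<open>n\<close>.\<close>

lemma bounded:
  obtains C where "\<And>f. f \<in> NH \<Longrightarrow> L f \<le> C"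
proof (rule ccontr)
  assume nt: "\<not> thesis"
  have unbdd: "\<exists>f. f \<in> NH \<and> L f > C" for C
  proof (rule ccontr)
    assume "\<not> (\<exists>f. f \<in> NH \<and> L f > C)"
    then have "L f \<le> C" if "f \<in> NH" for f using that by (auto simp: not_less)
    then have thesis by (rule that)
    with nt show False ..
  qed
  have "\<exists>C. \<forall>f. f \<in> NH \<longrightarrow> (\<forall>x. \<bar>f x - x\<bar> \<le> 2 * real n + 2) \<longrightarrow> L f \<le> C" for n
  proof -
    have "2 * real n + 2 > 0" by simp
    then obtain C where "\<And>f. f \<in> NH \<Longrightarrow> (\<And>x. \<bar>f x - x\<bar> \<le> 2 * real n + 2) \<Longrightarrow> L f \<le> C"
      using bounded_displacement[of "2 * real n + 2"] by blast
    then show ?thesis by (intro exI[of _ C]) blast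
  qed
  then obtain K where K: "L f \<le> K n" if "f \<in> NH" "\<forall>x. \<bar>f x - x\<bar> \<le> 2 * real n + 2" for f n
    by metis
  have "\<forall>n. \<exists>f. f \<in> NH \<and> L f > K n + real n"
    using unbdd by blast
  from choice[OF this] obtain f where f: "f n \<in> NH" "L (f n) > K n + real n" for n
    by blast
  have "\<exists>\<gamma>\<in>NH. \<forall>n x. \<bar>conj_by \<gamma> (f n) x - x\<bar> \<le> 2 * real n + 2"
    by (rule common_taming[of f, OF f(1)]) blast
  then obtain \<gamma> where \<gamma>: "\<gamma> \<in> NH" "\<And>n x. \<bar>conj_by \<gamma> (f n) x - x\<bar> \<le> 2 * real n + 2"
    by blast
  have "real n < 2 * L \<gamma>" for n
  proof -
    have "L (conj_by \<gamma> (f n)) \<le> K n"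
      using \<gamma> f(1) by (intro K) (auto simp: conj_by_def)
    then show ?thesis using L_conj_le[OF \<gamma>(1) f(1)[of n]] f(2)[of n] by simp
  qed
  then show False using reals_Archimedean2[of "2 * L \<gamma>"] by (meson less_asym)
qed

end

section \<open>Absolute continuity and null sets\<close>

lemma strict_mono_on_image_box:
  fixes f :: "real \<Rightarrow> real"
  assumes f: "strict_mono_on {a..b} f" "continuous_on {a..b} f" and uv: "a \<le> u" "u \<le> v" "v \<le> b"
  shows "f ` {u<..<v} = {f u<..<f v}" "f ` {u..v} = {f u..f v}"
proof -
  have le: "f x \<le> f y \<longleftrightarrow> x \<le> y" if "x \<in> {a..b}" "y \<in> {a..b}" for x y
    using strict_mono_on_less_eq[OF f(1)] that by blast
  show 2: "f ` {u..v} = {f u..f v}"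
  proof
    show "f ` {u..v} \<subseteq> {f u..f v}" using le uv by auto
    have "continuous_on {u..v} f" using f(2) by (rule continuous_on_subset) (use uv in auto)
    then show "{f u..f v} \<subseteq> f ` {u..v}" using IVT'[of f u _ v] uv by force
  qed
  have "inj_on f {u..v}"
    using strict_mono_on_imp_inj_on[OF f(1)] by (rule inj_on_subset) (use uv in auto)
  moreover have "{u<..<v} = {u..v} - {u, v}" "{f u<..<f v} = {f u..f v} - {f u, f v}" by auto
  ultimately show "f ` {u<..<v} = {f u<..<f v}"
    using 2 uv by (simp add: inj_on_image_set_diff[of f "{u..v}"])
qed

lemma measure_disjoint_intervals:
  fixes D :: "(real \<times> real) set"
  assumes "finite D" "\<And>u v. (u, v) \<in> D \<Longrightarrow> u \<le> v" "disjoint_family_on (\<lambda>(u, v). {u<..<v}) D"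
  shows "measure lebesgue (\<Union>(u, v)\<in>D. {u<..<v}) = (\<Sum>(u, v)\<in>D. v - u)"
proof -
  have "measure lebesgue (\<Union>p\<in>D. (\<lambda>(u, v). {u<..<v}) p) = (\<Sum>p\<in>D. measure lebesgue ((\<lambda>(u, v). {u<..<v}) p))"
    using assms by (intro measure_finite_Union) auto
  also have "\<dots> = (\<Sum>(u, v)\<in>D. v - u)"
    using assms(2) by (intro sum.cong) auto
  finally show ?thesis .
qed

text \<open>Lusin's property (N). A null set is enclosed in an open set of measure below
  \<open>\<delta>\<close> and covered there by countably many nonoverlapping intervals. Absolute
  continuity bounds the total length of the images for each finite subfamily by
  \<open>\<epsilon>\<close>, and this bound passes to the countable union.\<close>

lemma abs_cont_on_negligible_image:
  assumes ac: "abs_cont_on a b f" and f: "strict_mono_on {a..b} f" "continuous_on {a..b} f"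
    and N: "N \<subseteq> {a..b}" "negligible N"
  shows "negligible (f ` N)"
proof (cases "a < b")
  case False
  then have "N \<subseteq> {a}" using N by auto
  then have "finite (f ` N)" using finite_subset by blast
  then show ?thesis by (rule negligible_finite)
next
  case True
  let ?N = "N \<inter> {a<..<b}"
  have "negligible (f ` ?N)"
    unfolding negligible_outer_le
  proof (intro allI impI)
    fix \<epsilon> :: real assume "\<epsilon> > 0"
    from ac[unfolded abs_cont_on_def, rule_format, OF this] obtain \<delta> where \<delta>: "\<delta> > 0"
      and D: "\<And>D :: (real \<times> real) set. finite D \<and> (\<forall>(u, v)\<in>D. a \<le> u \<and> u < v \<and> v \<le> b) \<and>
        disjoint_family_on (\<lambda>(u, v). {u<..<v}) D \<and> (\<Sum>(u, v)\<in>D. v - u) < \<delta> \<Longrightarrow>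
        (\<Sum>(u, v)\<in>D. \<bar>f v - f u\<bar>) < \<epsilon>"
      by blast
    have negN: "negligible ?N" using N by (simp add: negligible_Int)
    obtain U where U: "open U" "?N \<subseteq> U" "U \<in> lmeasurable" "measure lebesgue U < \<delta>"
    proof -
      obtain U where U: "open U" "?N \<subseteq> U" "U - ?N \<in> lmeasurable" "emeasure lebesgue (U - ?N) < ennreal \<delta>"
        using sets_lebesgue_outer_open[OF negligible_imp_sets[OF negN] \<delta>] by blast
      have "U = (U - ?N) \<union> ?N" using U(2) by blast
      moreover have "(U - ?N) \<union> ?N \<in> lmeasurable"
        using U(3) negligible_imp_measurable[OF negN] by (rule fmeasurable.Un)
      ultimately have Um: "U \<in> lmeasurable" by simp
      have "measure lebesgue U = measure lebesgue (U - ?N)"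
        using negN Um by (intro measure_Diff_null_set[symmetric]) (auto simp: negligible_iff_null_sets)
      then have "measure lebesgue U < \<delta>"
        using U(3,4) \<delta> by (simp add: emeasure_eq_measure2 ennreal_less_iff)
      then show thesis using that U Um by blast
    qed
    let ?V = "U \<inter> {a<..<b}"
    \<comment> \<open>The covering lemma yields intervals tagged by points of \<open>?N\<close> and
      contained in the gauge at the tag. As the gauge at points of \<open>?N\<close> is all of
      \<open>?V\<close>, the intervals stay inside the open set of small measure.\<close>
    let ?g = "\<lambda>x. if x \<in> ?V then ?V else ball x 1"
    have gauge: "gauge ?g" using U(1) by (auto simp: gauge_def)
    have Nab: "?N \<subseteq> cbox a b" "box a b \<noteq> {}" using True by auto
    obtain \<D> where \<D>: "countable \<D>" "\<And>K. K \<in> \<D> \<Longrightarrow> interior K \<noteq> {} \<and> (\<exists>c d. K = cbox c d)"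
      "pairwise (\<lambda>A B. interior A \<inter> interior B = {}) \<D>"
      "\<And>K. K \<in> \<D> \<Longrightarrow> \<exists>x \<in> ?N \<inter> K. K \<subseteq> ?g x" "?N \<subseteq> \<Union>\<D>"
      by (rule covering_lemma[OF Nab gauge]) (rule that; assumption)
    define P where "P = {(u, v). u < v \<and> {u..v} \<in> \<D>}"
    have "inj_on (\<lambda>(u::real, v). {u..v}) P" by (auto simp: inj_on_def P_def Icc_eq_Icc)
    moreover have "(\<lambda>(u, v). {u..v}) ` P \<subseteq> \<D>" by (auto simp: P_def)
    ultimately have "countable P"
      using \<D>(1) by (metis countable_image_inj_on countable_subset)
    have PV: "{u..v} \<subseteq> ?V" "u < v" if "(u, v) \<in> P" for u v
    proof -
      have "{u..v} \<in> \<D>" "u < v" using that by (auto simp: P_def)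
      obtain x where x: "x \<in> ?N \<inter> {u..v}" "{u..v} \<subseteq> ?g x"
        using \<D>(4)[OF \<open>{u..v} \<in> \<D>\<close>] by blast
      have "x \<in> ?V" using x(1) U(2) by blast
      then have "?g x = ?V" by simp
      then show "{u..v} \<subseteq> ?V" using x(2) by simp
      show "u < v" by fact
    qed
    have ab: "a \<le> u \<and> u < v \<and> v \<le> b" if "(u, v) \<in> P" for u v
    proof -
      have "u \<in> {u..v}" "v \<in> {u..v}" using PV[OF that] by auto
      then have "u \<in> ?V" "v \<in> ?V" using PV(1)[OF that] by blast+
      then show ?thesis using PV(2)[OF that] by auto
    qed
    have disj: "disjoint_family_on (\<lambda>(u, v). {u<..<v}) P"
      unfolding disjoint_family_on_def
    proof (intro ballI impI)
      fix p p' assume p: "p \<in> P" "p' \<in> P" "p \<noteq> p'"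
      obtain u v u' v' where [simp]: "p = (u, v)" "p' = (u', v')" by fastforce
      have "{u..v} \<noteq> {u'..v'}" using p ab[of u v] ab[of u' v'] by (auto simp: Icc_eq_Icc)
      then have "interior {u..v} \<inter> interior {u'..v'} = {}"
        using p pairwiseD[OF \<D>(3), of "{u..v}" "{u'..v'}"] by (simp add: P_def del: interior_atLeastAtMost_real)
      then show "(case p of (u, v) \<Rightarrow> {u<..<v}) \<inter> (case p' of (u, v) \<Rightarrow> {u<..<v}) = {}"
        by (simp only: interior_atLeastAtMost_real prod.case \<open>p = (u, v)\<close> \<open>p' = (u', v')\<close>)
    qed
    have fin: "(\<Sum>(u, v)\<in>D. \<bar>f v - f u\<bar>) < \<epsilon>" if "finite D" "D \<subseteq> P" for D
    proof (rule D, intro conjI)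
      show "finite D" by fact
      show "\<forall>(u, v)\<in>D. a \<le> u \<and> u < v \<and> v \<le> b" using \<open>D \<subseteq> P\<close> ab by fast
      show dD: "disjoint_family_on (\<lambda>(u, v). {u<..<v}) D"
        using disj \<open>D \<subseteq> P\<close> by (rule disjoint_family_on_mono[rotated])
      have "(\<Sum>(u, v)\<in>D. v - u) = measure lebesgue (\<Union>(u, v)\<in>D. {u<..<v})"
        using that dD PV(2) by (intro measure_disjoint_intervals[symmetric]) (auto intro: less_imp_le)
      also have "\<dots> \<le> measure lebesgue U"
        using U(3) PV(1) that by (intro measure_mono_fmeasurable) (fastforce intro: sets.finite_UN)+
      finally show "(\<Sum>(u, v)\<in>D. v - u) < \<delta>" using U(4) by simp
    qed
    let ?T = "\<Union>p\<in>P. (\<lambda>(u, v). {f u..f v}) p"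
    have bd: "measure lebesgue (\<Union>p\<in>D. (\<lambda>(u, v). {f u..f v}) p) \<le> \<epsilon>" if "D \<subseteq> P" "finite D" for D
    proof -
      have "measure lebesgue (\<Union>p\<in>D. (\<lambda>(u, v). {f u..f v}) p) \<le> (\<Sum>p\<in>D. measure lebesgue ((\<lambda>(u, v). {f u..f v}) p))"
        using that by (intro measure_UNION_le) auto
      also have "\<dots> \<le> (\<Sum>(u, v)\<in>D. \<bar>f v - f u\<bar>)"
        by (intro sum_mono) auto
      finally show ?thesis using fin[OF that(2,1)] by simp
    qed
    have fm: "\<And>p. p \<in> P \<Longrightarrow> (\<lambda>(u, v). {f u..f v}) p \<in> lmeasurable" by auto
    show "\<exists>T. f ` ?N \<subseteq> T \<and> T \<in> lmeasurable \<and> measure lebesgue T \<le> \<epsilon>"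
    proof (intro exI conjI)
      show "?T \<in> lmeasurable" using \<open>countable P\<close> fm bd by (rule fmeasurable_UN_bound)
      show "measure lebesgue ?T \<le> \<epsilon>" using \<open>countable P\<close> fm bd by (rule measure_UN_bound)
      show "f ` ?N \<subseteq> ?T"
      proof
        fix y assume "y \<in> f ` ?N"
        then obtain x where x: "x \<in> ?N" "y = f x" by blast
        then obtain K where K: "K \<in> \<D>" "x \<in> K" using \<D>(5) by blast
        obtain u v where uv: "K = {u..v}" "u < v"
          using \<D>(2)[OF K(1)] by (auto simp: box_real)
        then have "(u, v) \<in> P" using K by (simp add: P_def)
        moreover have "y \<in> {f u..f v}"
          using strict_mono_on_image_box(2)[OF f, of u v] ab[OF \<open>(u, v) \<in> P\<close>] x K uv by auto
        ultimately show "y \<in> ?T" by blast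
      qed
    qed
  qed
  then have "negligible (f ` ?N \<union> {f a, f b})" by (intro negligible_Un) auto
  moreover have "f ` N \<subseteq> f ` ?N \<union> {f a, f b}"
  proof
    fix y assume "y \<in> f ` N"
    then obtain x where x: "x \<in> N" "y = f x" by blast
    then have "x \<in> {a..b}" using N(1) by blast
    then have "x \<in> {a<..<b} \<or> x = a \<or> x = b" by auto
    then show "y \<in> f ` ?N \<union> {f a, f b}" using x by blast
  qed
  ultimately show ?thesis by (rule negligible_subset)
qed

text \<open>The increasing case of the Banach-Zarecki theorem. If absolute continuity fails for
  \<open>\<epsilon>\<close>, there are finite unions of intervals \<open>U n\<close> of measure
  below \<open>(1/2)^n\<close> whose images have measure at least \<open>\<epsilon>\<close>. By
  Borel-Cantelli \<open>limsup U\<close> is null, but its image still has measure at least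
  \<open>\<epsilon>\<close>.\<close>

lemma negligible_image_abs_cont_on:
  assumes f: "strict_mono_on {a..b} f" "continuous_on {a..b} f"
    and N: "\<And>N. N \<subseteq> {a..b} \<Longrightarrow> negligible N \<Longrightarrow> negligible (f ` N)"
  shows "abs_cont_on a b f"
proof (rule ccontr)
  assume "\<not> abs_cont_on a b f"
  then obtain \<epsilon> where \<epsilon>: "\<epsilon> > 0" and ex: "\<And>\<delta>. \<delta> > 0 \<Longrightarrow> \<exists>D :: (real \<times> real) set.
        finite D \<and> (\<forall>(u, v)\<in>D. a \<le> u \<and> u < v \<and> v \<le> b) \<and>
        disjoint_family_on (\<lambda>(u, v). {u<..<v}) D \<and> (\<Sum>(u, v)\<in>D. v - u) < \<delta> \<and>
        \<not> (\<Sum>(u, v)\<in>D. \<bar>f v - f u\<bar>) < \<epsilon>"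
    unfolding abs_cont_on_def not_all not_imp not_ex by (elim exE conjE) (simp add: conj_assoc)
  have "\<forall>n::nat. \<exists>D :: (real \<times> real) set.
        finite D \<and> (\<forall>(u, v)\<in>D. a \<le> u \<and> u < v \<and> v \<le> b) \<and>
        disjoint_family_on (\<lambda>(u, v). {u<..<v}) D \<and> (\<Sum>(u, v)\<in>D. v - u) < (1/2)^n \<and>
        \<not> (\<Sum>(u, v)\<in>D. \<bar>f v - f u\<bar>) < \<epsilon>"
    by (intro allI ex) simp
  from choice[OF this] obtain D :: "nat \<Rightarrow> (real \<times> real) set" where D: "\<And>n. finite (D n)"
    "\<And>n. \<forall>(u, v)\<in>D n. a \<le> u \<and> u < v \<and> v \<le> b"
    "\<And>n. disjoint_family_on (\<lambda>(u, v). {u<..<v}) (D n)" "\<And>n. (\<Sum>(u, v)\<in>D n. v - u) < (1/2)^n"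
    "\<And>n. \<not> (\<Sum>(u, v)\<in>D n. \<bar>f v - f u\<bar>) < \<epsilon>"
    by blast
  have D2: "a \<le> u" "u < v" "v \<le> b" if "(u, v) \<in> D n" for u v n
    using D(2)[of n] that by auto
  define U where "U n = (\<Union>(u, v)\<in>D n. {u<..<v})" for n
  define V where "V n = (\<Union>(u, v)\<in>D n. {f u<..<f v})" for n
  have U_ab: "U n \<subseteq> {a..b}" for n
    using D2 by (force simp: U_def)
  have box: "f ` {u<..<v} = {f u<..<f v}" if "(u, v) \<in> D n" for u v n
    using D2[OF that] by (intro strict_mono_on_image_box(1)[OF f]) auto
  have inj: "inj_on f {a..b}" using f(1) by (rule strict_mono_on_imp_inj_on)
  have fU: "f ` U n = V n" for n
  proof -
    have "f ` (case p of (u, v) \<Rightarrow> {u<..<v}) = (case p of (u, v) \<Rightarrow> {f u<..<f v})" if "p \<in> D n" for p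
      using box[of "fst p" "snd p" n] that by (simp add: case_prod_beta)
    then show ?thesis unfolding U_def V_def image_UN by (intro SUP_cong) auto
  qed
  have mU: "measure lebesgue (U n) = (\<Sum>(u, v)\<in>D n. v - u)" for n
    unfolding U_def using D D2 by (intro measure_disjoint_intervals) (auto intro: less_imp_le)
  have fless: "f u < f v" if "(u, v) \<in> D n" for u v n
    using strict_mono_onD[OF f(1), of u v] D2[OF that] by auto
  have opU: "open (U n)" and opV: "open (V n)" for n
    by (auto simp: U_def V_def)
  have Umeas: "U n \<in> lmeasurable" for n
    using U_ab opU by (intro bounded_set_imp_lmeasurable bounded_subset[OF bounded_closed_interval]) auto
  have Vsub: "V n \<subseteq> {f a..f b}" if "a \<le> b" for n
    using strict_mono_on_image_box(2)[OF f, of a b] that image_mono[OF U_ab[of n], of f]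
    by (simp add: fU)
  have ab: "a \<le> b"
  proof (rule ccontr)
    assume "\<not> a \<le> b"
    then have "D 0 = {}" using D2[of _ _ 0] by fastforce
    then show False using D(5)[of 0] \<epsilon> by simp
  qed
  have mV: "measure lebesgue (V n) \<ge> \<epsilon>" for n
  proof -
    let ?h = "\<lambda>(u, v). (f u, f v)"
    have "inj_on ?h (D n)"
    proof (rule inj_onI, clarify)
      fix u v u' v' assume "(u, v) \<in> D n" "(u', v') \<in> D n" "f u = f u'" "f v = f v'"
      then show "u = u' \<and> v = v'"
        using inj_onD[OF inj, of u u'] inj_onD[OF inj, of v v'] D2 by (meson atLeastAtMost_iff less_imp_le order_trans)
    qed
    have disjV: "disjoint_family_on (\<lambda>(u, v). {f u<..<f v}) (D n)"
      unfolding disjoint_family_on_def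
    proof (intro ballI impI)
      fix p q assume pq: "p \<in> D n" "q \<in> D n" "p \<noteq> q"
      obtain u v u' v' where p: "p = (u, v)" and q: "q = (u', v')" by fastforce
      have "{u<..<v} \<inter> {u'<..<v'} = {}" using disjoint_family_onD[OF D(3) pq] p q by simp
      moreover have "f ` {u<..<v} \<inter> f ` {u'<..<v'} = f ` ({u<..<v} \<inter> {u'<..<v'})"
        using D2[of u v n] D2[of u' v' n] pq p q by (intro inj_on_image_Int[OF inj, symmetric]) auto
      ultimately show "(case p of (u, v) \<Rightarrow> {f u<..<f v}) \<inter> (case q of (u, v) \<Rightarrow> {f u<..<f v}) = {}"
        using box pq p q by auto
    qed
    have "measure lebesgue (\<Union>p\<in>D n. (\<lambda>(u, v). {f u<..<f v}) p) = (\<Sum>p\<in>D n. measure lebesgue ((\<lambda>(u, v). {f u<..<f v}) p))"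
      using D(1) disjV fless by (intro measure_finite_Union) (auto simp: fless[THEN less_imp_le])
    also have "\<dots> = (\<Sum>(u, v)\<in>D n. \<bar>f v - f u\<bar>)"
      by (intro sum.cong refl) (clarsimp simp: fless[THEN less_imp_le])
    finally show ?thesis using D(5)[of n] by (simp add: V_def)
  qed
  have "limsup U \<in> null_sets lebesgue"
  proof (rule borel_cantelli_limsup1)
    show "U n \<in> sets lebesgue" for n using Umeas by blast
    show "emeasure lebesgue (U n) < \<infinity>" for n
      using fmeasurableD2[OF Umeas[of n]] by (simp only: infinity_ennreal_def less_top[symmetric] not_False_eq_True)
    show "summable (\<lambda>n. measure lebesgue (U n))"
      by (rule summable_comparison_test'[of "\<lambda>n. (1/2::real)^n" 0])
        (use D(4) in \<open>auto simp: mU[symmetric] intro: less_imp_le\<close>)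
  qed
  then have "negligible (limsup U)" by (simp add: negligible_iff_null_sets)
  moreover have limU: "limsup U = (\<Inter>n. \<Union>m\<in>{n..}. U m)" by (simp add: limsup_INF_SUP)
  have "limsup U \<subseteq> {a..b}" unfolding limU using U_ab by blast
  ultimately have neg: "negligible (f ` limsup U)" by (intro N)
  \<comment> \<open>Injectivity of \<open>f\<close> lets the image commute with the intersection
    over \<open>n\<close>. The image is thus a decreasing limit of sets of finite measure at least
    \<open>\<epsilon>\<close>.\<close>
  have flim: "f ` limsup U = (\<Inter>n. \<Union>m\<in>{n..}. V m)"
  proof -
    have "f ` (\<Inter>n. \<Union>m\<in>{n..}. U m) = (\<Inter>n. f ` (\<Union>m\<in>{n..}. U m))"
      using U_ab by (intro image_INT[OF inj, of UNIV _ 0]) auto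
    then show ?thesis unfolding limU by (simp add: image_UN fU)
  qed
  have "(\<lambda>n. measure lebesgue (\<Union>m\<in>{n..}. V m)) \<longlonglongrightarrow> measure lebesgue (\<Inter>n. \<Union>m\<in>{n..}. V m)"
  proof (rule Lim_measure_decseq)
    show "range (\<lambda>n. \<Union>m\<in>{n..}. V m) \<subseteq> sets lebesgue" using opV by auto
    show "decseq (\<lambda>n. \<Union>m\<in>{n..}. V m)"
      unfolding decseq_def by (intro allI impI UN_mono) auto
    have fm: "(\<Union>m\<in>{n..}. V m) \<in> lmeasurable" for n
      using opV Vsub[OF ab] by (intro bounded_set_imp_lmeasurable bounded_subset[OF bounded_closed_interval[of "f a" "f b"]]) auto
    show "emeasure lebesgue (\<Union>m\<in>{n..}. V m) \<noteq> \<infinity>" for n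
      using fmeasurableD2[OF fm[of n]] by (simp only: infinity_ennreal_def not_False_eq_True)
  qed
  moreover have "\<epsilon> \<le> measure lebesgue (\<Union>m\<in>{n..}. V m)" for n
  proof -
    have "measure lebesgue (V n) \<le> measure lebesgue (\<Union>m\<in>{n..}. V m)"
      using opV Vsub[OF ab] by (intro measure_mono_fmeasurable bounded_set_imp_lmeasurable
          bounded_subset[OF bounded_closed_interval[of "f a" "f b"]]) auto
    then show ?thesis using mV[of n] by simp
  qed
  ultimately have "\<epsilon> \<le> measure lebesgue (\<Inter>n. \<Union>m\<in>{n..}. V m)"
    by (intro LIMSEQ_le_const) auto
  then show False using neg \<epsilon> by (simp add: flim negligible_imp_measure0)
qed

section \<open>The group on the line\<close>

definition PH :: "(real \<Rightarrow> real) set" where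
  "PH = {f \<in> NH. \<forall>x. \<forall>n::int. f (x + of_int n) = f x + of_int n}"

lemma PH_NH: "f \<in> PH \<Longrightarrow> f \<in> NH"
  by (simp add: PH_def)

lemma PH_shift: "f \<in> PH \<Longrightarrow> f (x + of_int n) = f x + of_int n"
  by (simp add: PH_def)

lemma PH_comp: "f \<in> PH \<Longrightarrow> g \<in> PH \<Longrightarrow> f \<circ> g \<in> PH"
  by (simp add: PH_def)

lemma PH_id: "id \<in> PH"
  by (simp add: PH_def)

lemma PH_inv:
  assumes "f \<in> PH" shows "rinv f \<in> PH"
proof -
  have "rinv f (x + of_int n) = rinv f x + of_int n" for x and n :: int
    using NH_inv_f[OF PH_NH[OF assms], of "rinv f x + of_int n"] assms
    by (simp add: PH_shift NH_f_inv[OF PH_NH[OF assms]])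
  then show ?thesis using assms by (simp add: PH_def)
qed

lemma PH_translation: "(\<lambda>x. x + a) \<in> PH"
  by (simp add: PH_def NH_translation)

lemma NH_loc_abs_cont:
  assumes "f \<in> NH" shows "loc_abs_cont f"
  unfolding loc_abs_cont_def
proof (intro allI impI negligible_image_abs_cont_on)
  fix a b
  show "strict_mono_on {a..b} f" using assms by (simp add: strict_mono_on_def NH_less)
  show "continuous_on {a..b} f" using NH_continuous[OF assms] by (rule continuous_on_subset) simp
qed (use assms in \<open>rule NH_image\<close>)

lemma loc_abs_cont_negligible_image:
  assumes ac: "loc_abs_cont f" and f: "strict_mono f" "continuous_on UNIV f" and N: "negligible N"
  shows "negligible (f ` N)"
proof -
  have "negligible (f ` (N \<inter> {- real n..real n}))" for n
  proof (rule abs_cont_on_negligible_image)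
    show "abs_cont_on (- real n) (real n) f" using ac by (simp add: loc_abs_cont_def)
    show "strict_mono_on {- real n..real n} f" using f(1) by (simp add: strict_mono_on_def strict_mono_def)
    show "continuous_on {- real n..real n} f" using f(2) by (rule continuous_on_subset) simp
  qed (use N in \<open>auto intro: negligible_Int\<close>)
  then have "negligible (\<Union>n. f ` (N \<inter> {- real n..real n}))" by (intro negligible_countable_Union) auto
  moreover have "f ` N \<subseteq> (\<Union>n. f ` (N \<inter> {- real n..real n}))"
  proof
    fix y assume "y \<in> f ` N"
    then obtain x where x: "x \<in> N" "y = f x" by blast
    obtain n :: nat where "\<bar>x\<bar> \<le> real n" using real_arch_simple by blast
    then have "x \<in> N \<inter> {- real n..real n}" using x by auto
    then show "y \<in> (\<Union>n. f ` (N \<inter> {- real n..real n}))" using x by blast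
  qed
  ultimately show ?thesis by (rule negligible_subset)
qed

lemma homeomorphism_rinv:
  assumes "homeomorphism UNIV UNIV f g"
  shows "bij f" "g = rinv f" "continuous_on UNIV f" "continuous_on UNIV (rinv f)"
proof -
  have fg: "f (g y) = y" "g (f x) = x" for x y
    using assms by (auto simp: homeomorphism_def)
  then show b: "bij f" by (metis bij_iff)
  then show g: "g = rinv f" using fg by (intro ext) (metis bij_inv_eq_iff)
  show "continuous_on UNIV f" "continuous_on UNIV (rinv f)"
    using assms by (auto simp: homeomorphism_def g[symmetric])
qed

lemma NH_homeomorphism:
  assumes "f \<in> NH" shows "homeomorphism UNIV UNIV f (rinv f)"
  using NH_continuous[OF assms] NH_continuous[OF NH_inv[OF assms]] assms
  by (auto simp: homeomorphism_def NH_bij bij_is_surj bij_imp_bij_inv)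

lemma strict_mono_NH:
  assumes h: "homeomorphism UNIV UNIV f g" and mono: "strict_mono f"
    and ac: "loc_abs_cont f" "loc_abs_cont (rinv f)"
  shows "f \<in> NH"
proof (rule NHI)
  note hf = homeomorphism_rinv[OF h]
  have mono': "strict_mono (rinv f)"
  proof (rule strict_monoI)
    fix x y :: real assume "x < y"
    then show "rinv f x < rinv f y"
      using strict_mono_less[OF mono, of "rinv f x" "rinv f y"] hf(1) by (simp add: bij_is_surj surj_f_inv_f)
  qed
  show "f x < f y" if "x < y" for x y using mono that by (simp add: strict_mono_less)
  show "\<exists>x. f x = y" for y using hf(1) by (metis bij_pointE)
  show "negligible (f ` N)" if "negligible N" for N
    using loc_abs_cont_negligible_image[OF ac(1) mono hf(3) that] .
  show "negligible (f -` N)" if "negligible N" for N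
    using loc_abs_cont_negligible_image[OF ac(2) mono' hf(4) that] hf(1)
    by (simp add: bij_vimage_eq_inv_image)
qed

text \<open>The definition of the group on the line does not mention orientation. A decreasing
  homeomorphism is excluded because commuting with integer translations forces
  \<open>f (x + n) > f x\<close> for positive \<open>n\<close>.\<close>

lemma periodic_homeomorphism_strict_mono:
  fixes f :: "real \<Rightarrow> real"
  assumes cont: "continuous_on UNIV f" and inj: "inj f"
    and per: "\<And>x. \<And>n::int. f (x + of_int n) = f x + of_int n"
  shows "strict_mono f"
proof (rule strict_monoI, rule ccontr)
  fix x y :: real assume xy: "x < y" "\<not> f x < f y"
  have ne: "f x \<noteq> f y" using inj xy(1) by (auto dest: injD)
  obtain n :: int where n: "y - x < n" using ex_less_of_int by blast
  have cont': "continuous_on {x..x + n} f" using cont by (rule continuous_on_subset) simp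
  have inj': "inj_on f {x..x + n}" using inj by (rule inj_on_subset) simp
  have "f x < f y \<and> f y < f (x + n) \<or> f (x + n) < f y \<and> f y < f x"
    by (rule continuous_inj_imp_mono[OF _ _ cont' inj']) (use xy(1) n in auto)
  then have "f (x + n) < f x" using xy ne by auto
  moreover have "n > 0" using xy(1) n by linarith
  ultimately show False by (simp add: per)
qed

lemma carrier_AC_line: "carrier AC_line = PH"
proof
  show "carrier AC_line \<subseteq> PH"
  proof
    fix f assume "f \<in> carrier AC_line"
    then obtain g where f: "homeomorphism UNIV UNIV f g" "\<And>x. \<And>n::int. f (x + of_int n) = f x + of_int n"
        "loc_abs_cont f" "loc_abs_cont (rinv f)"
      by (auto simp: AC_line_def)
    have "strict_mono f"
      using homeomorphism_rinv[OF f(1)] f(2) by (intro periodic_homeomorphism_strict_mono) (auto simp: bij_is_inj)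
    then show "f \<in> PH" using strict_mono_NH f by (simp add: PH_def)
  qed
  show "PH \<subseteq> carrier AC_line"
    using NH_homeomorphism NH_loc_abs_cont by (auto simp: AC_line_def PH_def)
qed

lemma PH_Bij: "f \<in> PH \<Longrightarrow> f \<in> Bij UNIV"
  by (simp add: Bij_def PH_NH NH_bij)

lemma mult_AC_line: "f \<in> PH \<Longrightarrow> g \<in> PH \<Longrightarrow> f \<otimes>\<^bsub>AC_line\<^esub> g = f \<circ> g"
  by (simp add: AC_line_def BijGroup_def PH_Bij compose_def fun_eq_iff)

lemma one_AC_line: "\<one>\<^bsub>AC_line\<^esub> = id"
  by (simp add: AC_line_def BijGroup_def fun_eq_iff)

lemma group_AC_line: "group AC_line"
proof (rule groupI)
  fix f assume "f \<in> carrier AC_line"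
  then have f: "f \<in> PH" by (simp add: carrier_AC_line)
  show "\<exists>g\<in>carrier AC_line. g \<otimes>\<^bsub>AC_line\<^esub> f = \<one>\<^bsub>AC_line\<^esub>"
  proof
    show "rinv f \<in> carrier AC_line" using f by (simp add: carrier_AC_line PH_inv)
    show "rinv f \<otimes>\<^bsub>AC_line\<^esub> f = \<one>\<^bsub>AC_line\<^esub>"
      using f by (simp add: mult_AC_line one_AC_line PH_inv PH_NH NH_bij bij_is_inj)
  qed
qed (auto simp: carrier_AC_line mult_AC_line one_AC_line PH_comp PH_id comp_assoc)

lemma inv_AC_line: "f \<in> PH \<Longrightarrow> inv\<^bsub>AC_line\<^esub> f = rinv f"
  by (intro group.inv_equality[OF group_AC_line])
    (auto simp: carrier_AC_line mult_AC_line one_AC_line PH_inv PH_NH NH_bij bij_is_inj)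

section \<open>Periodic extension of maps of the unit interval\<close>

text \<open>The copy of the interval group inside the group on the line: such maps fix every
  integer, preserve the unit interval and are determined by their restriction to it.\<close>

definition Stab0 :: "(real \<Rightarrow> real) set" where
  "Stab0 = {f \<in> PH. f 0 = 0}"

definition periodize :: "(real \<Rightarrow> real) \<Rightarrow> real \<Rightarrow> real" where
  "periodize g x = of_int \<lfloor>x\<rfloor> + g (frac x)"

lemma periodize_int_add:
  assumes "0 \<le> t" "t < 1" shows "periodize g (of_int k + t) = of_int k + g t"
proof -
  have "\<lfloor>of_int k + t\<rfloor> = k" using assms by linarith
  then show ?thesis by (simp add: periodize_def frac_def)
qed

lemma real_int_frac:
  obtains k :: int and t :: real where "x = of_int k + t" "0 \<le> t" "t < 1"
  using that[of "\<lfloor>x\<rfloor>" "frac x"] by (simp add: frac_def frac_lt_1) linarith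

lemma negligible_countable_UN:
  fixes A :: "'i::countable \<Rightarrow> 'a::euclidean_space set"
  shows "(\<And>k. negligible (A k)) \<Longrightarrow> negligible (\<Union>k. A k)"
  by (intro negligible_countable_Union) auto

text \<open>The hypotheses are phrased with null sets so that two kinds of maps are covered:
  absolutely continuous homeomorphisms of the unit interval, and maps of the line transported into
  the open unit interval.\<close>

lemma periodize_Stab0:
  assumes mono: "strict_mono_on {0..1} g" and surj: "g ` {0..1} = {0..1}"
    and im: "\<And>N. N \<subseteq> {0..1} \<Longrightarrow> negligible N \<Longrightarrow> negligible (g ` N)"
    and vim: "\<And>N. N \<subseteq> {0..1} \<Longrightarrow> negligible N \<Longrightarrow> negligible {x \<in> {0..1}. g x \<in> N}"
  shows "periodize g \<in> Stab0" "g 0 = 0" "g 1 = 1" "\<And>x. x \<in> {0..1} \<Longrightarrow> periodize g x = g x"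
proof -
  have less: "g x < g y" if "0 \<le> x" "x < y" "y \<le> 1" for x y
    using strict_mono_onD[OF mono] that by auto
  have mem: "0 \<le> g x" "g x \<le> 1" if "0 \<le> x" "x \<le> 1" for x
    using surj that by (metis atLeastAtMost_iff imageI)+
  obtain a b where ab: "a \<in> {0..1}" "g a = 0" "b \<in> {0..1}" "g b = 1"
    using surj by (metis (no_types, opaque_lifting) atLeastAtMost_iff imageE order_refl zero_le_one)
  show g0: "g 0 = 0" using less[of 0 a] ab mem[of 0] by (cases "a = 0") auto
  show g1: "g 1 = 1" using less[of b 1] ab mem[of 1] by (cases "b = 1") auto
  have lt1: "g x < 1" if "0 \<le> x" "x < 1" for x using less[of x 1] that g1 by simp
  show eq: "periodize g x = g x" if "x \<in> {0..1}" for x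
  proof (cases "x = 1")
    case True
    then show ?thesis by (simp add: periodize_def g0 g1)
  next
    case False
    then show ?thesis using periodize_int_add[of x g 0] that by simp
  qed
  have "periodize g \<in> NH"
  proof (rule NHI)
    show "periodize g x < periodize g y" if "x < y" for x y
    proof -
      obtain k t where x: "x = of_int k + t" "0 \<le> t" "t < 1" by (rule real_int_frac)
      obtain l s where y: "y = of_int l + s" "0 \<le> s" "s < 1" by (rule real_int_frac)
      show ?thesis
      proof (cases "k = l")
        case True
        then show ?thesis using less[of t s] x y that by (simp add: periodize_int_add)
      next
        case False
        have "real_of_int k < real_of_int l + 1" using that x y by linarith
        then have "k + 1 \<le> l" using False by linarith
        then have "real_of_int k + 1 \<le> real_of_int l" by linarith
        then show ?thesis
          unfolding x y periodize_int_add[OF x(2,3)] periodize_int_add[OF y(2,3)]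
          using lt1[of t] mem[of s] x y by linarith
      qed
    qed
    show "\<exists>x. periodize g x = y" for y
    proof -
      obtain l s where y: "y = of_int l + s" "0 \<le> s" "s < 1" by (rule real_int_frac)
      obtain t where t: "0 \<le> t" "t \<le> 1" "g t = s" using surj y by (metis atLeastAtMost_iff imageE less_imp_le)
      then have "t < 1" using g1 y(3) by (cases "t = 1") auto
      then have "periodize g (of_int l + t) = y" using periodize_int_add[of t g l] t y by simp
      then show ?thesis ..
    qed
    fix N :: "real set" assume N: "negligible N"
    \<comment> \<open>The part of \<open>N\<close> over the unit cell starting at \<open>k\<close>,
      translated into the unit interval, where the hypotheses on \<open>g\<close> apply. Countably
      many cells exhaust \<open>N\<close>.\<close>
    let ?N = "\<lambda>k::int. (\<lambda>x. - of_int k + x) ` N \<inter> {0..1}"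
    have negN: "negligible (?N k)" for k
      by (intro negligible_Int disjI1 negligible_translation N)
    show "negligible (periodize g ` N)"
    proof (rule negligible_subset)
      show "negligible (\<Union>k::int. (\<lambda>x. of_int k + x) ` (g ` ?N k))"
        by (intro negligible_countable_UN negligible_translation im negN) simp
      show "periodize g ` N \<subseteq> (\<Union>k::int. (\<lambda>x. of_int k + x) ` (g ` ?N k))"
      proof
        fix y assume "y \<in> periodize g ` N"
        then obtain x where x: "x \<in> N" "y = periodize g x" by blast
        obtain k t where t: "x = of_int k + t" "0 \<le> t" "t < 1" by (rule real_int_frac)
        have "t \<in> ?N k" using x(1) t by (auto intro!: image_eqI[of _ _ x])
        moreover have "y = of_int k + g t" using x t by (simp add: periodize_int_add)
        ultimately show "y \<in> (\<Union>k::int. (\<lambda>x. of_int k + x) ` (g ` ?N k))" by blast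
      qed
    qed
    show "negligible (periodize g -` N)"
    proof (rule negligible_subset)
      show "negligible (\<Union>k::int. (\<lambda>x. of_int k + x) ` {x \<in> {0..1}. g x \<in> ?N k})"
        by (intro negligible_countable_UN negligible_translation vim negN) simp
      show "periodize g -` N \<subseteq> (\<Union>k::int. (\<lambda>x. of_int k + x) ` {x \<in> {0..1}. g x \<in> ?N k})"
      proof
        fix x assume x: "x \<in> periodize g -` N"
        obtain k t where t: "x = of_int k + t" "0 \<le> t" "t < 1" by (rule real_int_frac)
        have "of_int k + g t \<in> N" using x t by (simp add: periodize_int_add)
        then have "g t \<in> ?N k" using mem[of t] t by (auto intro!: image_eqI[of _ _ "of_int k + g t"])
        moreover have "t \<in> {0..1}" using t by simp
        ultimately have "t \<in> {x \<in> {0..1}. g x \<in> ?N k}" by blast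
        then show "x \<in> (\<Union>k::int. (\<lambda>x. of_int k + x) ` {x \<in> {0..1}. g x \<in> ?N k})"
          unfolding t(1) by (intro UN_I[of k] imageI) auto
      qed
    qed
  qed
  moreover have "periodize g (x + of_int n) = periodize g x + of_int n" for x and n :: int
    by (simp add: periodize_def frac_def)
  ultimately show "periodize g \<in> Stab0" using eq[of 0] g0 by (simp add: Stab0_def PH_def)
qed

section \<open>Passage between the line and the open unit interval\<close>

definition to_unit :: "real \<Rightarrow> real" where "to_unit x = 1/2 + arctan x / pi"

definition of_unit :: "real \<Rightarrow> real" where "of_unit y = tan (pi * (y - 1/2))"

lemma to_unit_bounds [simp]: "0 < to_unit x" "to_unit x < 1"
  using arctan_bounded[of x] by (auto simp: to_unit_def field_simps)

lemma to_unit_bounds_le [simp]: "0 \<le> to_unit x" "to_unit x \<le> 1"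
  by (simp_all add: less_imp_le)

lemma of_unit_to_unit [simp]: "of_unit (to_unit x) = x"
  by (simp add: of_unit_def to_unit_def tan_arctan)

lemma to_unit_of_unit [simp]:
  assumes "0 < y" "y < 1" shows "to_unit (of_unit y) = y"
proof -
  have "pi * y > 0" "pi * y < pi" using assms by auto
  then have "arctan (tan (pi * (y - 1/2))) = pi * (y - 1/2)"
    by (intro arctan_tan) (auto simp: algebra_simps)
  then show ?thesis by (simp add: to_unit_def of_unit_def)
qed

lemma to_unit_less: "to_unit x < to_unit y \<longleftrightarrow> x < y"
  by (simp add: to_unit_def arctan_less_iff divide_less_cancel)

lemma negligible_to_unit:
  assumes "negligible N" shows "negligible (to_unit ` N)"
proof (rule negligible_differentiable_image_negligible[OF order_refl assms])
  show "to_unit differentiable_on N"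
    unfolding differentiable_on_def
  proof
    fix x
    have "(to_unit has_real_derivative 0 + inverse (1 + x\<^sup>2) / pi) (at x within N)"
      unfolding to_unit_def[abs_def]
      by (intro DERIV_add DERIV_const DERIV_cdivide has_field_derivative_at_within[OF DERIV_arctan])
    then show "to_unit differentiable (at x within N)" by (rule real_differentiable_def[THEN iffD2, OF exI])
  qed
qed

text \<open>The derivative blows up at both ends of the interval, so \<open>of_unit\<close> has no
  uniform modulus of continuity; differentiability at each interior point still gives preservation
  of null sets.\<close>

lemma negligible_of_unit:
  assumes "negligible N" "N \<subseteq> {0<..<1}" shows "negligible (of_unit ` N)"
proof (rule negligible_differentiable_image_negligible[OF order_refl assms(1)])
  show "of_unit differentiable_on N"
    unfolding differentiable_on_def
  proof
    fix y assume "y \<in> N"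
    then have "0 < y" "y < 1" using assms by auto
    then have "pi * y > 0" "pi * y < pi" by auto
    then have "cos (pi * (y - 1/2)) > 0"
      by (intro cos_gt_zero_pi) (auto simp: algebra_simps)
    then have "(of_unit has_real_derivative inverse ((cos (pi * (y - 1/2)))\<^sup>2) * pi) (at y within N)"
      unfolding of_unit_def[abs_def]
      by (auto intro!: derivative_eq_intros DERIV_chain2[where f = tan] simp: field_simps)
    then show "of_unit differentiable (at y within N)" by (rule real_differentiable_def[THEN iffD2, OF exI])
  qed
qed

definition unit_conj :: "(real \<Rightarrow> real) \<Rightarrow> real \<Rightarrow> real" where
  "unit_conj f y = (if 0 < y \<and> y < 1 then to_unit (f (of_unit y)) else y)"

text \<open>A homomorphism of \<open>NH\<close> onto \<open>Stab0\<close>, given by conjugation into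
  the open unit interval followed by periodic extension. Length functions on \<open>Stab0\<close>
  are pulled back along it.\<close>

definition from_NH :: "(real \<Rightarrow> real) \<Rightarrow> real \<Rightarrow> real" where
  "from_NH f = periodize (unit_conj f)"

lemma from_NH_Stab0:
  assumes f: "f \<in> NH" shows "from_NH f \<in> Stab0"
  unfolding from_NH_def
proof (rule periodize_Stab0(1))
  show "strict_mono_on {0..1} (unit_conj f)"
  proof (rule strict_mono_onI)
    fix x y :: real assume xy: "x \<in> {0..1}" "y \<in> {0..1}" "x < y"
    have "of_unit x < of_unit y" if "0 < x" "y < 1"
      using to_unit_less[of "of_unit x" "of_unit y"] that xy by simp
    then show "unit_conj f x < unit_conj f y"
      using xy f to_unit_bounds[of "f (of_unit x)"] to_unit_bounds[of "f (of_unit y)"]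
      by (auto simp: unit_conj_def to_unit_less NH_less)
  qed
  show "unit_conj f ` {0..1} = {0..1}"
  proof
    show "unit_conj f ` {0..1} \<subseteq> {0..1}"
      by (auto simp: unit_conj_def intro: less_imp_le)
    show "{0..1} \<subseteq> unit_conj f ` {0..1}"
    proof
      fix y :: real assume y: "y \<in> {0..1}"
      show "y \<in> unit_conj f ` {0..1}"
      proof (cases "0 < y \<and> y < 1")
        case True
        then have "unit_conj f (to_unit (rinv f (of_unit y))) = y" using f by (simp add: unit_conj_def)
        moreover have "to_unit (rinv f (of_unit y)) \<in> {0..1}" by (simp add: less_imp_le)
        ultimately show ?thesis by (metis imageI)
      next
        case False
        then have "unit_conj f y = y" by (auto simp: unit_conj_def)
        then show ?thesis using y by (metis imageI)
      qed
    qed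
  qed
  fix N :: "real set" assume N: "N \<subseteq> {0..1}" "negligible N"
  let ?N = "of_unit ` (N \<inter> {0<..<1})"
  have negN: "negligible ?N" using N by (intro negligible_of_unit negligible_Int) auto
  show "negligible (unit_conj f ` N)"
  proof (rule negligible_subset)
    show "negligible (N \<union> to_unit ` f ` ?N)"
      by (intro negligible_Un negligible_to_unit NH_image[OF f] negN N)
    show "unit_conj f ` N \<subseteq> N \<union> to_unit ` f ` ?N" by (auto simp: unit_conj_def)
  qed
  show "negligible {x \<in> {0..1}. unit_conj f x \<in> N}"
  proof (rule negligible_subset)
    show "negligible (N \<union> to_unit ` (f -` ?N))"
      by (intro negligible_Un negligible_to_unit NH_vimage[OF f] negN N)
    show "{x \<in> {0..1}. unit_conj f x \<in> N} \<subseteq> N \<union> to_unit ` (f -` ?N)"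
    proof
      fix x assume x: "x \<in> {x \<in> {0..1}. unit_conj f x \<in> N}"
      show "x \<in> N \<union> to_unit ` (f -` ?N)"
      proof (cases "0 < x \<and> x < 1")
        case True
        then have "to_unit (f (of_unit x)) \<in> N \<inter> {0<..<1}" using x by (simp add: unit_conj_def)
        then have "f (of_unit x) \<in> ?N" by (metis imageI of_unit_to_unit)
        then have "x \<in> to_unit ` (f -` ?N)" using True by (intro image_eqI[of _ _ "of_unit x"]) auto
        then show ?thesis ..
      next
        case False
        then have "unit_conj f x = x" by (auto simp: unit_conj_def)
        then show ?thesis using x by auto
      qed
    qed
  qed
qed

lemma from_NH_int [simp]: "from_NH f (of_int k) = of_int k"
  using periodize_int_add[of 0 "unit_conj f" k] by (simp add: from_NH_def unit_conj_def)

lemma from_NH_unit: "from_NH f (of_int k + to_unit x) = of_int k + to_unit (f x)"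
  using periodize_int_add[of "to_unit x" "unit_conj f" k] by (simp add: from_NH_def unit_conj_def less_imp_le)

lemma real_int_unit_cases:
  obtains k :: int where "x = of_int k" | k :: int and u where "x = of_int k + to_unit u"
proof -
  obtain k t where t: "x = of_int k + t" "0 \<le> t" "t < 1" by (rule real_int_frac)
  show thesis
  proof (cases "t = 0")
    case False
    then show ?thesis using that(2)[of k "of_unit t"] t by simp
  qed (use t that(1) in simp)
qed

lemma from_NH_comp: "from_NH (f \<circ> g) = from_NH f \<circ> from_NH g"
proof
  fix x
  show "from_NH (f \<circ> g) x = (from_NH f \<circ> from_NH g) x"
    by (cases x rule: real_int_unit_cases) (simp_all add: from_NH_unit)
qed

lemma from_NH_id: "from_NH id = id"
proof
  fix x
  show "from_NH id x = id x"
    by (cases x rule: real_int_unit_cases) (simp_all add: from_NH_unit)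
qed

lemma from_NH_inv:
  assumes "f \<in> NH" shows "from_NH (rinv f) = rinv (from_NH f)"
proof -
  have "f \<circ> rinv f = id" using assms by auto
  then have "from_NH f \<circ> from_NH (rinv f) = id" by (metis from_NH_comp from_NH_id)
  moreover have "from_NH f \<in> NH" using from_NH_Stab0[OF assms] by (simp add: Stab0_def PH_def)
  ultimately show ?thesis by (metis NH_bij bij_is_inj comp_assoc id_comp inv_o_cancel comp_id)
qed

lemma Stab0_from_NH:
  assumes "h \<in> Stab0" obtains f where "f \<in> NH" "from_NH f = h"
proof -
  have h: "h \<in> NH" "h 0 = 0" "\<And>x n. h (x + of_int n) = h x + of_int n"
    using assms by (auto simp: Stab0_def PH_def)
  have h1: "h 1 = 1" using h(3)[of 0 1] h(2) by simp
  have h01: "0 < h y \<and> h y < 1 \<longleftrightarrow> 0 < y \<and> y < 1" for y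
    using NH_less[OF h(1), of 0 y] NH_less[OF h(1), of y 1] h(2) h1 by simp
  define f where "f x = of_unit (h (to_unit x))" for x
  have tf: "to_unit (f x) = h (to_unit x)" for x
    using h01[of "to_unit x"] by (simp add: f_def)
  have "f \<in> NH"
  proof (rule NHI)
    show "f x < f y" if "x < y" for x y
      using that to_unit_less[of "f x" "f y"] by (simp add: tf NH_less[OF h(1)] to_unit_less)
    show "\<exists>x. f x = y" for y
    proof
      have "0 < rinv h (to_unit y) \<and> rinv h (to_unit y) < 1"
        using h01[of "rinv h (to_unit y)"] h(1) by simp
      then show "f (of_unit (rinv h (to_unit y))) = y" using h(1) by (simp add: f_def)
    qed
    fix N :: "real set" assume N: "negligible N"
    have "f ` N = of_unit ` h ` to_unit ` N" by (auto simp: f_def)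
    then show "negligible (f ` N)"
      using N h01 by (auto intro!: negligible_of_unit NH_image[OF h(1)] negligible_to_unit)
    have "f -` N \<subseteq> of_unit ` ((h -` (to_unit ` N)) \<inter> {0<..<1})"
    proof
      fix x assume "x \<in> f -` N"
      then have "to_unit (f x) \<in> to_unit ` N" by auto
      then have "h (to_unit x) \<in> to_unit ` N" by (simp only: tf)
      then have "to_unit x \<in> (h -` (to_unit ` N)) \<inter> {0<..<1}" by simp
      then show "x \<in> of_unit ` ((h -` (to_unit ` N)) \<inter> {0<..<1})" by (metis imageI of_unit_to_unit)
    qed
    moreover have "negligible (of_unit ` ((h -` (to_unit ` N)) \<inter> {0<..<1}))"
      using N by (intro negligible_of_unit negligible_Int disjI1 NH_vimage[OF h(1)] negligible_to_unit) auto
    ultimately show "negligible (f -` N)" by (rule negligible_subset[rotated])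
  qed
  moreover have "from_NH f = h"
  proof
    fix x show "from_NH f x = h x"
    proof (cases x rule: real_int_unit_cases)
      case (1 k)
      then show ?thesis using h(3)[of 0 k] h(2) by simp
    next
      case (2 k u)
      then show ?thesis using h(3)[of "to_unit u" k] by (simp add: from_NH_unit tf add.commute)
    qed
  qed
  ultimately show thesis by (rule that)
qed

lemma Stab0_PH: "f \<in> Stab0 \<Longrightarrow> f \<in> PH"
  by (simp add: Stab0_def)

lemma Stab0_length_bounded:
  assumes comp: "\<And>f g. f \<in> Stab0 \<Longrightarrow> g \<in> Stab0 \<Longrightarrow> L (f \<circ> g) \<le> L f + L g"
    and inv: "\<And>f. f \<in> Stab0 \<Longrightarrow> L (rinv f) \<le> L f"
  obtains C :: real where "\<And>f. f \<in> Stab0 \<Longrightarrow> L f \<le> C"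
proof -
  interpret NH_length "\<lambda>f. L (from_NH f)"
    by unfold_locales (simp_all add: from_NH_comp from_NH_inv comp inv from_NH_Stab0)
  obtain C where C: "\<And>f. f \<in> NH \<Longrightarrow> L (from_NH f) \<le> C"
    by (rule bounded) blast
  show thesis
  proof (rule that)
    fix f assume "f \<in> Stab0"
    then show "L f \<le> C" using C by (metis Stab0_from_NH)
  qed
qed

text \<open>An element of \<open>PH\<close> is the product of a power of the translation by \<open>1/4\<close>, a map fixing \<open>1/2\<close>
  and a map fixing \<open>0\<close>.\<close>

lemma PH_length_linear:
  assumes comp: "\<And>f g. f \<in> PH \<Longrightarrow> g \<in> PH \<Longrightarrow> L (f \<circ> g) \<le> L f + L g"
    and inv: "\<And>f. f \<in> PH \<Longrightarrow> L (rinv f) \<le> L f"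
  obtains A B :: real where "A \<ge> 0" "B \<ge> 0" "\<And>f. f \<in> PH \<Longrightarrow> L f \<le> A * \<bar>f 0\<bar> + B"
proof -
  have sub: "Stab0 \<subseteq> PH" by (auto simp: Stab0_def)
  obtain C where C: "\<And>f. f \<in> Stab0 \<Longrightarrow> L f \<le> C"
    by (rule Stab0_length_bounded[of L]) (use comp inv sub in blast)+
  have L0: "L f \<ge> 0" if "f \<in> PH" for f
  proof -
    have "L id \<ge> 0" using comp[OF PH_id PH_id] by simp
    moreover have "f \<circ> rinv f = id" using that by (auto simp: PH_NH)
    ultimately show ?thesis using comp[OF that PH_inv[OF that]] inv[OF that] by simp
  qed
  let ?T = "\<lambda>a x. x + (a::real)"
  have T: "?T a \<in> PH" for a by (rule PH_translation)
  have Tn: "L (?T (of_int m * a)) \<le> \<bar>of_int m\<bar> * L (?T a) + L id" for m a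
  proof -
    have pos: "L (?T (real n * a)) \<le> real n * L (?T a) + L id" for n a
    proof (induction n)
      case 0
      then show ?case by (simp add: id_def)
    next
      case (Suc n)
      have "?T (real (Suc n) * a) = ?T a \<circ> ?T (real n * a)" by (auto simp: algebra_simps)
      then have "L (?T (real (Suc n) * a)) \<le> L (?T a) + L (?T (real n * a))"
        using comp[OF T T] by metis
      then show ?case using Suc by (simp add: algebra_simps)
    qed
    have neg: "L (?T (- a)) \<le> L (?T a)" for a
    proof -
      have "rinv (?T a) = ?T (- a)"
        by (rule inv_equality) auto
      then show ?thesis using inv[OF T, of a] by simp
    qed
    show ?thesis
    proof (cases "m \<ge> 0")
      case True
      then show ?thesis using pos[of "nat m" a] by simp
    next
      case False
      then show ?thesis using pos[of "nat (- m)" a] neg[of "real (nat (- m)) * a"] by simp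
    qed
  qed
  \<comment> \<open>The stabiliser of 1/2 is conjugate to that of 0 by the translation by 1/2, so it
    inherits a uniform bound.\<close>
  have half: "L k \<le> C + 2 * L (?T (1/2))" if k: "k \<in> PH" "k (1/2) = 1/2" for k
  proof -
    let ?k = "?T (- 1/2) \<circ> k \<circ> ?T (1/2)"
    have "?k \<in> PH" by (intro PH_comp T k(1))
    then have "?k \<in> Stab0" using k(2) by (simp add: Stab0_def)
    moreover have "k = ?T (1/2) \<circ> ?k \<circ> ?T (- 1/2)" by auto
    moreover have "L (?T (1/2) \<circ> ?k \<circ> ?T (- 1/2)) \<le> L (?T (1/2) \<circ> ?k) + L (?T (- 1/2))"
      by (intro comp PH_comp T k)
    moreover have "L (?T (1/2) \<circ> ?k) \<le> L (?T (1/2)) + L ?k"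
      by (intro comp PH_comp T k)
    moreover have "L (?T (- 1/2)) \<le> L (?T (1/2))"
    proof -
      have "rinv (?T (1/2)) = ?T (- 1/2)"
        by (rule inv_equality) auto
      then show ?thesis using inv[OF T, of "1/2"] by simp
    qed
    ultimately show ?thesis using C by fastforce
  qed
  define A where "A = 4 * L (?T (1/4))"
  define B where "B = L (?T (1/4)) + L id + (C + 2 * L (?T (1/2))) + C"
  have C0: "C \<ge> 0" using C[of id] L0[OF PH_id] by (auto simp: Stab0_def PH_id)
  have "L f \<le> A * \<bar>f 0\<bar> + B" if f: "f \<in> PH" for f
  proof -
    define m where "m = \<lfloor>4 * f 0\<rfloor>"
    define r where "r = f 0 - of_int m * (1/4)"
    have r: "0 \<le> r" "r < 1/4" unfolding r_def m_def by linarith+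
    \<comment> \<open>A tent of height \<open>r\<close> over the integers that vanishes at the
      half-integers: \<open>k\<close> sends 0 to \<open>r\<close> and fixes 1/2. Its slope is at
      most \<open>2 * r\<close>, and translating by multiples of 1/4 leaves \<open>r < 1/4\<close>,
      so \<open>k\<close> is increasing.\<close>
    define k where "k x = x + r * (1 - 2 * dist_int x)" for x
    have "k \<in> PH"
    proof -
      have "(\<lambda>x. x + r * (1 - 2 * dist_int x)) \<in> NH"
      proof (rule NH_perturb[of "1/2"])
        fix x y
        have "r * (1 - 2 * dist_int x) - r * (1 - 2 * dist_int y) = - (2 * r * (dist_int x - dist_int y))"
          by (simp add: algebra_simps)
        then have "\<bar>r * (1 - 2 * dist_int x) - r * (1 - 2 * dist_int y)\<bar> = 2 * r * \<bar>dist_int x - dist_int y\<bar>"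
          using r(1) by (simp add: abs_mult)
        also have "\<dots> \<le> 1/2 * \<bar>x - y\<bar>"
          using r dist_int_diff[of x y] by (intro mult_mono) auto
        finally show "\<bar>r * (1 - 2 * dist_int x) - r * (1 - 2 * dist_int y)\<bar> \<le> 1/2 * \<bar>x - y\<bar>" .
      qed simp
      then show ?thesis by (simp add: PH_def k_def[abs_def] dist_int_add_int)
    qed
    have k0: "k 0 = r" using dist_int_near[of 0 0] by (simp add: k_def)
    have "k (1/2) = 1/2" using dist_int_near[of "1/2" 0] by (simp add: k_def)
    then have Lk: "L k \<le> C + 2 * L (?T (1/2))" using half \<open>k \<in> PH\<close> by blast
    define g where "g = rinv k \<circ> ?T (- (of_int m * (1/4))) \<circ> f"
    have gPH: "g \<in> PH" unfolding g_def by (intro PH_comp PH_inv T f \<open>k \<in> PH\<close>)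
    have "g 0 = rinv k (k 0)" by (simp add: g_def k0 r_def)
    also have "\<dots> = 0" using \<open>k \<in> PH\<close> by (simp add: PH_NH)
    finally have "L g \<le> C" using gPH by (intro C) (simp add: Stab0_def)
    have "f = ?T (of_int m * (1/4)) \<circ> (k \<circ> g)"
      using \<open>k \<in> PH\<close> by (auto simp: g_def PH_NH)
    then have "L f \<le> L (?T (of_int m * (1/4))) + L (k \<circ> g)"
      using comp[OF T PH_comp[OF \<open>k \<in> PH\<close> gPH]] by metis
    also have "\<dots> \<le> (\<bar>of_int m\<bar> * L (?T (1/4)) + L id) + (L k + L g)"
      using Tn[of m "1/4"] comp[OF \<open>k \<in> PH\<close> gPH] by (rule add_mono)
    also have "\<bar>real_of_int m\<bar> * L (?T (1/4)) \<le> (4 * \<bar>f 0\<bar> + 1) * L (?T (1/4))"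
    proof (intro mult_right_mono L0 T)
      show "\<bar>real_of_int m\<bar> \<le> 4 * \<bar>f 0\<bar> + 1" unfolding m_def by linarith
    qed
    finally show ?thesis using Lk \<open>L g \<le> C\<close> by (simp add: A_def B_def id_def algebra_simps)
  qed
  moreover have "A \<ge> 0" "B \<ge> 0"
    using L0[OF T] L0[OF PH_id] C0 by (auto simp: A_def B_def intro!: add_nonneg_nonneg)
  ultimately show thesis using that by blast
qed

section \<open>Derivatives\<close>

lemma AE_lborel_negligible:
  "(AE x in lborel. P x) \<longleftrightarrow> negligible {x. \<not> P x}" for P :: "'a::euclidean_space \<Rightarrow> bool"
proof -
  have "(AE x in lborel. P x) \<longleftrightarrow> (AE x in lebesgue. P x)" by (rule AE_completion_iff[symmetric])
  also have "\<dots> \<longleftrightarrow> negligible {x. \<not> P x}"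
    by (simp add: negligible_iff_null_sets completion.AE_iff_null_sets)
  finally show ?thesis .
qed

lemma NH_measurable: "f \<in> NH \<Longrightarrow> f \<in> borel_measurable borel"
  by (intro borel_measurable_continuous_onI NH_continuous)

lemma NH_AE_comp:
  assumes f: "f \<in> NH" and P: "AE x in lborel. P x" shows "AE x in lborel. P (f x)"
  using NH_vimage[OF f, of "{x. \<not> P x}"] P by (simp add: AE_lborel_negligible vimage_def)

text \<open>Two roles of the derivative in one function: the Radon-Nikodym density of the measure
  \<open>A \<mapsto> \<bar>f(A)\<bar>\<close>, expressed by the substitution rule, and the pointwise
  derivative almost everywhere. Being a nonnegative Borel function, it can replace
  \<open>deriv f\<close> in all integrals.\<close>

definition density_of :: "(real \<Rightarrow> real) \<Rightarrow> (real \<Rightarrow> real) \<Rightarrow> bool" where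
  "density_of f p \<longleftrightarrow> p \<in> borel_measurable borel \<and> (\<forall>x. 0 \<le> p x) \<and>
    (\<forall>u\<in>borel_measurable borel. (\<integral>\<^sup>+x. u x \<partial>lborel) = (\<integral>\<^sup>+x. u (f x) * ennreal (p x) \<partial>lborel)) \<and>
    (AE x in lborel. (f has_real_derivative p x) (at x))"

text \<open>The measure \<open>\<nu>\<close> assigns to a set the Lebesgue measure of its image
  under \<open>f\<close>. It is absolutely continuous because \<open>f\<close> maps null sets to
  null sets, and its density satisfies the substitution rule because \<open>f\<close> carries
  \<open>\<nu>\<close> back to Lebesgue measure.\<close>

lemma NH_Radon_Nikodym:
  assumes f: "f \<in> NH"
  obtains p where "p \<in> borel_measurable borel" "\<And>x. 0 \<le> p x"
    "\<And>u. u \<in> borel_measurable borel \<Longrightarrow> (\<integral>\<^sup>+x. u x \<partial>lborel) = (\<integral>\<^sup>+x. u (f x) * ennreal (p x) \<partial>lborel)"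
proof -
  note [measurable] = NH_measurable[OF f] NH_measurable[OF NH_inv[OF f]]
  define \<nu> where "\<nu> = distr lborel borel (rinv f)"
  have "absolutely_continuous lborel \<nu>"
    unfolding absolutely_continuous_def
  proof
    fix N :: "real set" assume N: "N \<in> null_sets lborel"
    then have [measurable]: "N \<in> sets borel" by auto
    have "negligible N" using null_sets_completionI[OF N] by (simp add: negligible_iff_null_sets)
    then have "negligible (rinv f -` N)" by (rule NH_vimage[OF NH_inv[OF f]])
    then have "rinv f -` N \<in> null_sets lebesgue" by (simp add: negligible_iff_null_sets)
    moreover have "rinv f -` N \<in> sets borel"
      using measurable_sets_borel[OF NH_measurable[OF NH_inv[OF f]], of N] by simp
    ultimately have "emeasure lborel (rinv f -` N) = 0" by (simp add: null_sets_completion_iff null_sets_def)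
    then show "N \<in> null_sets \<nu>"
      by (simp add: null_sets_def \<nu>_def emeasure_distr)
  qed
  then have "\<exists>P\<in>borel_measurable lborel. density lborel P = \<nu>"
    by (intro sigma_finite_measure.Radon_Nikodym sigma_finite_lborel) (simp_all add: \<nu>_def)
  then obtain P where P[measurable]: "P \<in> borel_measurable borel" and \<nu>P: "density lborel P = \<nu>"
    by auto
  have "distr \<nu> borel f = distr lborel borel (f \<circ> rinv f)"
    unfolding \<nu>_def by (intro distr_distr) auto
  also have "f \<circ> rinv f = id" using f by auto
  also have "distr lborel borel id = lborel" by (simp add: id_def distr_id2)
  finally have d: "distr \<nu> borel f = lborel" .
  have u: "(\<integral>\<^sup>+x. u x \<partial>lborel) = (\<integral>\<^sup>+x. u (f x) * P x \<partial>lborel)"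
    if [measurable]: "u \<in> borel_measurable borel" for u
  proof -
    have "(\<integral>\<^sup>+x. u x \<partial>lborel) = (\<integral>\<^sup>+x. u x \<partial>distr \<nu> borel f)" by (simp add: d)
    also have "\<dots> = (\<integral>\<^sup>+x. u (f x) \<partial>\<nu>)" by (intro nn_integral_distr) (auto simp: \<nu>_def)
    also have "\<dots> = (\<integral>\<^sup>+x. P x * u (f x) \<partial>lborel)"
      unfolding \<nu>P[symmetric] by (intro nn_integral_density) auto
    finally show ?thesis by (simp add: mult.commute)
  qed
  \<comment> \<open>Over the interval from \<open>-n\<close> to \<open>n\<close> the density
    integrates to the finite number \<open>f n - f (- n)\<close>. This permits a real-valued
    version.\<close>
  have fin: "AE x in lborel. P x \<noteq> \<infinity>"
  proof -
    have "AE x in lborel. indicator {- real n..real n} x * P x \<noteq> \<infinity>" for n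
    proof (rule nn_integral_PInf_AE)
      have "(\<integral>\<^sup>+x. indicator {- real n..real n} x * P x \<partial>lborel) = (\<integral>\<^sup>+x. indicator {f (- real n)..f (real n)} (f x) * P x \<partial>lborel)"
        using f by (intro nn_integral_cong) (auto simp: indicator_def NH_le)
      also have "\<dots> = emeasure lborel {f (- real n)..f (real n)}"
        by (subst u[symmetric]) auto
      finally show "(\<integral>\<^sup>+x. indicator {- real n..real n} x * P x \<partial>lborel) \<noteq> \<infinity>"
        using f by (simp add: NH_le)
    qed auto
    then have "AE x in lborel. \<forall>n. indicator {- real n..real n} x * P x \<noteq> \<infinity>"
      by (simp add: AE_all_countable)
    then show ?thesis
    proof (eventually_elim)
      case (elim x)
      obtain n :: nat where "\<bar>x\<bar> \<le> real n" using real_arch_simple by blast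
      then have "x \<in> {- real n..real n}" by auto
      then have "indicator {- real n..real n} x = (1::ennreal)" by simp
      then show ?case using elim[rule_format, of n] by simp
    qed
  qed
  show thesis
  proof (rule that[of "\<lambda>x. enn2real (P x)"])
    fix u :: "real \<Rightarrow> ennreal" assume [measurable]: "u \<in> borel_measurable borel"
    have "(\<integral>\<^sup>+x. u x \<partial>lborel) = (\<integral>\<^sup>+x. u (f x) * P x \<partial>lborel)" by (rule u) fact
    also have "\<dots> = (\<integral>\<^sup>+x. u (f x) * ennreal (enn2real (P x)) \<partial>lborel)"
    proof (rule nn_integral_cong_AE)
      show "AE x in lborel. u (f x) * P x = u (f x) * ennreal (enn2real (P x))"
        using fin by eventually_elim (simp add: less_top)
    qed
    finally show "(\<integral>\<^sup>+x. u x \<partial>lborel) = (\<integral>\<^sup>+x. u (f x) * ennreal (enn2real (P x)) \<partial>lborel)" .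
  qed auto
qed

lemma integral_right_derivative:
  fixes p F :: "real \<Rightarrow> real"
  assumes "\<And>a b. a \<le> b \<Longrightarrow> (p has_integral F b - F a) {a..b}"
  obtains N where "negligible N" "\<And>x e. x \<notin> N \<Longrightarrow> e > 0 \<Longrightarrow>
     \<exists>d>0. \<forall>h. 0 < h \<and> h < d \<longrightarrow> \<bar>(F (x + h) - F x) / h - p x\<bar> < e"
proof -
  have int: "p integrable_on cbox a b" for a b
    using assms[of a b] by (cases "a \<le> b") (auto simp: integrable_on_def)
  obtain N where N: "negligible N" "\<And>x e. x \<notin> N \<Longrightarrow> 0 < e \<Longrightarrow> \<exists>d>0. \<forall>h. 0 < h \<and> h < d \<longrightarrow>
        norm (integral (cbox x (x + h *\<^sub>R One)) p /\<^sub>R h ^ DIM(real) - p x) < e"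
    by (rule integrable_ccontinuous_explicit[of p, OF int]) (rule that; assumption)
  have eq: "integral (cbox x (x + h *\<^sub>R One)) p /\<^sub>R h ^ DIM(real) = (F (x + h) - F x) / h"
    if "h > 0" for x h
    using integral_unique[OF assms[of x "x + h"]] that by (simp add: divide_inverse mult.commute)
  show thesis
  proof (rule that[OF N(1)])
    fix x and e :: real assume "x \<notin> N" "e > 0"
    from N(2)[OF this] show "\<exists>d>0. \<forall>h. 0 < h \<and> h < d \<longrightarrow> \<bar>(F (x + h) - F x) / h - p x\<bar> < e"
      using eq[of _ x] by (metis real_norm_def)
  qed
qed

text \<open>Lebesgue differentiation over intervals to the right of a point gives the right
  derivative. Applied to the reflected function it gives the left one, outside another null
  set.\<close>

lemma integral_derivative_AE:
  fixes p F :: "real \<Rightarrow> real"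
  assumes int: "\<And>a b. a \<le> b \<Longrightarrow> (p has_integral F b - F a) {a..b}"
  shows "AE x in lborel. (F has_real_derivative p x) (at x)"
proof -
  obtain N where N: "negligible N" "\<And>x e. x \<notin> N \<Longrightarrow> e > 0 \<Longrightarrow>
     \<exists>d>0. \<forall>h. 0 < h \<and> h < d \<longrightarrow> \<bar>(F (x + h) - F x) / h - p x\<bar> < e"
    by (rule integral_right_derivative[of p F, OF int], assumption) (rule that; assumption)
  have int': "((\<lambda>x. p (- x)) has_integral (- F (- b)) - (- F (- a))) {a..b}" if "a \<le> b" for a b
    using has_integral_reflect_real[where f = p and a = "- b" and b = "- a"] int[of "-b" "-a"] that by simp
  obtain N' where N': "negligible N'" "\<And>x e. x \<notin> N' \<Longrightarrow> e > 0 \<Longrightarrow>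
     \<exists>d>0. \<forall>h. 0 < h \<and> h < d \<longrightarrow> \<bar>((- F (- (x + h))) - (- F (- x))) / h - p (- x)\<bar> < e"
    by (rule integral_right_derivative[of "\<lambda>x. p (- x)" "\<lambda>x. - F (- x)", OF int'], assumption)
      (rule that; assumption)
  have "(F has_real_derivative p x) (at x)" if x: "x \<notin> N" "- x \<notin> N'" for x
    unfolding DERIV_def
  proof (rule LIM_I)
    fix e :: real assume "e > 0"
    obtain d where d: "d > 0" "\<And>h. 0 < h \<Longrightarrow> h < d \<Longrightarrow> \<bar>(F (x + h) - F x) / h - p x\<bar> < e"
      using N(2)[OF x(1) \<open>e > 0\<close>] by blast
    obtain d' where d': "d' > 0" "\<And>h. 0 < h \<Longrightarrow> h < d' \<Longrightarrow> \<bar>((- F (- (- x + h))) - (- F x)) / h - p x\<bar> < e"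
      using N'(2)[OF x(2) \<open>e > 0\<close>] by auto
    show "\<exists>s>0. \<forall>h. h \<noteq> 0 \<and> norm (h - 0) < s \<longrightarrow> norm ((F (x + h) - F x) / h - p x) < e"
    proof (intro exI conjI allI impI)
      show "min d d' > 0" using d d' by simp
      fix h :: real assume h: "h \<noteq> 0 \<and> norm (h - 0) < min d d'"
      show "norm ((F (x + h) - F x) / h - p x) < e"
      proof (cases "h > 0")
        case True
        then show ?thesis using d(2)[of h] h by simp
      next
        case False
        then have "\<bar>((- F (- (- x + - h))) - (- F x)) / (- h) - p x\<bar> < e" using h by (intro d'(2)) auto
        moreover have "((- F (- (- x + - h))) - (- F x)) / (- h) = (F (x + h) - F x) / h"
          using h by (simp add: field_simps)
        ultimately show ?thesis by simp
      qed
    qed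
  qed
  then have "{x. \<not> (F has_real_derivative p x) (at x)} \<subseteq> N \<union> uminus ` N'" by force
  moreover have "negligible (N \<union> uminus ` N')"
    by (intro negligible_Un N(1) negligible_bounded_slope_image[OF N'(1), of uminus 1]) simp
  ultimately show ?thesis unfolding AE_lborel_negligible by (blast intro: negligible_subset)
qed

lemma NH_density_exists:
  assumes f: "f \<in> NH" obtains p where "density_of f p"
proof -
  obtain p where p: "p \<in> borel_measurable borel" "\<And>x. 0 \<le> p x"
    "\<And>u. u \<in> borel_measurable borel \<Longrightarrow> (\<integral>\<^sup>+x. u x \<partial>lborel) = (\<integral>\<^sup>+x. u (f x) * ennreal (p x) \<partial>lborel)"
    by (rule NH_Radon_Nikodym[OF f]) (rule that; assumption)
  note [measurable] = p(1)
  have "(p has_integral f b - f a) {a..b}" if "a \<le> b" for a b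
  proof -
    have "((\<lambda>x. indicator {a..b} x * p x) has_integral f b - f a) UNIV"
    proof (rule nn_integral_has_integral)
      have "(\<integral>\<^sup>+x. ennreal (indicator {a..b} x * p x) \<partial>lborel) = (\<integral>\<^sup>+x. indicator {f a..f b} (f x) * ennreal (p x) \<partial>lborel)"
        using f by (intro nn_integral_cong) (auto simp: indicator_def NH_le)
      also have "\<dots> = emeasure lborel {f a..f b}" by (subst p(3)[symmetric]) auto
      also have "\<dots> = ennreal (f b - f a)" using that f by (simp add: NH_le)
      finally show "(\<integral>\<^sup>+x. ennreal (indicator {a..b} x * p x) \<partial>lborel) = ennreal (f b - f a)" .
    qed (use p that f in \<open>auto simp: NH_le\<close>)
    moreover have "(\<lambda>x. indicator {a..b} x * p x) = (\<lambda>x. if x \<in> {a..b} then p x else 0)"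
      by (auto simp: indicator_def)
    ultimately show ?thesis by (simp only: has_integral_restrict_UNIV)
  qed
  then have "AE x in lborel. (f has_real_derivative p x) (at x)" by (rule integral_derivative_AE)
  then show thesis using p by (intro that[of p]) (auto simp: density_of_def)
qed

text \<open>The choice is determined only up to a null set, by \<open>dens_unique\<close>;
  identities between densities are therefore stated almost everywhere.\<close>

definition dens :: "(real \<Rightarrow> real) \<Rightarrow> real \<Rightarrow> real" where
  "dens f = (SOME p. density_of f p)"

lemma dens:
  assumes "f \<in> NH" shows "density_of f (dens f)"
  unfolding dens_def using NH_density_exists[OF assms] by (metis someI_ex)

lemma dens_measurable: "f \<in> NH \<Longrightarrow> dens f \<in> borel_measurable borel"
  and dens_nonneg: "f \<in> NH \<Longrightarrow> 0 \<le> dens f x"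
  and dens_substitution: "f \<in> NH \<Longrightarrow> u \<in> borel_measurable borel \<Longrightarrow>
     (\<integral>\<^sup>+x. u x \<partial>lborel) = (\<integral>\<^sup>+x. u (f x) * ennreal (dens f x) \<partial>lborel)"
  and dens_derivative: "f \<in> NH \<Longrightarrow> AE x in lborel. (f has_real_derivative dens f x) (at x)"
  using dens[of f] by (auto simp: density_of_def)

lemma dens_unique:
  assumes "f \<in> NH" "AE x in lborel. (f has_real_derivative q x) (at x)"
  shows "AE x in lborel. dens f x = q x"
  using dens_derivative[OF assms(1)] assms(2) by eventually_elim (rule DERIV_unique)

text \<open>The pointwise chain rule applies off the exceptional set of \<open>h\<close> and the
  preimage under \<open>h\<close> of the exceptional set of \<open>f\<close>; the latter is null
  because \<open>h\<close> belongs to \<open>NH\<close>.\<close>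

lemma dens_comp:
  assumes f: "f \<in> NH" and h: "h \<in> NH"
  shows "AE x in lborel. dens (f \<circ> h) x = dens f (h x) * dens h x"
proof (rule dens_unique)
  show "AE x in lborel. (f \<circ> h has_real_derivative dens f (h x) * dens h x) (at x)"
    using dens_derivative[OF h] NH_AE_comp[OF h dens_derivative[OF f]]
    by eventually_elim (rule DERIV_chain)
qed (use f h in simp)

lemma dens_substitution_box:
  assumes f: "f \<in> NH" and [measurable]: "u \<in> borel_measurable borel"
  shows "(\<integral>\<^sup>+x. u (f x) * ennreal (dens f x) * indicator {a..b} x \<partial>lborel) =
    (\<integral>\<^sup>+x. u x * indicator {f a..f b} x \<partial>lborel)"
proof -
  have "(\<integral>\<^sup>+x. u x * indicator {f a..f b} x \<partial>lborel) =
      (\<integral>\<^sup>+x. (u (f x) * indicator {f a..f b} (f x)) * ennreal (dens f x) \<partial>lborel)"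
    by (rule dens_substitution[OF f]) measurable
  also have "\<dots> = (\<integral>\<^sup>+x. u (f x) * ennreal (dens f x) * indicator {a..b} x \<partial>lborel)"
    using f by (intro nn_integral_cong) (auto simp: indicator_def NH_le)
  finally show ?thesis by simp
qed

lemma dens_integral:
  assumes "f \<in> NH" "a \<le> b"
  shows "(\<integral>\<^sup>+x. ennreal (dens f x) * indicator {a..b} x \<partial>lborel) = ennreal (f b - f a)"
  using dens_substitution_box[OF assms(1), of "\<lambda>_. 1" a b] assms by (simp add: NH_le)

text \<open>Taking values in \<open>ennreal\<close> reduces additivity and substitution to questions
  of measurability; \<open>L1dist_finite\<close> justifies the return to real numbers.\<close>

definition L1dist :: "(real \<Rightarrow> real) \<Rightarrow> (real \<Rightarrow> real) \<Rightarrow> ennreal" where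
  "L1dist f g = (\<integral>\<^sup>+x. ennreal \<bar>dens f x - dens g x\<bar> * indicator {0..1} x \<partial>lborel)"

lemma L1dist_finite:
  assumes f: "f \<in> NH" and g: "g \<in> NH" shows "L1dist f g < \<infinity>"
proof -
  note [measurable] = dens_measurable[OF f] dens_measurable[OF g]
  have "L1dist f g \<le> (\<integral>\<^sup>+x. ennreal (dens f x) * indicator {0..1} x + ennreal (dens g x) * indicator {0..1} x \<partial>lborel)"
    unfolding L1dist_def
  proof (intro nn_integral_mono)
    fix x
    have "ennreal \<bar>dens f x - dens g x\<bar> \<le> ennreal (dens f x) + ennreal (dens g x)"
      using dens_nonneg[OF f, of x] dens_nonneg[OF g, of x] by (simp flip: ennreal_plus)
    then show "ennreal \<bar>dens f x - dens g x\<bar> * indicator {0..1} x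
        \<le> ennreal (dens f x) * indicator {0..1} x + ennreal (dens g x) * indicator {0..1} x"
      by (auto simp: indicator_def)
  qed
  also have "\<dots> = ennreal (f 1 - f 0) + ennreal (g 1 - g 0)"
    using f g by (subst nn_integral_add) (auto simp: dens_integral)
  also have "\<dots> < \<infinity>" by simp
  finally show ?thesis .
qed

text \<open>The functions \<open>F\<close> and \<open>G\<close> are compared with \<open>f\<close>
  and \<open>g\<close> only on the open unit interval, since elements of the interval group are
  \<open>undefined\<close> outside the closed one. Derivatives are local, and the two endpoints form
  a null set.\<close>

lemma deriv_L1_dist_NH:
  assumes f: "f \<in> NH" and g: "g \<in> NH"
    and f': "\<And>x. 0 < x \<Longrightarrow> x < 1 \<Longrightarrow> F x = f x" and g': "\<And>x. 0 < x \<Longrightarrow> x < 1 \<Longrightarrow> G x = g x"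
  shows "deriv_L1_dist F G = enn2real (L1dist f g)"
proof -
  note [measurable] = dens_measurable[OF f] dens_measurable[OF g]
  have local: "deriv H x = deriv h x"
    if "0 < x" "x < 1" "\<And>x. 0 < x \<Longrightarrow> x < 1 \<Longrightarrow> H x = h x" for H h :: "real \<Rightarrow> real" and x
  proof (rule deriv_cong_ev)
    have "\<forall>\<^sub>F y in nhds x. y \<in> {0<..<1}" using that by (intro eventually_nhds_in_open) auto
    then show "\<forall>\<^sub>F y in nhds x. H y = h y" by eventually_elim (use that in auto)
  qed simp
  have ne01: "AE x in lborel. x \<noteq> (0::real) \<and> x \<noteq> 1"
    by (simp add: AE_lborel_negligible)
  have eq: "AE x in lborel. indicator {0..1} x *\<^sub>R \<bar>deriv F x - deriv G x\<bar> = indicator {0..1} x *\<^sub>R \<bar>dens f x - dens g x\<bar>"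
    using dens_derivative[OF f] dens_derivative[OF g] ne01
  proof eventually_elim
    case (elim x)
    show ?case
    proof (cases "0 < x \<and> x < 1")
      case True
      then have "deriv F x = deriv f x" "deriv G x = deriv g x"
        by (auto intro!: local f' g')
      moreover have "deriv f x = dens f x" "deriv g x = dens g x"
        using elim by (auto intro: DERIV_imp_deriv)
      ultimately show ?thesis by simp
    qed (use elim in \<open>auto simp: indicator_def\<close>)
  qed
  have "deriv_L1_dist F G = (LINT x|lebesgue. indicator {0..1} x *\<^sub>R \<bar>dens f x - dens g x\<bar>)"
    unfolding deriv_L1_dist_def set_lebesgue_integral_def
  proof (rule integral_cong_AE)
    show m: "(\<lambda>x. indicator {0..1} x *\<^sub>R \<bar>dens f x - dens g x\<bar>) \<in> borel_measurable lebesgue"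
      by (intro measurable_completion) measurable
    show "AE x in lebesgue. indicator {0..1} x *\<^sub>R \<bar>deriv F x - deriv G x\<bar> = indicator {0..1} x *\<^sub>R \<bar>dens f x - dens g x\<bar>"
      using eq by (simp only: AE_completion_iff)
    \<comment> \<open>By completeness of Lebesgue measure, measurability passes to a function that
      agrees almost everywhere with a measurable one.\<close>
    then show "(\<lambda>x. indicator {0..1} x *\<^sub>R \<bar>deriv F x - deriv G x\<bar>) \<in> borel_measurable lebesgue"
    proof (intro measurableI)
      fix A :: "real set" assume "A \<in> sets borel"
      with m have S: "(\<lambda>x. indicator {0..1} x *\<^sub>R \<bar>dens f x - dens g x\<bar>) -` A \<inter> space lebesgue \<in> sets lebesgue"
        by (rule measurable_sets)
      assume "AE x in lebesgue. indicator {0..1} x *\<^sub>R \<bar>deriv F x - deriv G x\<bar> = indicator {0..1} x *\<^sub>R \<bar>dens f x - dens g x\<bar>"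
      then have "AE x in lebesgue. (x \<in> (\<lambda>x. indicator {0..1} x *\<^sub>R \<bar>dens f x - dens g x\<bar>) -` A \<inter> space lebesgue) \<longleftrightarrow>
          (x \<in> (\<lambda>x. indicator {0..1} x *\<^sub>R \<bar>deriv F x - deriv G x\<bar>) -` A \<inter> space lebesgue)"
        by eventually_elim (simp only: vimage_eq Int_iff)
      from completion.in_sets_AE[OF this S Int_lower2]
      show "(\<lambda>x. indicator {0..1} x *\<^sub>R \<bar>deriv F x - deriv G x\<bar>) -` A \<inter> space lebesgue \<in> sets lebesgue" .
    qed simp
  qed
  also have "\<dots> = (LINT x|lborel. indicator {0..1} x *\<^sub>R \<bar>dens f x - dens g x\<bar>)"
    by (intro integral_completion) measurable
  also have "\<dots> = enn2real (\<integral>\<^sup>+x. ennreal (indicator {0..1} x *\<^sub>R \<bar>dens f x - dens g x\<bar>) \<partial>lborel)"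
    by (intro integral_eq_nn_integral) auto
  also have "(\<integral>\<^sup>+x. ennreal (indicator {0..1} x *\<^sub>R \<bar>dens f x - dens g x\<bar>) \<partial>lborel) = L1dist f g"
    unfolding L1dist_def by (intro nn_integral_cong) (auto simp: indicator_def)
  finally show ?thesis .
qed

section \<open>A left-invariant metric\<close>

lemma L1dist_triangle:
  assumes "f \<in> NH" "g \<in> NH" "h \<in> NH"
  shows "L1dist f h \<le> L1dist f g + L1dist g h"
proof -
  note [measurable] = dens_measurable[OF assms(1)] dens_measurable[OF assms(2)] dens_measurable[OF assms(3)]
  have "L1dist f h \<le> (\<integral>\<^sup>+x. ennreal \<bar>dens f x - dens g x\<bar> * indicator {0..1} x +
      ennreal \<bar>dens g x - dens h x\<bar> * indicator {0..1} x \<partial>lborel)"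
    unfolding L1dist_def
  proof (intro nn_integral_mono)
    fix x
    have "ennreal \<bar>dens f x - dens h x\<bar> \<le> ennreal \<bar>dens f x - dens g x\<bar> + ennreal \<bar>dens g x - dens h x\<bar>"
      by (simp flip: ennreal_plus)
    then show "ennreal \<bar>dens f x - dens h x\<bar> * indicator {0..1} x \<le>
        ennreal \<bar>dens f x - dens g x\<bar> * indicator {0..1} x + ennreal \<bar>dens g x - dens h x\<bar> * indicator {0..1} x"
      by (auto simp: indicator_def)
  qed
  also have "\<dots> = L1dist f g + L1dist g h"
    unfolding L1dist_def by (intro nn_integral_add) measurable
  finally show ?thesis .
qed

lemma deriv_L1_dist_eq: "f \<in> NH \<Longrightarrow> g \<in> NH \<Longrightarrow> deriv_L1_dist f g = enn2real (L1dist f g)"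
  by (rule deriv_L1_dist_NH) auto

lemma L1dist_real_triangle:
  assumes "f \<in> NH" "g \<in> NH" "h \<in> NH"
  shows "enn2real (L1dist f h) \<le> enn2real (L1dist f g) + enn2real (L1dist g h)"
  using enn2real_mono[OF L1dist_triangle[OF assms]] L1dist_finite[OF assms(1,2)] L1dist_finite[OF assms(2,3)]
  by (simp add: enn2real_plus)

lemma dens_shift:
  assumes f: "f \<in> PH" shows "AE x in lborel. dens f (x + of_int n) = dens f x"
proof -
  have fN: "f \<in> NH" using f by (rule PH_NH)
  have "AE x in lborel. dens f x = dens f (x + of_int n)"
  proof (rule dens_unique[OF fN])
    show "AE x in lborel. (f has_real_derivative dens f (x + of_int n)) (at x)"
      using NH_AE_comp[OF NH_translation dens_derivative[OF fN], of "of_int n"]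
    proof eventually_elim
      case (elim x)
      then have "((\<lambda>x. f (x + of_int n)) has_real_derivative dens f (x + of_int n)) (at x)"
        by (simp only: DERIV_shift)
      then have "((\<lambda>x. f (x + of_int n) - of_int n) has_real_derivative dens f (x + of_int n) - 0) (at x)"
        by (intro DERIV_diff DERIV_const)
      then show ?case by (simp add: PH_shift[OF f])
    qed
  qed
  then show ?thesis by eventually_elim simp
qed

lemma nn_integral_period:
  fixes w :: "real \<Rightarrow> ennreal"
  assumes [measurable]: "w \<in> borel_measurable borel" and per: "\<And>n::int. AE x in lborel. w (x + of_int n) = w x"
  shows "(\<integral>\<^sup>+x. w x * indicator {a..a + 1} x \<partial>lborel) = (\<integral>\<^sup>+x. w x * indicator {0..1} x \<partial>lborel)"
proof -
  have closed: "(\<integral>\<^sup>+x. w x * indicator {b..c} x \<partial>lborel) = (\<integral>\<^sup>+x. w x * indicator {b..<c} x \<partial>lborel)" for b c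
  proof (rule nn_integral_cong_AE)
    have "AE x in lborel. x \<noteq> c" by (simp add: AE_lborel_negligible)
    then show "AE x in lborel. w x * indicator {b..c} x = w x * indicator {b..<c} x"
      by eventually_elim (auto simp: indicator_def)
  qed
  have split: "(\<integral>\<^sup>+x. w x * indicator {b..<d} x \<partial>lborel) =
      (\<integral>\<^sup>+x. w x * indicator {b..<c} x \<partial>lborel) + (\<integral>\<^sup>+x. w x * indicator {c..<d} x \<partial>lborel)"
    if "b \<le> c" "c \<le> d" for b c d
  proof -
    have "(\<integral>\<^sup>+x. w x * indicator {b..<d} x \<partial>lborel) =
        (\<integral>\<^sup>+x. w x * indicator {b..<c} x + w x * indicator {c..<d} x \<partial>lborel)"
      using that by (intro nn_integral_cong) (auto simp: indicator_def)
    then show ?thesis by (simp add: nn_integral_add)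
  qed
  have shift: "(\<integral>\<^sup>+x. w x * indicator {b + of_int n..<c + of_int n} x \<partial>lborel) = (\<integral>\<^sup>+x. w x * indicator {b..<c} x \<partial>lborel)"
    for b c and n :: int
  proof -
    have "(\<integral>\<^sup>+x. w x * indicator {b + of_int n..<c + of_int n} x \<partial>lborel) =
        (\<integral>\<^sup>+x. w (of_int n + 1 * x) * indicator {b + of_int n..<c + of_int n} (of_int n + 1 * x) \<partial>lborel)"
      by (subst nn_integral_real_affine[of _ 1 "of_int n"]) auto
    also have "\<dots> = (\<integral>\<^sup>+x. w x * indicator {b..<c} x \<partial>lborel)"
    proof (rule nn_integral_cong_AE)
      show "AE x in lborel. w (of_int n + 1 * x) * indicator {b + of_int n..<c + of_int n} (of_int n + 1 * x)
          = w x * indicator {b..<c} x"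
        using per[of n] by eventually_elim (auto simp: indicator_def add.commute)
    qed
    finally show ?thesis .
  qed
  \<comment> \<open>An integer between \<open>a\<close> and \<open>a + 1\<close>. The period is cut
    there, and the two pieces, shifted by \<open>n - 1\<close> and by \<open>n\<close>, fill the
    unit interval; half-open intervals make the cuts exact.\<close>
  define n where "n = \<lceil>a\<rceil>"
  have n: "a \<le> of_int n" "of_int n \<le> a + 1" unfolding n_def by linarith+
  have "(\<integral>\<^sup>+x. w x * indicator {a..<a + 1} x \<partial>lborel) =
      (\<integral>\<^sup>+x. w x * indicator {a - of_int (n - 1)..<1} x \<partial>lborel) + (\<integral>\<^sup>+x. w x * indicator {0..<a + 1 - of_int n} x \<partial>lborel)"
    using split[OF n] shift[of "a - of_int (n - 1)" "n - 1" 1] shift[of 0 n "a + 1 - of_int n"] by simp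
  also have "\<dots> = (\<integral>\<^sup>+x. w x * indicator {0..<1} x \<partial>lborel)"
    using split[of 0 "a + 1 - of_int n" 1] n by (simp add: algebra_simps)
  finally show ?thesis by (simp only: closed)
qed

text \<open>Substitution turns the unit interval into the one from \<open>h 0\<close> to
  \<open>h 0 + 1\<close>. This is again a full period of the densities, so the integral is
  unchanged.\<close>

lemma L1dist_right_invariant:
  assumes f: "f \<in> PH" and g: "g \<in> PH" and h: "h \<in> PH"
  shows "L1dist (f \<circ> h) (g \<circ> h) = L1dist f g"
proof -
  note N = PH_NH[OF f] PH_NH[OF g] PH_NH[OF h]
  note [measurable] = dens_measurable[OF N(1)] dens_measurable[OF N(2)]
  let ?u = "\<lambda>x. ennreal \<bar>dens f x - dens g x\<bar>"
  have "L1dist (f \<circ> h) (g \<circ> h) = (\<integral>\<^sup>+x. ?u (h x) * ennreal (dens h x) * indicator {0..1} x \<partial>lborel)"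
    unfolding L1dist_def
  proof (rule nn_integral_cong_AE)
    show "AE x in lborel. ennreal \<bar>dens (f \<circ> h) x - dens (g \<circ> h) x\<bar> * indicator {0..1} x =
        ?u (h x) * ennreal (dens h x) * indicator {0..1} x"
      using dens_comp[OF N(1,3)] dens_comp[OF N(2,3)]
    proof eventually_elim
      case (elim x)
      then have "\<bar>dens (f \<circ> h) x - dens (g \<circ> h) x\<bar> = \<bar>dens f (h x) - dens g (h x)\<bar> * dens h x"
        using dens_nonneg[OF N(3), of x] by (simp add: abs_mult flip: left_diff_distrib)
      then show ?case by (simp add: ennreal_mult')
    qed
  qed
  also have "\<dots> = (\<integral>\<^sup>+x. ?u x * indicator {h 0..h 1} x \<partial>lborel)"
    by (rule dens_substitution_box[OF N(3)]) measurable
  also have "h 1 = h 0 + 1" using PH_shift[OF h, of 0 1] by simp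
  also have "(\<integral>\<^sup>+x. ?u x * indicator {h 0..h 0 + 1} x \<partial>lborel) = L1dist f g"
    unfolding L1dist_def
  proof (rule nn_integral_period)
    show "AE x in lborel. ?u (x + of_int n) = ?u x" for n :: int
      using dens_shift[OF f, of n] dens_shift[OF g, of n] by eventually_elim simp
  qed measurable
  finally show ?thesis .
qed

definition supdist :: "(real \<Rightarrow> real) \<Rightarrow> (real \<Rightarrow> real) \<Rightarrow> real" where
  "supdist f g = (SUP x\<in>{0..1}. \<bar>f x - g x\<bar>)"

lemma PH_diff_bdd:
  assumes "f \<in> PH" "g \<in> PH" shows "bdd_above ((\<lambda>x. \<bar>f x - g x\<bar>) ` {0..1})"
proof -
  have "continuous_on {0..1} (\<lambda>x. \<bar>f x - g x\<bar>)"
    using assms by (intro continuous_intros continuous_on_subset[OF NH_continuous]) (auto simp: PH_NH)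
  then have "compact ((\<lambda>x. \<bar>f x - g x\<bar>) ` {0..1})" by (rule compact_continuous_image) simp
  then show ?thesis by (intro bounded_imp_bdd_above compact_imp_bounded)
qed

lemma supdist_ge:
  assumes "f \<in> PH" "g \<in> PH" shows "\<bar>f x - g x\<bar> \<le> supdist f g"
proof -
  obtain k t where x: "x = of_int k + t" "0 \<le> t" "t < 1" by (rule real_int_frac)
  have "\<bar>f t - g t\<bar> \<le> supdist f g"
    unfolding supdist_def using x PH_diff_bdd[OF assms] by (intro cSUP_upper) auto
  then show ?thesis using assms PH_shift[of f t k] PH_shift[of g t k] x by (simp add: add.commute)
qed

lemma supdist_le: "(\<And>x. 0 \<le> x \<Longrightarrow> x \<le> 1 \<Longrightarrow> \<bar>f x - g x\<bar> \<le> c) \<Longrightarrow> supdist f g \<le> c"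
  unfolding supdist_def by (intro cSUP_least) auto

lemma AC_line_dist_PH:
  "f \<in> PH \<Longrightarrow> g \<in> PH \<Longrightarrow> AC_line_dist f g = supdist f g + enn2real (L1dist f g)"
  by (simp add: AC_line_dist_def carrier_AC_line deriv_L1_dist_eq PH_NH supdist_def)

lemma AC_line_dist_sym: "AC_line_dist f g = AC_line_dist g f"
  by (simp add: AC_line_dist_def deriv_L1_dist_def abs_minus_commute)

lemma supdist_nonneg: "f \<in> PH \<Longrightarrow> g \<in> PH \<Longrightarrow> 0 \<le> supdist f g"
  using supdist_ge[of f g 0] by linarith

lemma AC_line_dist_nonneg: "0 \<le> AC_line_dist f g"
proof (cases "f \<in> PH \<and> g \<in> PH")
  case True
  then show ?thesis by (simp add: AC_line_dist_PH supdist_nonneg)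
qed (auto simp: AC_line_dist_def carrier_AC_line)

lemma AC_line_dist_ge: "f \<in> PH \<Longrightarrow> g \<in> PH \<Longrightarrow> \<bar>f x - g x\<bar> \<le> AC_line_dist f g"
  using supdist_ge[of f g x] by (simp add: AC_line_dist_PH add_increasing2)

lemma AC_line_dist_zero: "f \<in> PH \<Longrightarrow> g \<in> PH \<Longrightarrow> AC_line_dist f g = 0 \<longleftrightarrow> f = g"
proof
  assume "f \<in> PH" "g \<in> PH" "AC_line_dist f g = 0"
  then show "f = g" using AC_line_dist_ge[of f g] by auto
next
  assume "f \<in> PH" "g \<in> PH" "f = g"
  then show "AC_line_dist f g = 0" by (simp add: AC_line_dist_PH supdist_def L1dist_def)
qed

lemma AC_line_dist_triangle:
  assumes "f \<in> PH" "g \<in> PH" "h \<in> PH"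
  shows "AC_line_dist f h \<le> AC_line_dist f g + AC_line_dist g h"
proof -
  have "supdist f h \<le> supdist f g + supdist g h"
    using supdist_ge[OF assms(1,2)] supdist_ge[OF assms(2,3)] by (intro supdist_le) (smt (verit))
  then show ?thesis
    using L1dist_real_triangle[of f g h] assms by (simp add: AC_line_dist_PH PH_NH)
qed

lemma Metric_space_line: "Metric_space PH AC_line_dist"
  by unfold_locales (use AC_line_dist_nonneg AC_line_dist_sym AC_line_dist_zero AC_line_dist_triangle in auto)

lemma AC_line_dist_right_invariant:
  assumes "f \<in> PH" "g \<in> PH" "h \<in> PH"
  shows "AC_line_dist (f \<circ> h) (g \<circ> h) = AC_line_dist f g"
proof -
  have le: "supdist (a \<circ> k) (b \<circ> k) \<le> supdist a b" if "a \<in> PH" "b \<in> PH" for a b k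
    using supdist_ge[OF that] by (intro supdist_le) simp
  have "f \<circ> h \<circ> rinv h = f" "g \<circ> h \<circ> rinv h = g"
    using assms(3) by (auto simp: PH_NH)
  then have "supdist f g \<le> supdist (f \<circ> h) (g \<circ> h)"
    using le[of "f \<circ> h" "g \<circ> h" "rinv h"] assms by (simp add: PH_comp)
  then have "supdist (f \<circ> h) (g \<circ> h) = supdist f g" using le[OF assms(1,2), of h] by simp
  then show ?thesis
    using assms L1dist_right_invariant[OF assms] by (simp add: AC_line_dist_PH PH_comp)
qed

text \<open>The density is first truncated at a height \<open>M\<close>, with small loss by
  dominated convergence. The truncated density is then the limit of truncated difference quotients,
  which are continuous and dominated by \<open>M\<close>.\<close>

lemma dens_approx:
  assumes F: "F \<in> NH" and ab: "a \<le> b" and e: "(e::real) > 0"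
  obtains v :: "real \<Rightarrow> real" and M :: real where "continuous_on UNIV v" "M \<ge> 0" "\<And>x. 0 \<le> v x" "\<And>x. v x \<le> M"
    "(\<integral>\<^sup>+x. ennreal \<bar>dens F x - v x\<bar> * indicator {a..b} x \<partial>lborel) < ennreal e"
proof -
  note [measurable] = dens_measurable[OF F] NH_measurable[OF F]
  note nonneg = dens_nonneg[OF F]
  have e2: "ennreal (e/2) > 0" using e by simp
  have "(\<lambda>M::nat. \<integral>\<^sup>+x. ennreal (dens F x - min (dens F x) M) * indicator {a..b} x \<partial>lborel) \<longlonglongrightarrow> (\<integral>\<^sup>+x. 0 \<partial>(lborel :: real measure))"
  proof (rule nn_integral_dominated_convergence)
    show "AE x in lborel. ennreal (dens F x - min (dens F x) (real M)) * indicator {a..b} x \<le> ennreal (dens F x) * indicator {a..b} x" for M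
      using nonneg by (intro AE_I2 mult_right_mono ennreal_leI) (auto simp: min_def)
    show "(\<integral>\<^sup>+x. ennreal (dens F x) * indicator {a..b} x \<partial>lborel) < \<infinity>"
      by (simp add: dens_integral[OF F ab])
    show "AE x in lborel. (\<lambda>M. ennreal (dens F x - min (dens F x) (real M)) * indicator {a..b} x) \<longlonglongrightarrow> 0"
    proof (intro AE_I2 tendsto_eventually)
      fix x
      obtain m :: nat where "dens F x \<le> real m" using real_arch_simple by blast
      then have "min (dens F x) (real M) = dens F x" if "M \<ge> m" for M
        using that by (simp add: min_def)
      then show "\<forall>\<^sub>F M in sequentially. ennreal (dens F x - min (dens F x) (real M)) * indicator {a..b} x = 0"
        unfolding eventually_sequentially by (intro exI[of _ m]) simp
    qed
  qed auto
  then have "\<forall>\<^sub>F M in sequentially. (\<integral>\<^sup>+x. ennreal (dens F x - min (dens F x) (real M)) * indicator {a..b} x \<partial>lborel) < ennreal (e/2)"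
    using e2 by (intro order_tendstoD(2)) auto
  then obtain M :: nat where M: "(\<integral>\<^sup>+x. ennreal (dens F x - min (dens F x) M) * indicator {a..b} x \<partial>lborel) < ennreal (e/2)"
    unfolding eventually_sequentially by blast
  \<comment> \<open>Difference quotients of the continuous \<open>F\<close> are continuous, are
    nonnegative by monotonicity, and converge to the density almost everywhere.\<close>
  define w where "w n x = (F (x + 1 / real (Suc n)) - F x) / (1 / real (Suc n))" for n x
  have w_nonneg: "0 \<le> w n x" for n x
    using F by (simp add: w_def NH_le)
  have w_cont: "continuous_on UNIV (w n)" for n
    unfolding w_def
    by (intro continuous_intros continuous_on_compose2[OF NH_continuous[OF F]]) auto
  have [measurable]: "w n \<in> borel_measurable borel" for n
    using w_cont by (rule borel_measurable_continuous_onI)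
  have w_lim: "AE x in lborel. (\<lambda>n. w n x) \<longlonglongrightarrow> dens F x"
    using dens_derivative[OF F]
  proof eventually_elim
    case (elim x)
    have "filterlim (\<lambda>n. 1 / real (Suc n)) (at 0) sequentially"
      using LIMSEQ_Suc[OF lim_1_over_n[where 'a = real]] by (intro filterlim_atI) auto
    with elim[unfolded DERIV_def] show ?case
      unfolding w_def by (rule filterlim_compose)
  qed
  have "(\<lambda>n. \<integral>\<^sup>+x. ennreal \<bar>min (dens F x) M - min (w n x) M\<bar> * indicator {a..b} x \<partial>lborel) \<longlonglongrightarrow> (\<integral>\<^sup>+x. 0 \<partial>(lborel :: real measure))"
  proof (rule nn_integral_dominated_convergence)
    show "AE x in lborel. ennreal \<bar>min (dens F x) M - min (w n x) M\<bar> * indicator {a..b} x \<le> ennreal M * indicator {a..b} x" for n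
    proof (intro AE_I2 mult_right_mono ennreal_leI)
      fix x show "\<bar>min (dens F x) M - min (w n x) M\<bar> \<le> real M"
        using nonneg[of x] w_nonneg[of n x] by (auto simp: min_def abs_if)
    qed simp
    show "(\<integral>\<^sup>+x. ennreal M * indicator {a..b} x \<partial>lborel) < \<infinity>"
      using ab by (simp add: nn_integral_cmult ennreal_mult_less_top)
    show "AE x in lborel. (\<lambda>n. ennreal \<bar>min (dens F x) M - min (w n x) M\<bar> * indicator {a..b} x) \<longlonglongrightarrow> 0"
      using w_lim
    proof eventually_elim
      case (elim x)
      have "(\<lambda>n. ennreal \<bar>min (dens F x) M - min (w n x) M\<bar>) \<longlonglongrightarrow> ennreal \<bar>min (dens F x) M - min (dens F x) M\<bar>"
        using elim by (intro tendsto_intros)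
      then show ?case by (cases "x \<in> {a..b}") auto
    qed
  qed auto
  then have "\<forall>\<^sub>F n in sequentially. (\<integral>\<^sup>+x. ennreal \<bar>min (dens F x) M - min (w n x) M\<bar> * indicator {a..b} x \<partial>lborel) < ennreal (e/2)"
    using e2 by (intro order_tendstoD(2)) auto
  then obtain n where n: "(\<integral>\<^sup>+x. ennreal \<bar>min (dens F x) M - min (w n x) M\<bar> * indicator {a..b} x \<partial>lborel) < ennreal (e/2)"
    unfolding eventually_sequentially by blast
  show thesis
  proof (rule that[of "\<lambda>x. min (w n x) (real M)" "real M"])
    show "continuous_on UNIV (\<lambda>x. min (w n x) (real M))"
      by (intro continuous_intros w_cont)
    have "(\<integral>\<^sup>+x. ennreal \<bar>dens F x - min (w n x) M\<bar> * indicator {a..b} x \<partial>lborel) \<le>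
        (\<integral>\<^sup>+x. ennreal (dens F x - min (dens F x) M) * indicator {a..b} x +
          ennreal \<bar>min (dens F x) M - min (w n x) M\<bar> * indicator {a..b} x \<partial>lborel)"
    proof (intro nn_integral_mono)
      fix x
      have "\<bar>dens F x - min (w n x) M\<bar> \<le> (dens F x - min (dens F x) M) + \<bar>min (dens F x) M - min (w n x) M\<bar>"
        by linarith
      then have "ennreal \<bar>dens F x - min (w n x) M\<bar> \<le> ennreal ((dens F x - min (dens F x) M) + \<bar>min (dens F x) M - min (w n x) M\<bar>)"
        by (rule ennreal_leI)
      also have "\<dots> = ennreal (dens F x - min (dens F x) M) + ennreal \<bar>min (dens F x) M - min (w n x) M\<bar>"
        by (intro ennreal_plus) auto
      finally show "ennreal \<bar>dens F x - min (w n x) M\<bar> * indicator {a..b} x \<le>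
          ennreal (dens F x - min (dens F x) M) * indicator {a..b} x +
          ennreal \<bar>min (dens F x) M - min (w n x) M\<bar> * indicator {a..b} x"
        by (auto simp: indicator_def)
    qed
    also have "\<dots> = (\<integral>\<^sup>+x. ennreal (dens F x - min (dens F x) M) * indicator {a..b} x \<partial>lborel) +
       (\<integral>\<^sup>+x. ennreal \<bar>min (dens F x) M - min (w n x) M\<bar> * indicator {a..b} x \<partial>lborel)"
      by (intro nn_integral_add) measurable
    also have "\<dots> < ennreal (e/2) + ennreal (e/2)" using M n by (rule add_strict_mono)
    also have "\<dots> = ennreal e" using e by (simp flip: ennreal_plus)
    finally show "(\<integral>\<^sup>+x. ennreal \<bar>dens F x - min (w n x) M\<bar> * indicator {a..b} x \<partial>lborel) < ennreal e" .
  qed (use w_nonneg in auto)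
qed

lemma uniformly_continuous_Icc:
  fixes v :: "real \<Rightarrow> real"
  assumes "continuous_on UNIV v" "e > 0"
  obtains d where "d > 0" "\<And>s t. s \<in> {a..b} \<Longrightarrow> t \<in> {a..b} \<Longrightarrow> \<bar>s - t\<bar> < d \<Longrightarrow> \<bar>v s - v t\<bar> < e"
proof -
  have "uniformly_continuous_on {a..b} v"
    using assms(1) by (intro compact_uniformly_continuous) (auto intro: continuous_on_subset)
  from this[unfolded uniformly_continuous_on_def, rule_format, OF assms(2)]
  obtain d where "d > 0" "\<And>s t. s \<in> {a..b} \<Longrightarrow> t \<in> {a..b} \<Longrightarrow> dist t s < d \<Longrightarrow> dist (v t) (v s) < e"
    by blast
  then show thesis by (intro that[of d]) (auto simp: dist_real_def)
qed

text \<open>For \<open>y = g t + k\<close> with \<open>t\<close> in the unit interval, the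
  difference of the inverses at \<open>y\<close> equals \<open>rinv f (g t) - rinv f (f t)\<close>.
  Uniform continuity of \<open>rinv f\<close> makes it small; the interval from
  \<open>f 0 - 1\<close> to \<open>f 0 + 2\<close> contains \<open>f t\<close> and
  \<open>g t\<close> as soon as \<open>f\<close> and \<open>g\<close> are within 1 of each
  other.\<close>

lemma supdist_inv_small:
  assumes f: "f \<in> PH" and e: "e > 0"
  obtains d where "d > 0" "\<And>g. g \<in> PH \<Longrightarrow> supdist f g < d \<Longrightarrow> supdist (rinv f) (rinv g) \<le> e"
proof -
  have fN: "f \<in> NH" using f by (rule PH_NH)
  obtain d where d: "d > 0" "\<And>s t. s \<in> {f 0 - 1..f 0 + 2} \<Longrightarrow> t \<in> {f 0 - 1..f 0 + 2} \<Longrightarrow>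
      \<bar>s - t\<bar> < d \<Longrightarrow> \<bar>rinv f s - rinv f t\<bar> < e"
    by (rule uniformly_continuous_Icc[OF NH_continuous[OF NH_inv[OF fN]] e]) (rule that; assumption)
  show thesis
  proof (rule that[of "min d 1"])
    show "min d 1 > 0" using d by simp
    fix g assume g: "g \<in> PH" and small: "supdist f g < min d 1"
    have gN: "g \<in> NH" using g by (rule PH_NH)
    show "supdist (rinv f) (rinv g) \<le> e"
    proof (rule supdist_le)
      fix y :: real
      obtain k t where x: "rinv g y = of_int k + t" "0 \<le> t" "t < 1" by (rule real_int_frac)
      have "y = g (of_int k + t)" using gN by (simp flip: x(1))
      then have y: "y = g t + of_int k" using PH_shift[OF g, of t k] by (simp add: add.commute)
      have fg: "\<bar>f t - g t\<bar> < min d 1" using supdist_ge[OF f g, of t] small by simp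
      have "f 0 \<le> f t" "f t \<le> f 1" using fN x by (simp_all add: NH_le)
      then have "f 0 \<le> f t" "f t \<le> f 0 + 1" using PH_shift[OF f, of 0 1] by simp_all
      then have "\<bar>rinv f (g t) - rinv f (f t)\<bar> < e" using fg by (intro d(2)) auto
      moreover have "rinv f y = rinv f (g t) + of_int k" unfolding y by (rule PH_shift[OF PH_inv[OF f]])
      ultimately show "\<bar>rinv f y - rinv g y\<bar> \<le> e" using x fN by simp
    qed
  qed
qed

text \<open>By right invariance the distance of \<open>rinv f\<close> and \<open>rinv g\<close> is that of \<open>rinv f \<circ> g\<close> and
  \<open>rinv f \<circ> f\<close>. In their derivatives the factor \<open>(rinv f)'\<close> is only integrable, but it can be replaced by a
  bounded continuous approximation \<open>v\<close>, since substitution turns the error back into the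
  distance of \<open>(rinv f)'\<close> and \<open>v\<close>.\<close>

lemma L1dist_inv_small:
  assumes f: "f \<in> PH" and e: "e > 0"
  obtains d where "d > 0" "\<And>g. g \<in> PH \<Longrightarrow> supdist f g < d \<Longrightarrow> enn2real (L1dist f g) < d \<Longrightarrow>
    enn2real (L1dist (rinv f) (rinv g)) \<le> 4 * e"
proof -
  have fN: "f \<in> NH" using f by (rule PH_NH)
  let ?K = "{f 0 - 1..f 0 + 2}"
  obtain v M where v: "continuous_on UNIV v" "M \<ge> 0" "\<And>x. 0 \<le> v x" "\<And>x. v x \<le> M"
    "(\<integral>\<^sup>+x. ennreal \<bar>dens (rinv f) x - v x\<bar> * indicator ?K x \<partial>lborel) < ennreal e"
    by (rule dens_approx[OF NH_inv[OF fN], of "f 0 - 1" "f 0 + 2" e]) (use e in auto)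
  obtain d where d: "d > 0" "\<And>s t. s \<in> ?K \<Longrightarrow> t \<in> ?K \<Longrightarrow> \<bar>s - t\<bar> < d \<Longrightarrow> \<bar>v s - v t\<bar> < e"
    by (rule uniformly_continuous_Icc[OF v(1) e]) (rule that; assumption)
  \<comment> \<open>The bound 1 keeps the values of \<open>g\<close> inside \<open>?K\<close>, the
    bound \<open>d\<close> keeps \<open>v (g x)\<close> close to \<open>v (f x)\<close>, and the
    last bound gives \<open>M * D \<le> e\<close>; the denominator \<open>M + 1\<close> is positive
    even if \<open>M = 0\<close>.\<close>
  define D where "D = min (min d 1) (e / (M + 1))"
  have Dpos: "D > 0" using d e v(2) by (simp add: D_def)
  have MD: "M * D \<le> e"
  proof -
    have "M * D \<le> M * (e / (M + 1))" using v(2) by (intro mult_left_mono) (auto simp: D_def)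
    also have "\<dots> \<le> e" using v(2) e by (simp add: field_simps)
    finally show ?thesis .
  qed
  show thesis
  proof (rule that[OF Dpos])
    fix g assume g: "g \<in> PH" and small: "supdist f g < D" and L1: "enn2real (L1dist f g) < D"
    have gN: "g \<in> NH" using g by (rule PH_NH)
    let ?u = "dens (rinv f)"
    note [measurable] = dens_measurable[OF fN] dens_measurable[OF gN] dens_measurable[OF NH_inv[OF fN]]
      NH_measurable[OF fN] NH_measurable[OF gN] borel_measurable_continuous_onI[OF v(1)]
    have fg: "\<bar>f x - g x\<bar> < D" for x using supdist_ge[OF f g, of x] small by simp
    have f1: "f 1 = f 0 + 1" and g1: "g 1 = g 0 + 1" using PH_shift[OF f, of 0 1] PH_shift[OF g, of 0 1] by simp_all
    have D1: "D \<le> 1" "D \<le> d" by (simp_all add: D_def)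
    have inK: "f x \<in> ?K" "g x \<in> ?K" if "0 \<le> x" "x \<le> 1" for x
    proof -
      have "f 0 \<le> f x" "f x \<le> f 1" using fN that by (simp_all add: NH_le)
      then show "f x \<in> ?K" "g x \<in> ?K" using fg[of x] D1 f1 by auto
    qed
    have tail: "(\<integral>\<^sup>+x. ennreal \<bar>?u (h x) - v (h x)\<bar> * ennreal (dens h x) * indicator {0..1} x \<partial>lborel) \<le> ennreal e"
      if hN: "h \<in> NH" and hK: "{h 0..h 1} \<subseteq> ?K" for h
    proof -
      have "(\<integral>\<^sup>+x. ennreal \<bar>?u (h x) - v (h x)\<bar> * ennreal (dens h x) * indicator {0..1} x \<partial>lborel) =
          (\<integral>\<^sup>+x. ennreal \<bar>?u x - v x\<bar> * indicator {h 0..h 1} x \<partial>lborel)"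
        by (rule dens_substitution_box[OF hN]) measurable
      also have "\<dots> \<le> (\<integral>\<^sup>+x. ennreal \<bar>?u x - v x\<bar> * indicator ?K x \<partial>lborel)"
        using hK by (intro nn_integral_mono mult_left_mono) (auto simp: indicator_def)
      also have "\<dots> \<le> ennreal e" using v(5) by simp
      finally show ?thesis .
    qed
    have "L1dist (rinv f) (rinv g) = L1dist (rinv f \<circ> g) (rinv g \<circ> g)"
      by (rule L1dist_right_invariant[symmetric]) (intro PH_inv f g)+
    also have "rinv g \<circ> g = id" using gN by auto
    also have "id = rinv f \<circ> f" using fN by auto
    also have "L1dist (rinv f \<circ> g) (rinv f \<circ> f) \<le>
        (\<integral>\<^sup>+x. (ennreal \<bar>?u (g x) - v (g x)\<bar> * ennreal (dens g x) * indicator {0..1} x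
          + ennreal \<bar>?u (f x) - v (f x)\<bar> * ennreal (dens f x) * indicator {0..1} x)
          + (ennreal M * (ennreal \<bar>dens f x - dens g x\<bar> * indicator {0..1} x)
          + ennreal e * (ennreal (dens f x) * indicator {0..1} x)) \<partial>lborel)"
      unfolding L1dist_def
    proof (rule nn_integral_mono_AE)
      show "AE x in lborel. ennreal \<bar>dens (rinv f \<circ> g) x - dens (rinv f \<circ> f) x\<bar> * indicator {0..1} x \<le>
          (ennreal \<bar>?u (g x) - v (g x)\<bar> * ennreal (dens g x) * indicator {0..1} x
          + ennreal \<bar>?u (f x) - v (f x)\<bar> * ennreal (dens f x) * indicator {0..1} x)
          + (ennreal M * (ennreal \<bar>dens f x - dens g x\<bar> * indicator {0..1} x)
          + ennreal e * (ennreal (dens f x) * indicator {0..1} x))"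
        using dens_comp[OF NH_inv[OF fN] gN] dens_comp[OF NH_inv[OF fN] fN]
      proof eventually_elim
        case (elim x)
        show ?case
        proof (cases "x \<in> {0..1}")
          case True
          have p: "0 \<le> dens f x" "0 \<le> dens g x" using fN gN by (simp_all add: dens_nonneg)
          have vfg: "\<bar>v (g x) - v (f x)\<bar> < e"
            using inK[of x] True fg[of x] D1 by (intro d(2)) auto
          \<comment> \<open>Each of the four terms integrates to at most \<open>e\<close>: the first
            two by substitution and the choice of \<open>v\<close>, the third because
            \<open>v \<le> M\<close> and the densities of \<open>f\<close> and \<open>g\<close> are
            close, the fourth by uniform continuity of \<open>v\<close> and because
            \<open>dens f\<close> has integral 1.\<close>
          have split: "dens (rinv f \<circ> g) x - dens (rinv f \<circ> f) x =
            (?u (g x) - v (g x)) * dens g x - (?u (f x) - v (f x)) * dens f x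
            - v (g x) * (dens f x - dens g x) + (v (g x) - v (f x)) * dens f x"
            by (simp add: elim algebra_simps)
          have "\<bar>dens (rinv f \<circ> g) x - dens (rinv f \<circ> f) x\<bar> \<le> \<bar>(?u (g x) - v (g x)) * dens g x\<bar> + \<bar>(?u (f x) - v (f x)) * dens f x\<bar>
            + \<bar>v (g x) * (dens f x - dens g x)\<bar> + \<bar>(v (g x) - v (f x)) * dens f x\<bar>"
            unfolding split by linarith
          also have "\<dots> = \<bar>?u (g x) - v (g x)\<bar> * dens g x + \<bar>?u (f x) - v (f x)\<bar> * dens f x
            + v (g x) * \<bar>dens f x - dens g x\<bar> + \<bar>v (g x) - v (f x)\<bar> * dens f x"
            by (simp only: abs_mult abs_of_nonneg[OF p(1)] abs_of_nonneg[OF p(2)] abs_of_nonneg[OF v(3)])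
          also have "\<dots> \<le> \<bar>?u (g x) - v (g x)\<bar> * dens g x + \<bar>?u (f x) - v (f x)\<bar> * dens f x
            + M * \<bar>dens f x - dens g x\<bar> + e * dens f x"
            using p v(4) vfg by (intro add_mono mult_right_mono) auto
          finally have le: "\<bar>dens (rinv f \<circ> g) x - dens (rinv f \<circ> f) x\<bar> \<le>
            (\<bar>?u (g x) - v (g x)\<bar> * dens g x + \<bar>?u (f x) - v (f x)\<bar> * dens f x)
            + (M * \<bar>dens f x - dens g x\<bar> + e * dens f x)" by (simp only: add.assoc)
          show ?thesis
            using ennreal_leI[OF le] True p v(2) less_imp_le[OF e] by (simp add: ennreal_plus ennreal_mult)
        qed simp
      qed
    qed
    also have "\<dots> = ((\<integral>\<^sup>+x. ennreal \<bar>?u (g x) - v (g x)\<bar> * ennreal (dens g x) * indicator {0..1} x \<partial>lborel)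
          + (\<integral>\<^sup>+x. ennreal \<bar>?u (f x) - v (f x)\<bar> * ennreal (dens f x) * indicator {0..1} x \<partial>lborel))
          + (ennreal M * L1dist f g + ennreal e * (\<integral>\<^sup>+x. ennreal (dens f x) * indicator {0..1} x \<partial>lborel))"
      unfolding L1dist_def by (simp add: nn_integral_add nn_integral_cmult)
    also have "\<dots> \<le> (ennreal e + ennreal e) + (ennreal M * ennreal D + ennreal e * 1)"
    proof (intro add_mono mult_left_mono tail fN gN)
      show "{g 0..g 1} \<subseteq> ?K" using inK(2)[of 0] inK(2)[of 1] by auto
      show "{f 0..f 1} \<subseteq> ?K" using inK(1)[of 0] inK(1)[of 1] by auto
      have "L1dist f g = ennreal (enn2real (L1dist f g))"
        using L1dist_finite[OF fN gN] by (simp add: less_top)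
      then show "L1dist f g \<le> ennreal D" using L1 by (metis ennreal_leI less_imp_le)
      show "(\<integral>\<^sup>+x. ennreal (dens f x) * indicator {0..1} x \<partial>lborel) \<le> 1"
        using dens_integral[OF fN, of 0 1] f1 by simp
    qed auto
    also have "\<dots> = ennreal (3 * e + M * D)"
      using e v(2) Dpos by (simp add: ennreal_plus[symmetric] ennreal_mult[symmetric] del: ennreal_plus)
    also have "\<dots> \<le> ennreal (4 * e)" using MD by (intro ennreal_leI) simp
    finally show "enn2real (L1dist (rinv f) (rinv g)) \<le> 4 * e"
      using e by (intro enn2real_leI) auto
  qed
qed

lemma AC_line_inv_continuous:
  assumes f: "f \<in> PH" and e: "e > 0"
  obtains d where "d > 0" "\<And>g. g \<in> PH \<Longrightarrow> AC_line_dist f g < d \<Longrightarrow> AC_line_dist (rinv f) (rinv g) < e"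
proof -
  obtain d1 where d1: "d1 > 0" "\<And>g. g \<in> PH \<Longrightarrow> supdist f g < d1 \<Longrightarrow> supdist (rinv f) (rinv g) \<le> e/4"
    by (rule supdist_inv_small[OF f, of "e/4"]) (use e in auto)
  obtain d2 where d2: "d2 > 0" "\<And>g. g \<in> PH \<Longrightarrow> supdist f g < d2 \<Longrightarrow> enn2real (L1dist f g) < d2 \<Longrightarrow>
    enn2real (L1dist (rinv f) (rinv g)) \<le> 4 * (e/16)"
    by (rule L1dist_inv_small[OF f, of "e/16"]) (use e in auto)
  show thesis
  proof (rule that[of "min d1 d2"])
    show "min d1 d2 > 0" using d1 d2 by simp
    fix g assume g: "g \<in> PH" and small: "AC_line_dist f g < min d1 d2"
    then have "supdist f g < min d1 d2" "enn2real (L1dist f g) < min d1 d2"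
      using supdist_nonneg[OF f g] enn2real_nonneg[of "L1dist f g"]
      unfolding AC_line_dist_PH[OF f g] by linarith+
    then show "AC_line_dist (rinv f) (rinv g) < e"
      using d1(2)[OF g] d2(2)[OF g] e by (simp add: AC_line_dist_PH PH_inv f g)
  qed
qed

definition left_dist :: "(real \<Rightarrow> real) \<Rightarrow> (real \<Rightarrow> real) \<Rightarrow> real" where
  "left_dist f g = AC_line_dist (rinv f) (rinv g)"

lemma PH_inv_inv: "f \<in> PH \<Longrightarrow> rinv (rinv f) = f"
  by (simp add: PH_NH NH_inv_inv)

lemma Metric_space_left_dist: "Metric_space PH left_dist"
proof
  show "0 \<le> left_dist x y" for x y by (simp add: left_dist_def AC_line_dist_nonneg)
  show "left_dist x y = left_dist y x" for x y by (simp add: left_dist_def AC_line_dist_sym)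
  show "left_dist x y = 0 \<longleftrightarrow> x = y" if "x \<in> PH" "y \<in> PH" for x y
    using that AC_line_dist_zero[OF PH_inv PH_inv] PH_inv_inv by (metis left_dist_def)
  show "left_dist x z \<le> left_dist x y + left_dist y z" if "x \<in> PH" "y \<in> PH" "z \<in> PH" for x y z
    using that by (simp add: left_dist_def AC_line_dist_triangle PH_inv)
qed

text \<open>Continuity of inversion at \<open>f\<close> and at \<open>rinv f\<close> nests the balls
  of the two metrics in each other, so the topologies agree. Inversion exchanges the two sides,
  which turns right invariance into left invariance.\<close>

lemma left_dist_compatible: "compatible_left_invariant AC_line AC_line_top left_dist"
  unfolding compatible_left_invariant_def carrier_AC_line
proof (intro conjI ballI)
  interpret A: Metric_space PH AC_line_dist by (rule Metric_space_line)
  interpret B: Metric_space PH left_dist by (rule Metric_space_left_dist)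
  show "Metric_space PH left_dist" by (rule Metric_space_left_dist)
  have AB: "\<exists>d>0. A.mball f d \<subseteq> B.mball f e" if fe: "f \<in> PH" "e > 0" for f e
  proof -
    obtain d where "d > 0" "\<And>g. g \<in> PH \<Longrightarrow> AC_line_dist f g < d \<Longrightarrow> AC_line_dist (rinv f) (rinv g) < e"
      by (rule AC_line_inv_continuous[OF fe]) (rule that; assumption)
    then show ?thesis using fe by (intro exI[of _ d]) (auto simp: left_dist_def)
  qed
  have BA: "\<exists>d>0. B.mball f d \<subseteq> A.mball f e" if fe: "f \<in> PH" "e > 0" for f e
  proof -
    obtain d where d: "d > 0" "\<And>g. g \<in> PH \<Longrightarrow> AC_line_dist (rinv f) g < d \<Longrightarrow> AC_line_dist (rinv (rinv f)) (rinv g) < e"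
      by (rule AC_line_inv_continuous[OF PH_inv[OF fe(1)] fe(2)]) (rule that; assumption)
    have "AC_line_dist f g < e" if "g \<in> PH" "AC_line_dist (rinv f) (rinv g) < d" for g
      using d(2)[OF PH_inv[OF that(1)] that(2)] that \<open>f \<in> PH\<close> by (simp add: PH_inv_inv)
    then show ?thesis using fe d(1) by (intro exI[of _ d]) (auto simp: left_dist_def)
  qed
  have "openin B.mtopology U \<longleftrightarrow> openin A.mtopology U" for U
    unfolding A.openin_mtopology B.openin_mtopology using AB BA by (meson order_trans subsetD)
  then show "Metric_space.mtopology PH left_dist = AC_line_top"
    by (simp add: topology_eq AC_line_top_def carrier_AC_line)
  show "left_dist (g \<otimes>\<^bsub>AC_line\<^esub> x) (g \<otimes>\<^bsub>AC_line\<^esub> y) = left_dist x y"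
    if "g \<in> PH" "x \<in> PH" "y \<in> PH" for g x y
    using that by (simp add: mult_AC_line left_dist_def NH_inv_comp PH_NH AC_line_dist_right_invariant PH_inv)
qed

section \<open>Length functions on groups\<close>

definition length_function :: "('a, 'b) monoid_scheme \<Rightarrow> ('a \<Rightarrow> real) \<Rightarrow> bool" where
  "length_function G L \<longleftrightarrow> (\<forall>x\<in>carrier G. \<forall>y\<in>carrier G. L (x \<otimes>\<^bsub>G\<^esub> y) \<le> L x + L y) \<and>
     (\<forall>x\<in>carrier G. L (inv\<^bsub>G\<^esub> x) \<le> L x)"

text \<open>A purely algebraic property. It implies coarse boundedness for any topology on the
  group.\<close>

definition strongly_bounded :: "('a, 'b) monoid_scheme \<Rightarrow> bool" where
  "strongly_bounded G \<longleftrightarrow> (\<forall>L. length_function G L \<longrightarrow> (\<exists>C. \<forall>x\<in>carrier G. L x \<le> C))"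

definition word_length :: "('a, 'b) monoid_scheme \<Rightarrow> 'a set \<Rightarrow> 'a \<Rightarrow> real" where
  "word_length G S x = real (LEAST k. x \<in> set_power G (S \<union> set_inv\<^bsub>G\<^esub> S) k)"

lemma word_dist_word_length: "word_dist G S x y = word_length G S (inv\<^bsub>G\<^esub> x \<otimes>\<^bsub>G\<^esub> y)"
  by (simp add: word_dist_def word_length_def)

context group begin

lemma length_function_invariant_metric:
  assumes d: "compatible_left_invariant G T d"
  shows "length_function G (d \<one>)"
proof -
  interpret Metric_space "carrier G" d using d by (simp add: compatible_left_invariant_def)
  have inva: "d (g \<otimes> x) (g \<otimes> y) = d x y" if "g \<in> carrier G" "x \<in> carrier G" "y \<in> carrier G" for g x y
    using d that by (simp add: compatible_left_invariant_def)
  show ?thesis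
    unfolding length_function_def
  proof (intro conjI ballI)
    fix x y assume xy: "x \<in> carrier G" "y \<in> carrier G"
    show "d \<one> (x \<otimes> y) \<le> d \<one> x + d \<one> y"
      using triangle[of \<one> x "x \<otimes> y"] inva[of x \<one> y] xy by simp
    show "d \<one> (inv x) \<le> d \<one> x"
      using inva[of x \<one> "inv x"] xy by (simp add: commute)
  qed
qed

lemma set_power_carrier: "A \<subseteq> carrier G \<Longrightarrow> set_power G A k \<subseteq> carrier G"
  by (induction k) (auto simp: set_mult_def)

lemma set_power_mult:
  assumes A: "A \<subseteq> carrier G" and x: "x \<in> set_power G A m" and y: "y \<in> set_power G A n"
  shows "x \<otimes> y \<in> set_power G A (m + n)"
  using y
proof (induction n arbitrary: y)
  case 0
  moreover have "x \<in> carrier G" using x set_power_carrier[OF A, of m] by blast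
  ultimately show ?case using x by simp
next
  case (Suc n)
  then obtain y' a where y: "y' \<in> set_power G A n" "a \<in> A" "y = y' \<otimes> a" by (auto simp: set_mult_def)
  have "x \<in> carrier G" "y' \<in> carrier G" "a \<in> carrier G" using x y A set_power_carrier[OF A] by auto
  then have "x \<otimes> y = (x \<otimes> y') \<otimes> a" by (simp add: y m_assoc)
  then show ?case using Suc.IH[OF y(1)] y(2) by (auto simp: set_mult_def)
qed

lemma set_power_one: "A \<subseteq> carrier G \<Longrightarrow> a \<in> A \<Longrightarrow> a \<in> set_power G A 1"
  by (auto simp: set_mult_def intro!: bexI[of _ a])

lemma set_power_inv:
  assumes A: "A \<subseteq> carrier G" "\<And>a. a \<in> A \<Longrightarrow> inv a \<in> A" and x: "x \<in> set_power G A n"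
  shows "inv x \<in> set_power G A n"
  using x
proof (induction n arbitrary: x)
  case (Suc n)
  then obtain y a where y: "y \<in> set_power G A n" "a \<in> A" "x = y \<otimes> a" by (auto simp: set_mult_def)
  have "y \<in> carrier G" "a \<in> carrier G" using y A set_power_carrier[OF A(1)] by auto
  then have "inv x = inv a \<otimes> inv y" by (simp add: y inv_mult_group)
  then show ?case
    using set_power_mult[OF A(1) set_power_one[OF A(1) A(2)[OF y(2)]] Suc.IH[OF y(1)]] by simp
qed simp

lemma generate_set_power:
  assumes S: "S \<subseteq> carrier G" and x: "x \<in> generate G S"
  shows "\<exists>k. x \<in> set_power G (S \<union> set_inv S) k"
proof -
  have A: "S \<union> set_inv S \<subseteq> carrier G" using S by (auto simp: SET_INV_def)
  show ?thesis
    using x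
  proof (induction rule: generate.induct)
    case one
    have "\<one> \<in> set_power G (S \<union> set_inv S) 0" by simp
    then show ?case ..
  next
    case (incl h)
    then have "h \<in> set_power G (S \<union> set_inv S) 1" by (intro set_power_one[OF A]) simp
    then show ?case ..
  next
    case (inv h)
    then have "inv h \<in> set_power G (S \<union> set_inv S) 1" by (intro set_power_one[OF A]) (auto simp: SET_INV_def)
    then show ?case ..
  next
    case (eng h1 h2)
    then show ?case using set_power_mult[OF A] by blast
  qed
qed

lemma word_length_power:
  assumes S: "S \<subseteq> carrier G" "generate G S = carrier G" and x: "x \<in> carrier G"
  obtains k where "word_length G S x = real k" "x \<in> set_power G (S \<union> set_inv S) k"
  using LeastI_ex[OF generate_set_power[OF S(1), of x]] S(2) x that by (auto simp: word_length_def)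

lemma word_length_le: "x \<in> set_power G (S \<union> set_inv S) k \<Longrightarrow> word_length G S x \<le> real k"
  by (simp add: word_length_def Least_le)

lemma length_function_word_length:
  assumes S: "S \<subseteq> carrier G" "generate G S = carrier G"
  shows "length_function G (word_length G S)"
  unfolding length_function_def
proof (intro conjI ballI)
  have A: "S \<union> set_inv S \<subseteq> carrier G" "\<And>a. a \<in> S \<union> set_inv S \<Longrightarrow> inv a \<in> S \<union> set_inv S"
    using S(1) by (auto simp: SET_INV_def)
  fix x y assume x: "x \<in> carrier G" and y: "y \<in> carrier G"
  obtain k where k: "word_length G S x = real k" "x \<in> set_power G (S \<union> set_inv S) k"
    by (rule word_length_power[OF S x])
  obtain l where l: "word_length G S y = real l" "y \<in> set_power G (S \<union> set_inv S) l"
    by (rule word_length_power[OF S y])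
  show "word_length G S (x \<otimes> y) \<le> word_length G S x + word_length G S y"
    using word_length_le[OF set_power_mult[OF A(1) k(2) l(2)]] k l by simp
  show "word_length G S (inv x) \<le> word_length G S x"
    using word_length_le[OF set_power_inv[OF A k(2)]] k by simp
qed

text \<open>This yields lower bounds on word lengths: a length function bounded on the generators
  grows at most linearly along words. The condition on \<open>\<one>\<close> accounts for the empty
  word.\<close>

lemma length_le_word_length:
  assumes L: "length_function G L" and S: "S \<subseteq> carrier G" "generate G S = carrier G"
    and B: "\<And>s. s \<in> S \<Longrightarrow> L s \<le> B" "L \<one> \<le> 0" and x: "x \<in> carrier G"
  shows "L x \<le> B * word_length G S x"
proof -
  have A: "S \<union> set_inv S \<subseteq> carrier G" using S(1) by (auto simp: SET_INV_def)
  have AB: "L a \<le> B" if "a \<in> S \<union> set_inv S" for a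
    using that
  proof
    assume "a \<in> set_inv S"
    then obtain s where s: "s \<in> S" "a = inv s" by (auto simp: SET_INV_def)
    then have "L a \<le> L s" using L S(1) by (auto simp: length_function_def)
    then show "L a \<le> B" using B(1)[OF s(1)] by simp
  qed (rule B)
  have pow: "L x \<le> B * real k" if "x \<in> set_power G (S \<union> set_inv S) k" for x k
    using that
  proof (induction k arbitrary: x)
    case (Suc k)
    then obtain y a where y: "y \<in> set_power G (S \<union> set_inv S) k" "a \<in> S \<union> set_inv S" "x = y \<otimes> a"
      by (auto simp: set_mult_def)
    have "y \<in> carrier G" "a \<in> carrier G" using y A set_power_carrier[OF A, of k] by auto
    then have "L x \<le> L y + L a" using L by (simp add: length_function_def y(3))
    then show ?case using Suc.IH[OF y(1)] AB[OF y(2)] by (simp add: algebra_simps)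
  qed (use B(2) in simp)
  obtain k where "word_length G S x = real k" "x \<in> set_power G (S \<union> set_inv S) k"
    by (rule word_length_power[OF S x])
  then show ?thesis using pow by simp
qed

lemma coarsely_bounded_inI:
  assumes S: "S \<subseteq> carrier G" and bdd: "\<And>L. length_function G L \<Longrightarrow> \<exists>C. \<forall>x\<in>S. L x \<le> C"
  shows "coarsely_bounded_in G T S"
  unfolding coarsely_bounded_in_def
proof (intro conjI allI impI S)
  fix d assume d: "compatible_left_invariant G T d"
  interpret Metric_space "carrier G" d using d by (simp add: compatible_left_invariant_def)
  obtain C where "\<forall>x\<in>S. d \<one> x \<le> C"
    using bdd[OF length_function_invariant_metric[OF d]] by blast
  then have "S \<subseteq> mcball \<one> C" using S by (auto simp: in_mcball)
  then show "mbounded S" by (auto simp: mbounded_def)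
qed

text \<open>The word length of any generating set is itself a length function. Hence it is bounded
  and the word metric has finite diameter.\<close>

lemma strongly_bounded_quasi_isometry_type:
  assumes sb: "strongly_bounded G" and M: "Metric_space (carrier G) d"
    and T: "T = Metric_space.mtopology (carrier G) d"
  shows "coarsely_bounded_group G T" "generated_by_coarsely_bounded G T"
    "has_quasi_isometry_type G T {()} (\<lambda>_ _. 0)"
proof -
  show cb: "coarsely_bounded_group G T"
    unfolding coarsely_bounded_group_def
    using sb by (intro coarsely_bounded_inI) (auto simp: strongly_bounded_def)
  have gen: "generate G (carrier G) = carrier G"
    using generate_incl[of "carrier G"] by (auto intro: generate.incl)
  show "generated_by_coarsely_bounded G T"
    unfolding generated_by_coarsely_bounded_def using cb gen by (auto simp: coarsely_bounded_group_def)
  show "has_quasi_isometry_type G T {()} (\<lambda>_ _. 0)"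
    unfolding has_quasi_isometry_type_def
  proof (intro conjI allI impI)
    have "closedin T (carrier G)" unfolding T by (rule Metric_space.closedin_mspace[OF M])
    then show "\<exists>S. closedin T S \<and> coarsely_bounded_in G T S \<and> generate G S = carrier G"
      using cb gen by (auto simp: coarsely_bounded_group_def)
    fix S assume "closedin T S \<and> coarsely_bounded_in G T S \<and> generate G S = carrier G"
    then have S: "S \<subseteq> carrier G" "generate G S = carrier G" by (auto simp: coarsely_bounded_in_def)
    have "\<exists>C. \<forall>x\<in>carrier G. word_length G S x \<le> C"
      using sb length_function_word_length[OF S] unfolding strongly_bounded_def by blast
    then obtain C where C: "\<And>x. x \<in> carrier G \<Longrightarrow> word_length G S x \<le> C" by blast
    have C0: "0 \<le> C" using C[OF one_closed] by (simp add: word_length_def)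
    have "word_dist G S x y \<le> C" if "x \<in> carrier G" "y \<in> carrier G" for x y
      using that by (simp add: word_dist_word_length C)
    moreover have "0 \<le> word_dist G S x y" for x y by (simp add: word_dist_def)
    ultimately show "quasi_isometric (carrier G) (word_dist G S) {()} (\<lambda>_ _. 0)"
      unfolding quasi_isometric_def
      by (intro exI[of _ "\<lambda>_. ()"] exI[of _ 1] exI[of _ C]) (use C0 in \<open>auto intro!: bexI[of _ \<one>]\<close>)
  qed
qed

end

text \<open>The map \<open>\<phi>\<close> may fail to be injective. It stands for restriction to the
  unit interval and for the passage to the circle; in the latter case integer translations are
  lost.\<close>

lemma group_image:
  assumes carrier: "carrier G = \<phi> ` H" and one: "\<one>\<^bsub>G\<^esub> = \<phi> id"
    and mult: "\<And>f g. f \<in> H \<Longrightarrow> g \<in> H \<Longrightarrow> \<phi> f \<otimes>\<^bsub>G\<^esub> \<phi> g = \<phi> (f \<circ> g)"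
    and H: "id \<in> H" "\<And>f g. f \<in> H \<Longrightarrow> g \<in> H \<Longrightarrow> f \<circ> g \<in> H" "\<And>f. f \<in> H \<Longrightarrow> rinv f \<in> H" "H \<subseteq> NH"
  shows "group G" "\<And>f. f \<in> H \<Longrightarrow> inv\<^bsub>G\<^esub> (\<phi> f) = \<phi> (rinv f)"
proof -
  have inv_l: "\<phi> (rinv f) \<otimes>\<^bsub>G\<^esub> \<phi> f = \<one>\<^bsub>G\<^esub>" if "f \<in> H" for f
    using that H by (simp add: mult one NH_bij bij_is_inj subset_iff)
  show G: "group G"
  proof (rule groupI)
    fix x assume "x \<in> carrier G"
    then show "\<exists>y\<in>carrier G. y \<otimes>\<^bsub>G\<^esub> x = \<one>\<^bsub>G\<^esub>" using inv_l H(3) by (auto simp: carrier)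
  qed (auto simp: carrier one mult H(1,2) comp_assoc)
  show "inv\<^bsub>G\<^esub> (\<phi> f) = \<phi> (rinv f)" if "f \<in> H" for f
    using that H(3) by (intro group.inv_equality[OF G inv_l]) (auto simp: carrier)
qed

section \<open>The group on the interval\<close>

lemma abs_cont_on_cong:
  assumes "\<And>x. a \<le> x \<Longrightarrow> x \<le> b \<Longrightarrow> f x = g x"
  shows "abs_cont_on a b f \<longleftrightarrow> abs_cont_on a b g"
proof -
  have "(\<Sum>(u, v)\<in>D. \<bar>f v - f u\<bar>) = (\<Sum>(u, v)\<in>D. \<bar>g v - g u\<bar>)"
    if "\<forall>(u, v)\<in>D. a \<le> u \<and> u < v \<and> v \<le> b" for D
    using that assms by (intro sum.cong) fastforce+
  then show ?thesis unfolding abs_cont_on_def by (metis (no_types, lifting))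
qed

lemma Stab0_unit: "f \<in> Stab0 \<Longrightarrow> f x \<in> {0..1} \<longleftrightarrow> x \<in> {0..1}"
  using NH_le[of f 0 x] NH_le[of f x 1] PH_shift[of f 0 1] by (auto simp: Stab0_def PH_NH)

lemma Stab0_group:
  shows "id \<in> Stab0" "\<And>f g. f \<in> Stab0 \<Longrightarrow> g \<in> Stab0 \<Longrightarrow> f \<circ> g \<in> Stab0"
    "\<And>f. f \<in> Stab0 \<Longrightarrow> rinv f \<in> Stab0" "Stab0 \<subseteq> NH"
proof -
  show "rinv f \<in> Stab0" if "f \<in> Stab0" for f
    using that NH_inv_f[of f 0] by (simp add: Stab0_def PH_inv PH_NH)
qed (auto simp: Stab0_def PH_id PH_comp PH_NH)

abbreviation unit_restrict :: "(real \<Rightarrow> real) \<Rightarrow> real \<Rightarrow> real" where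
  "unit_restrict f \<equiv> restrict f {0..1}"

lemma unit_restrict_inv_into:
  assumes f: "f \<in> Stab0" and x: "x \<in> {0..1}"
  shows "inv_into {0..1} (unit_restrict f) x = rinv f x"
proof (rule inv_into_f_eq)
  have N: "f \<in> NH" using f by (simp add: Stab0_PH PH_NH)
  then show "inj_on (unit_restrict f) {0..1}" by (auto simp: inj_on_def NH_eq)
  show "rinv f x \<in> {0..1}" using Stab0_unit[OF Stab0_group(3)[OF f]] x by blast
  then show "unit_restrict f (rinv f x) = x" using N by simp
qed

lemma carrier_AC_interval: "carrier AC_interval = unit_restrict ` Stab0"
proof
  show "carrier AC_interval \<subseteq> unit_restrict ` Stab0"
  proof
    fix g assume "g \<in> carrier AC_interval"
    then obtain k where g: "g \<in> extensional {0..1}" "homeomorphism {0..1} {0..1} g k"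
      "strict_mono_on {0..1} g" "abs_cont_on 0 1 g" "abs_cont_on 0 1 (inv_into {0..1} g)"
      by (auto simp: AC_interval_def)
    note hom = homeomorphism_def[THEN iffD1, OF g(2)]
    let ?k = "inv_into {0..1} g"
    have inj: "inj_on g {0..1}" using g(3) by (rule strict_mono_on_imp_inj_on)
    have kk: "?k y = k y" if "y \<in> {0..1}" for y
      using inj hom that by (intro inv_into_f_eq) auto
    have kmem: "?k y \<in> {0..1}" "g (?k y) = y" if "y \<in> {0..1}" for y
      using hom that kk by auto
    have kcont: "continuous_on {0..1} ?k"
      using hom kk by (metis continuous_on_cong)
    have kmono: "strict_mono_on {0..1} ?k"
    proof (rule strict_mono_onI)
      fix x y :: real assume "x \<in> {0..1}" "y \<in> {0..1}" "x < y"
      then show "?k x < ?k y"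
        using strict_mono_on_less[OF g(3), of "?k x" "?k y"] kmem by simp
    qed
    have surj: "g ` {0..1} = {0..1}" using hom by auto
    have im: "negligible (g ` N)" if "N \<subseteq> {0..1}" "negligible N" for N
      using abs_cont_on_negligible_image[OF g(4,3) _ that] hom by simp
    have vim: "negligible {x \<in> {0..1}. g x \<in> N}" if "N \<subseteq> {0..1}" "negligible N" for N
    proof -
      have "{x \<in> {0..1}. g x \<in> N} \<subseteq> ?k ` N"
        using inj by (auto intro!: rev_image_eqI)
      then show ?thesis
        using abs_cont_on_negligible_image[OF g(5) kmono kcont that] by (rule negligible_subset[rotated])
    qed
    note per = periodize_Stab0[OF g(3) surj im vim]
    have "g = unit_restrict (periodize g)"
      using per(4) g(1) by (auto simp: restrict_def extensional_def fun_eq_iff)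
    then show "g \<in> unit_restrict ` Stab0" using per(1) by blast
  qed
  show "unit_restrict ` Stab0 \<subseteq> carrier AC_interval"
  proof
    fix g assume "g \<in> unit_restrict ` Stab0"
    then obtain f where f: "f \<in> Stab0" "g = unit_restrict f" by blast
    have N: "f \<in> NH" using f by (simp add: Stab0_PH PH_NH)
    note mem = Stab0_unit[OF f(1)] Stab0_unit[OF Stab0_group(3)[OF f(1)]]
    have "homeomorphism {0..1} {0..1} g (rinv f)"
    proof (rule homeomorphismI)
      show "continuous_on {0..1} g"
        using continuous_on_subset[OF NH_continuous[OF N], of "{0..1}"]
        by (rule continuous_on_eq) (simp_all add: f(2))
      show "continuous_on {0..1} (rinv f)"
        using continuous_on_subset[OF NH_continuous[OF NH_inv[OF N]], of "{0..1}"] by simp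
      show "g ` {0..1} \<subseteq> {0..1}" "rinv f ` {0..1} \<subseteq> {0..1}" using mem f(2) by auto
      show "rinv f (g x) = x" if "x \<in> {0..1}" for x using that f(2) N by simp
      show "g (rinv f y) = y" if "y \<in> {0..1}" for y using that f(2) N mem(2)[of y] by simp
    qed
    moreover have "strict_mono_on {0..1} g" using N by (auto simp: strict_mono_on_def f(2) NH_less)
    moreover have "abs_cont_on 0 1 g"
      using NH_loc_abs_cont[OF N] abs_cont_on_cong[of 0 1 g f] by (simp add: f(2) loc_abs_cont_def)
    moreover have "abs_cont_on 0 1 (inv_into {0..1} g)"
      using NH_loc_abs_cont[OF NH_inv[OF N]] abs_cont_on_cong[of 0 1 "inv_into {0..1} g" "rinv f"]
        unit_restrict_inv_into[OF f(1)] by (simp add: f(2) loc_abs_cont_def)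
    ultimately show "g \<in> carrier AC_interval" by (auto simp: AC_interval_def f(2))
  qed
qed

lemma AC_interval_mult:
  assumes "f \<in> Stab0" "g \<in> Stab0"
  shows "unit_restrict f \<otimes>\<^bsub>AC_interval\<^esub> unit_restrict g = unit_restrict (f \<circ> g)"
proof -
  have bij: "unit_restrict f \<in> Bij {0..1}" if "f \<in> Stab0" for f
  proof -
    have "homeomorphism {0..1} {0..1} (unit_restrict f) k \<Longrightarrow> bij_betw (unit_restrict f) {0..1} {0..1}" for k
      by (auto simp: homeomorphism_def bij_betw_def intro: inj_on_inverseI)
    moreover have "unit_restrict f \<in> carrier AC_interval" using that by (simp add: carrier_AC_interval)
    ultimately show ?thesis by (auto simp: AC_interval_def Bij_def)
  qed
  have "unit_restrict f \<otimes>\<^bsub>AC_interval\<^esub> unit_restrict g = compose {0..1} (unit_restrict f) (unit_restrict g)"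
    using bij assms by (simp add: AC_interval_def BijGroup_def)
  also have "\<dots> = unit_restrict (f \<circ> g)"
    using Stab0_unit[OF assms(2)] by (auto simp: compose_def restrict_def fun_eq_iff)
  finally show ?thesis .
qed

lemma AC_interval_one: "\<one>\<^bsub>AC_interval\<^esub> = unit_restrict id"
  by (simp add: AC_interval_def BijGroup_def restrict_def fun_eq_iff)

lemma AC_interval_group: "group AC_interval"
  and AC_interval_inv: "f \<in> Stab0 \<Longrightarrow> inv\<^bsub>AC_interval\<^esub> (unit_restrict f) = unit_restrict (rinv f)"
  using group_image[OF carrier_AC_interval AC_interval_one AC_interval_mult Stab0_group] by blast+

lemma AC_interval_strongly_bounded: "strongly_bounded AC_interval"
  unfolding strongly_bounded_def
proof (intro allI impI)
  fix L assume "length_function AC_interval L"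
  then have L: "\<forall>f\<in>Stab0. \<forall>g\<in>Stab0. L (unit_restrict f \<otimes>\<^bsub>AC_interval\<^esub> unit_restrict g) \<le> L (unit_restrict f) + L (unit_restrict g)"
    "\<forall>f\<in>Stab0. L (inv\<^bsub>AC_interval\<^esub> (unit_restrict f)) \<le> L (unit_restrict f)"
    unfolding length_function_def carrier_AC_interval by blast+
  have "L (unit_restrict (f \<circ> g)) \<le> L (unit_restrict f) + L (unit_restrict g)" if "f \<in> Stab0" "g \<in> Stab0" for f g
    using L(1)[rule_format, OF that] unfolding AC_interval_mult[OF that] .
  moreover have "L (unit_restrict (rinv f)) \<le> L (unit_restrict f)" if "f \<in> Stab0" for f
    using L(2)[rule_format, OF that] unfolding AC_interval_inv[OF that] .
  ultimately obtain C where "\<And>f. f \<in> Stab0 \<Longrightarrow> L (unit_restrict f) \<le> C"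
    using Stab0_length_bounded[of "\<lambda>f. L (unit_restrict f)"] by blast
  then show "\<exists>C. \<forall>x\<in>carrier AC_interval. L x \<le> C" by (auto simp: carrier_AC_interval)
qed

text \<open>Points are separated although only derivatives are compared: all elements take the value
  0 at 0, so integrating equal densities from 0 to \<open>t\<close> recovers equal values.\<close>

lemma Metric_space_AC_interval: "Metric_space (carrier AC_interval) deriv_L1_dist"
proof
  have eq: "deriv_L1_dist (unit_restrict f) (unit_restrict g) = enn2real (L1dist f g)"
    if "f \<in> Stab0" "g \<in> Stab0" for f g
    using that by (intro deriv_L1_dist_NH) (auto simp: Stab0_PH PH_NH)
  show "0 \<le> deriv_L1_dist x y" for x y
    unfolding deriv_L1_dist_def set_lebesgue_integral_def by (intro integral_nonneg_AE) auto
  show "deriv_L1_dist x y = deriv_L1_dist y x" for x y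
    by (simp add: deriv_L1_dist_def abs_minus_commute)
  show "deriv_L1_dist x z \<le> deriv_L1_dist x y + deriv_L1_dist y z"
    if xyz: "x \<in> carrier AC_interval" "y \<in> carrier AC_interval" "z \<in> carrier AC_interval" for x y z
  proof -
    obtain f g h where "f \<in> Stab0" "g \<in> Stab0" "h \<in> Stab0" "x = unit_restrict f" "y = unit_restrict g" "z = unit_restrict h"
      using xyz by (auto simp: carrier_AC_interval)
    then show ?thesis using L1dist_real_triangle[of f g h] Stab0_group(4) by (auto simp: eq)
  qed
  show "deriv_L1_dist x y = 0 \<longleftrightarrow> x = y" if xy: "x \<in> carrier AC_interval" "y \<in> carrier AC_interval" for x y
  proof
    obtain f g where f: "f \<in> Stab0" "x = unit_restrict f" and g: "g \<in> Stab0" "y = unit_restrict g"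
      using xy by (auto simp: carrier_AC_interval)
    have N: "f \<in> NH" "g \<in> NH" using f g by (simp_all add: Stab0_PH PH_NH)
    note [measurable] = dens_measurable[OF N(1)] dens_measurable[OF N(2)]
    assume "deriv_L1_dist x y = 0"
    then have "enn2real (L1dist f g) = 0" by (simp add: f g eq)
    then have "L1dist f g = 0" using L1dist_finite[OF N] by (auto simp: enn2real_eq_0_iff)
    then have ae: "AE x in lborel. ennreal \<bar>dens f x - dens g x\<bar> * indicator {0..1} x = 0"
      unfolding L1dist_def by (subst (asm) nn_integral_0_iff_AE) auto
    have "f t = g t" if t: "0 \<le> t" "t \<le> 1" for t
    proof -
      have "(\<integral>\<^sup>+x. ennreal (dens f x) * indicator {0..t} x \<partial>lborel) = (\<integral>\<^sup>+x. ennreal (dens g x) * indicator {0..t} x \<partial>lborel)"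
      proof (rule nn_integral_cong_AE)
        show "AE x in lborel. ennreal (dens f x) * indicator {0..t} x = ennreal (dens g x) * indicator {0..t} x"
          using ae by eventually_elim (use t in \<open>auto simp: indicator_def split: if_splits\<close>)
      qed
      then have "ennreal (f t - f 0) = ennreal (g t - g 0)" using t by (simp add: dens_integral N)
      moreover have "f 0 = 0" "g 0 = 0" "0 \<le> f t" "0 \<le> g t"
        using f g t NH_le[OF N(1), of 0 t] NH_le[OF N(2), of 0 t] by (auto simp: Stab0_def)
      ultimately show ?thesis by simp
    qed
    then show "x = y" by (auto simp: f g restrict_def fun_eq_iff)
  qed (simp add: deriv_L1_dist_def set_lebesgue_integral_def)
qed

section \<open>The group on the circle\<close>

lemma circle_proj_in_circle [simp]: "circle_proj x \<in> circle"
  by (simp add: circle_proj_def)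

lemma norm_circle_proj [simp]: "norm (circle_proj x) = 1"
  by (simp add: circle_proj_def)

lemma circle_proj_eq: "circle_proj x = circle_proj y \<longleftrightarrow> (\<exists>n::int. x = y + of_int n)"
proof -
  have "circle_proj x = circle_proj y \<longleftrightarrow>
      (\<exists>n::int. 2 * of_real pi * \<i> * of_real x = 2 * of_real pi * \<i> * of_real y + (of_int (2 * n) * pi) * \<i>)"
    by (simp add: circle_proj_def exp_eq)
  also have "\<dots> \<longleftrightarrow> (\<exists>n::int. x = y + of_int n)"
  proof (intro ex_cong1)
    fix n :: int
    have "2 * of_real pi * \<i> * of_real x = 2 * of_real pi * \<i> * of_real y + (of_int (2 * n) * pi) * \<i> \<longleftrightarrow>
        (2 * of_real pi * \<i>) * of_real x = (2 * of_real pi * \<i>) * complex_of_real (y + of_int n)"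
      by (simp add: algebra_simps)
    also have "\<dots> \<longleftrightarrow> x = y + of_int n"
      by (simp del: of_real_add of_real_of_int_eq)
    finally show "2 * of_real pi * \<i> * of_real x = 2 * of_real pi * \<i> * of_real y + (of_int (2 * n) * pi) * \<i> \<longleftrightarrow> x = y + of_int n" .
  qed
  finally show ?thesis .
qed

lemma circle_proj_add_int [simp]: "circle_proj (x + of_int n) = circle_proj x"
  by (auto simp: circle_proj_eq)

lemma circle_proj_surj:
  assumes "z \<in> circle" obtains x where "z = circle_proj x"
proof -
  have "z = exp (\<i> * of_real (Arg2pi z))"
    using Arg2pi_eq[of z] assms by (simp add: is_Arg_def)
  then have "z = circle_proj (Arg2pi z / (2 * pi))" by (simp add: circle_proj_def field_simps)
  then show thesis by (rule that)
qed

lemma continuous_on_circle_proj: "continuous_on S circle_proj"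
  unfolding circle_proj_def by (intro continuous_intros)

lemma circle_dist_proj: "circle_dist (circle_proj a) (circle_proj b) = dist_int (a - b)"
proof -
  let ?A = "circle_proj -` {circle_proj a}" and ?B = "circle_proj -` {circle_proj b}"
  have A: "?A = range (\<lambda>n::int. a + of_int n)" and B: "?B = range (\<lambda>n::int. b + of_int n)"
    by (auto simp: circle_proj_eq)
  have "setdist ?A ?B \<le> dist_int (a - b)"
  proof -
    have "setdist ?A ?B \<le> dist a (b + of_int (round (a - b)))"
      by (rule setdist_le_dist) simp_all
    then show ?thesis by (simp add: dist_int_def dist_real_def algebra_simps)
  qed
  moreover have "dist_int (a - b) \<le> setdist ?A ?B"
  proof (rule le_setdistI)
    fix x y assume "x \<in> ?A" "y \<in> ?B"
    then obtain m n where "x = a + of_int m" "y = b + of_int n" by (auto simp: A B)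
    then show "dist_int (a - b) \<le> dist x y"
      using dist_int_le[of "a - b" "n - m"] by (simp add: dist_real_def algebra_simps)
  qed auto
  ultimately show ?thesis by (simp add: circle_dist_def)
qed

lemma dist_int_triangle: "dist_int (a - c) \<le> dist_int (a - b) + dist_int (b - c)"
  using dist_int_le[of "a - c" "round (a - b) + round (b - c)"] unfolding dist_int_def by (simp; linarith)

lemma dist_int_eq_0: "dist_int x = 0 \<longleftrightarrow> (\<exists>n::int. x = of_int n)"
  using dist_int_le[of x] dist_int_nonneg[of x] by (auto simp: dist_int_def)

text \<open>For \<open>f\<close> in \<open>PH\<close> the choice of the preimage is immaterial,
  because another choice changes \<open>f\<close> by an integer.\<close>

definition to_circle :: "(real \<Rightarrow> real) \<Rightarrow> complex \<Rightarrow> complex" where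
  "to_circle f = (\<lambda>z\<in>circle. circle_proj (f (SOME x. circle_proj x = z)))"

lemma to_circle_proj:
  assumes "f \<in> PH" shows "to_circle f (circle_proj x) = circle_proj (f x)"
proof -
  have "circle_proj (SOME y. circle_proj y = circle_proj x) = circle_proj x"
    by (rule someI[of _ x]) simp
  then obtain n :: int where "(SOME y. circle_proj y = circle_proj x) = x + of_int n"
    by (auto simp: circle_proj_eq)
  then show ?thesis using PH_shift[OF assms, of x n] by (simp add: to_circle_def)
qed

lemma to_circle_extensional: "to_circle f \<in> extensional circle"
  by (simp add: to_circle_def)

lemma extensional_circle_eqI:
  assumes "h \<in> extensional circle" "k \<in> extensional circle" "\<And>x. h (circle_proj x) = k (circle_proj x)"
  shows "h = k"
proof (rule extensionalityI[OF assms(1,2)])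
  fix z assume "z \<in> circle"
  then show "h z = k z" using assms(3) by (metis circle_proj_surj)
qed

lemma to_circle_comp:
  assumes "f \<in> PH" "g \<in> PH"
  shows "compose circle (to_circle f) (to_circle g) = to_circle (f \<circ> g)"
  by (rule extensional_circle_eqI)
    (use assms in \<open>auto simp: compose_def to_circle_extensional to_circle_proj PH_comp[unfolded o_def] o_def\<close>)

lemma to_circle_id: "to_circle id = (\<lambda>z\<in>circle. z)"
  by (rule extensional_circle_eqI) (auto simp: to_circle_extensional to_circle_proj[OF PH_id])

text \<open>The projection of the compact unit interval onto the circle is a quotient map: the
  preimage of a closed set is the projection of a compact subset of the unit interval, hence
  closed.\<close>

lemma to_circle_continuous:
  assumes f: "f \<in> PH" shows "continuous_on circle (to_circle f)"
proof -
  have *: "closed (circle \<inter> to_circle f -` B)" if "closed B" for B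
  proof -
    have c: "continuous_on {0..1} (circle_proj \<circ> f)"
      using continuous_on_compose[OF continuous_on_subset[OF NH_continuous[OF PH_NH[OF f]]] continuous_on_circle_proj, of "{0..1}"]
      by simp
    have "closed ({0..1} \<inter> (circle_proj \<circ> f) -` B)"
      using continuous_closed_preimage[OF c _ that] by simp
    then have "compact ({0..1} \<inter> ({0..1} \<inter> (circle_proj \<circ> f) -` B))"
      by (intro compact_Int_closed) auto
    then have "compact (circle_proj ` ({0..1} \<inter> (circle_proj \<circ> f) -` B))"
      by (intro compact_continuous_image continuous_on_circle_proj) simp
    moreover have "circle \<inter> to_circle f -` B = circle_proj ` ({0..1} \<inter> (circle_proj \<circ> f) -` B)"
    proof
      show "circle \<inter> to_circle f -` B \<subseteq> circle_proj ` ({0..1} \<inter> (circle_proj \<circ> f) -` B)"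
      proof
        fix z assume z: "z \<in> circle \<inter> to_circle f -` B"
        then obtain x where x: "z = circle_proj x" using circle_proj_surj by blast
        obtain k t where t: "x = of_int k + t" "0 \<le> t" "t < 1" by (rule real_int_frac)
        have zt: "z = circle_proj t" using circle_proj_add_int[of t k] by (simp add: x t(1) add.commute)
        then have "circle_proj (f t) \<in> B" using z by (simp add: to_circle_proj[OF f])
        then show "z \<in> circle_proj ` ({0..1} \<inter> (circle_proj \<circ> f) -` B)" using t zt by auto
      qed
    qed (auto simp: to_circle_proj[OF f])
    ultimately show ?thesis by (simp add: compact_imp_closed)
  qed
  show ?thesis
    unfolding continuous_on_closed_vimage[OF closed_sphere] using * by (auto simp: Int_commute)
qed

lemma to_circle_inverse:
  assumes "f \<in> PH" "z \<in> circle"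
  shows "to_circle (rinv f) (to_circle f z) = z" "to_circle f (to_circle (rinv f) z) = z"
    "to_circle f z \<in> circle"
proof -
  obtain x where x: "z = circle_proj x" using assms(2) by (rule circle_proj_surj)
  show "to_circle (rinv f) (to_circle f z) = z" "to_circle f (to_circle (rinv f) z) = z"
    "to_circle f z \<in> circle"
    using assms(1) by (simp_all add: x to_circle_proj PH_inv PH_NH)
qed

lemma to_circle_homeomorphism:
  assumes "f \<in> PH" shows "homeomorphism circle circle (to_circle f) (to_circle (rinv f))"
  by (intro homeomorphismI to_circle_continuous)
    (use assms to_circle_inverse[OF assms] to_circle_inverse(3)[OF PH_inv[OF assms]] in \<open>auto simp: PH_inv\<close>)

section \<open>Lifts of circle homeomorphisms\<close>

definition is_lift :: "(real \<Rightarrow> real) \<Rightarrow> (complex \<Rightarrow> complex) \<Rightarrow> bool" where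
  "is_lift F h \<longleftrightarrow> (\<exists>G. homeomorphism UNIV UNIV F G) \<and> F 0 \<in> {0..<1} \<and> (\<forall>x. circle_proj (F x) = h (circle_proj x))"

lemma int_valued_constant:
  fixes d :: "real \<Rightarrow> real"
  assumes cont: "continuous_on UNIV d" and int: "\<And>x. \<exists>n::int. d x = of_int n"
  obtains n :: int where "\<And>x. d x = of_int n"
proof -
  have "d constant_on UNIV"
  proof (rule continuous_discrete_range_constant[OF connected_UNIV cont])
    fix x
    have "1 \<le> norm (d y - d x)" if "d y \<noteq> d x" for y
    proof -
      obtain m n :: int where "d x = of_int m" "d y = of_int n" using int by metis
      then show ?thesis using that by (simp flip: of_int_diff of_int_abs)
    qed
    then show "\<exists>e>0. \<forall>y. y \<in> UNIV \<and> d y \<noteq> d x \<longrightarrow> e \<le> norm (d y - d x)"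
      by (intro exI[of _ 1]) auto
  qed
  then obtain c where "\<And>x. d x = c" by (auto simp: constant_on_def)
  then show thesis using int that by metis
qed

lemma is_lift_continuous: "is_lift F h \<Longrightarrow> continuous_on UNIV F"
  by (auto simp: is_lift_def homeomorphism_def)

lemma is_lift_unique:
  assumes "is_lift F h" "is_lift G h" shows "F = G"
proof -
  have "\<exists>n::int. F x - G x = of_int n" for x
  proof -
    have "circle_proj (F x) = circle_proj (G x)" using assms by (simp add: is_lift_def)
    then show ?thesis by (auto simp: circle_proj_eq)
  qed
  then obtain n :: int where n: "\<And>x. F x - G x = of_int n"
    using int_valued_constant[of "\<lambda>x. F x - G x"] assms
    by (metis continuous_on_diff is_lift_continuous)
  have "\<bar>F 0 - G 0\<bar> < 1" using assms by (auto simp: is_lift_def)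
  then have "\<bar>real_of_int n\<bar> < 1" using n[of 0] by simp
  then have "n = 0" by linarith
  then show ?thesis using n by auto
qed

lemma circle_lift_eq:
  assumes "is_lift F h" shows "circle_lift h = F"
proof -
  have "(THE F. is_lift F h) = F"
    by (rule the_equality[of "\<lambda>F. is_lift F h", OF assms]) (rule is_lift_unique[OF _ assms])
  then show ?thesis by (simp only: circle_lift_def is_lift_def)
qed

lemma is_lift_cong: "(\<And>z. z \<in> circle \<Longrightarrow> h z = k z) \<Longrightarrow> is_lift F h \<longleftrightarrow> is_lift F k"
  by (simp add: is_lift_def)

text \<open>The representative modulo integer translations that satisfies the condition on the value
  at 0 imposed by \<open>circle_lift\<close>.\<close>

definition normalize :: "(real \<Rightarrow> real) \<Rightarrow> real \<Rightarrow> real" where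
  "normalize f = (\<lambda>x. f x + of_int (- \<lfloor>f 0\<rfloor>))"

lemma normalize_0: "normalize f 0 \<in> {0..<1}"
  unfolding normalize_def by (simp; linarith)

lemma normalize_PH:
  assumes "f \<in> PH" shows "normalize f \<in> PH"
  using PH_comp[OF PH_translation assms, of "of_int (- \<lfloor>f 0\<rfloor>)"] by (simp add: normalize_def o_def)

lemma to_circle_normalize: "f \<in> PH \<Longrightarrow> to_circle (normalize f) = to_circle f"
  by (rule extensional_circle_eqI)
    (simp_all add: to_circle_extensional to_circle_proj normalize_PH, simp only: normalize_def circle_proj_add_int)

lemma is_lift_normalize:
  assumes "f \<in> PH" shows "is_lift (normalize f) (to_circle f)"
proof -
  have "circle_proj (normalize f x) = to_circle f (circle_proj x)" for x
    by (simp only: normalize_def circle_proj_add_int to_circle_proj[OF assms])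
  then show ?thesis
    using NH_homeomorphism[OF PH_NH[OF normalize_PH[OF assms]]] normalize_0 by (auto simp: is_lift_def)
qed

text \<open>A continuous logarithm on the contractible line gives continuous lifts of
  \<open>h\<close> and of its inverse \<open>k\<close>. Each composite of the two lifts covers the
  identity of the circle, so it is translation by an integer; this makes the lift of
  \<open>h\<close> a homeomorphism.\<close>

lemma lift_exists:
  assumes h: "homeomorphism circle circle h k" obtains F where "is_lift F h"
proof -
  note hk = homeomorphism_def[THEN iffD1, OF h]
  have log: "\<exists>F. continuous_on UNIV F \<and> (\<forall>x. circle_proj (F x) = m (circle_proj x))"
    if "continuous_on circle m" "m ` circle \<subseteq> circle" for m
  proof -
    have mem: "m (circle_proj x) \<in> circle" for x
      using that(2) circle_proj_in_circle[of x] by blast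
    have "continuous_on UNIV (\<lambda>x. m (circle_proj x))"
      by (rule continuous_on_compose2[OF that(1) continuous_on_circle_proj]) auto
    moreover have "m (circle_proj x) \<noteq> 0" for x using mem[of x] by auto
    ultimately obtain g where g: "continuous_on UNIV g" "\<And>x::real. m (circle_proj x) = exp (g x)"
      using continuous_logarithm_on_contractible[of UNIV "\<lambda>x. m (circle_proj x)"]
      by (metis UNIV_I contractible_UNIV)
    have "Re (g x) = 0" for x
    proof -
      have "norm (exp (g x)) = 1" using mem[of x] by (simp add: g(2))
      then show ?thesis by simp
    qed
    then have gx: "g x = \<i> * of_real (Im (g x))" for x by (simp add: complex_eq_iff)
    show ?thesis
    proof (intro exI conjI allI)
      show "continuous_on UNIV (\<lambda>x. Im (g x) / (2 * pi))" by (intro continuous_intros g(1)) simp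
      fix x
      have "circle_proj (Im (g x) / (2 * pi)) = exp (\<i> * of_real (Im (g x)))"
        by (simp add: circle_proj_def)
      then show "circle_proj (Im (g x) / (2 * pi)) = m (circle_proj x)" by (simp only: gx[symmetric] g(2))
    qed
  qed
  obtain F0 where F0: "continuous_on UNIV F0" "\<And>x. circle_proj (F0 x) = h (circle_proj x)"
    using log[of h] hk by auto
  obtain K0 where K0: "continuous_on UNIV K0" "\<And>x. circle_proj (K0 x) = k (circle_proj x)"
    using log[of k] hk by auto
  have comp: "\<exists>n::int. \<forall>x. B (A x) = x + of_int n"
    if A: "continuous_on UNIV A" and B: "continuous_on UNIV B" and "\<And>x. circle_proj (B (A x)) = circle_proj x" for A B
  proof -
    have "continuous_on UNIV (\<lambda>x. B (A x) - x)"
      by (intro continuous_intros continuous_on_compose2[OF B A]) auto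
    moreover have "\<exists>n::int. B (A x) - x = of_int n" for x
      using that(3)[of x] by (auto simp: circle_proj_eq)
    ultimately obtain n :: int where "\<And>x. B (A x) - x = of_int n" by (rule int_valued_constant) blast
    then show ?thesis by (intro exI[of _ n]) (auto simp: algebra_simps)
  qed
  obtain c :: int where c: "\<And>x. K0 (F0 x) = x + of_int c"
    using comp[OF F0(1) K0(1)] hk by (auto simp: F0(2) K0(2))
  obtain c' :: int where c': "\<And>x. F0 (K0 x) = x + of_int c'"
    using comp[OF K0(1) F0(1)] hk by (auto simp: F0(2) K0(2))
  define a where "a = \<lfloor>F0 0\<rfloor>"
  define F where "F x = F0 x + of_int (- a)" for x
  define G where "G y = K0 (y + of_int a) - of_int c" for y
  have GF: "G (F x) = x" for x by (simp add: F_def G_def c)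
  have surjF: "\<exists>x. F x = y" for y
  proof
    show "F (K0 (y + of_int a - of_int c')) = y" by (simp add: F_def c')
  qed
  have FG: "F (G y) = y" for y using surjF[of y] GF by metis
  have "homeomorphism UNIV UNIV F G"
  proof (rule homeomorphismI)
    show "continuous_on UNIV F" unfolding F_def by (intro continuous_intros F0(1))
    show "continuous_on UNIV G" unfolding G_def
      by (intro continuous_intros continuous_on_compose2[OF K0(1)]) auto
  qed (use FG GF in auto)
  moreover have "F 0 \<in> {0..<1}" unfolding F_def a_def by (simp; linarith)
  moreover have "circle_proj (F x) = h (circle_proj x)" for x
    by (simp only: F_def circle_proj_add_int F0(2))
  ultimately have "is_lift F h" by (auto simp: is_lift_def)
  then show thesis by (rule that)
qed

text \<open>The difference \<open>F (x + 1) - F x\<close> is a constant integer \<open>m\<close>,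
  the degree, and is positive as \<open>F\<close> increases. The point \<open>y\<close> with
  \<open>F y = F 0 + 1\<close> projects to the same point as 0 because \<open>h\<close> is
  injective, so it is an integer \<open>l\<close> with \<open>m * l = 1\<close>.\<close>

lemma lift_shift:
  assumes F: "is_lift F h" and mono: "strict_mono F" and h: "inj_on h circle"
  shows "F (x + of_int n) = F x + of_int n"
proof -
  have int: "\<exists>n::int. F (x + 1) - F x = of_int n" for x
  proof -
    have "circle_proj (F (x + 1)) = circle_proj (F x)"
      using F circle_proj_add_int[of x 1] by (simp add: is_lift_def)
    then show ?thesis by (auto simp: circle_proj_eq)
  qed
  have "continuous_on UNIV (\<lambda>x. F (x + 1) - F x)"
    by (intro continuous_on_diff is_lift_continuous[OF F]
        continuous_on_compose2[OF is_lift_continuous[OF F]] continuous_intros) auto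
  then obtain m :: int where m: "\<And>x. F (x + 1) - F x = of_int m"
    by (rule int_valued_constant[of "\<lambda>x. F (x + 1) - F x", OF _ int]) (rule that; assumption)
  have nat: "F (x + real k) = F x + of_int m * real k" for x k
  proof (induction k)
    case (Suc k)
    then show ?case using m[of "x + real k"] by (simp add: algebra_simps)
  qed simp
  have "F 0 < F 1" using mono by (simp add: strict_mono_less)
  then have "real_of_int m > 0" using m[of 0] by simp
  then have "m > 0" by simp
  have "range F = UNIV" using F by (auto simp: is_lift_def homeomorphism_def)
  then obtain y where y: "F y = F 0 + 1" by (metis surjD)
  have "h (circle_proj y) = circle_proj (F y)" using F by (simp add: is_lift_def)
  also have "F y = F 0 + of_int 1" using y by simp
  also have "circle_proj (F 0 + of_int 1) = circle_proj (F 0)" by (rule circle_proj_add_int)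
  also have "\<dots> = h (circle_proj 0)" using F by (simp add: is_lift_def)
  finally have "circle_proj y = circle_proj 0"
    by (rule inj_onD[OF h _ circle_proj_in_circle circle_proj_in_circle])
  then obtain l :: int where l: "y = of_int l" by (auto simp: circle_proj_eq)
  have "F 0 < F y" using y by simp
  then have "0 < y" using mono by (simp add: strict_mono_less)
  then have "F y = F 0 + of_int m * of_int l" using nat[of 0 "nat l"] l by simp
  then have "real_of_int (m * l) = 1" using y by simp
  then have "m * l = 1" by linarith
  then have "m = 1" using \<open>m > 0\<close> by (auto simp: zmult_eq_1_iff)
  have natI: "F (x + real k) = F x + real k" for x k using nat[of x k] \<open>m = 1\<close> by simp
  show ?thesis
  proof (cases "n \<ge> 0")
    case True
    then show ?thesis using natI[of x "nat n"] by simp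
  next
    case False
    then show ?thesis using natI[of "x + of_int n" "nat (- n)"] by simp
  qed
qed

lemma loc_abs_cont_add_const:
  assumes "loc_abs_cont f" shows "loc_abs_cont (\<lambda>x. f x + c)"
  using assms by (simp add: loc_abs_cont_def abs_cont_on_def)

lemma carrier_AC_circle: "carrier AC_circle = to_circle ` PH"
proof
  show "to_circle ` PH \<subseteq> carrier AC_circle"
  proof
    fix h assume "h \<in> to_circle ` PH"
    then obtain f where f: "f \<in> PH" "h = to_circle f" by blast
    have lift: "circle_lift h = normalize f"
      unfolding f(2) by (intro circle_lift_eq is_lift_normalize f)
    have inj: "inj_on h circle"
      unfolding f(2) using to_circle_inverse(1)[OF f(1)] by (rule inj_on_inverseI)
    have "inv_into circle h z = to_circle (rinv f) z" if "z \<in> circle" for z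
      using to_circle_inverse(2)[OF f(1) that] to_circle_inverse(3)[OF PH_inv[OF f(1)] that] f(2)
      by (intro inv_into_f_eq inj) auto
    then have "is_lift (normalize (rinv f)) (inv_into circle h)"
      using is_lift_normalize[OF PH_inv[OF f(1)]] is_lift_cong by metis
    then have "circle_lift (inv_into circle h) = normalize (rinv f)" by (rule circle_lift_eq)
    then show "h \<in> carrier AC_circle"
      using to_circle_homeomorphism[OF f(1)] f lift normalize_PH[OF f(1)] normalize_PH[OF PH_inv[OF f(1)]]
      by (auto simp: AC_circle_def to_circle_extensional PH_NH NH_loc_abs_cont strict_mono_def NH_less)
  qed
  show "carrier AC_circle \<subseteq> to_circle ` PH"
  proof
    fix h assume "h \<in> carrier AC_circle"
    then obtain k where h: "h \<in> extensional circle" "homeomorphism circle circle h k"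
      "strict_mono (circle_lift h)" "loc_abs_cont (circle_lift h)" "loc_abs_cont (circle_lift (inv_into circle h))"
      by (auto simp: AC_circle_def)
    note hk = homeomorphism_def[THEN iffD1, OF h(2)]
    have inj: "inj_on h circle" using hk by (auto intro: inj_on_inverseI)
    obtain F where F: "is_lift F h" by (rule lift_exists[OF h(2)])
    obtain K where K: "is_lift K k" by (rule lift_exists[OF homeomorphism_symD[OF h(2)]])
    have "inv_into circle h z = k z" if "z \<in> circle" for z
      using that hk inj by (intro inv_into_f_eq) auto
    then have "is_lift K (inv_into circle h)" using K is_lift_cong by metis
    then have lifts: "circle_lift h = F" "circle_lift (inv_into circle h) = K"
      using F by (auto intro: circle_lift_eq)
    obtain G where G: "homeomorphism UNIV UNIV F G" using F by (auto simp: is_lift_def)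
    note FG = homeomorphism_rinv[OF G]
    \<comment> \<open>The inverse of \<open>F\<close> need not be the normalised lift
      \<open>K\<close> of the inverse map, but differs from it by an integer constant, so local
      absolute continuity carries over.\<close>
    have int: "\<exists>n::int. K (F x) - x = of_int n" for x
    proof -
      have "circle_proj (K (F x)) = k (h (circle_proj x))" using F K by (simp add: is_lift_def)
      then show ?thesis using hk by (auto simp: circle_proj_eq)
    qed
    have "continuous_on UNIV (\<lambda>x. K (F x) - x)"
      by (intro continuous_intros continuous_on_compose2[OF is_lift_continuous[OF K] is_lift_continuous[OF F]]) auto
    then obtain n :: int where n: "\<And>x. K (F x) - x = of_int n"
      by (rule int_valued_constant[of "\<lambda>x. K (F x) - x", OF _ int]) (rule that; assumption)
    have "rinv F y = K y + (- of_int n)" for y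
      using n[of "rinv F y"] FG(1) by (simp add: bij_is_surj surj_f_inv_f)
    then have "rinv F = (\<lambda>y. K y + (- of_int n))" by auto
    then have "loc_abs_cont (rinv F)" using loc_abs_cont_add_const[of K "- of_int n"] h(5) lifts by simp
    then have "F \<in> NH" using strict_mono_NH[OF G] h lifts by simp
    moreover have "F (x + of_int n) = F x + of_int n" for x n
      using lift_shift[OF F _ inj] h(3) lifts by simp
    ultimately have PH: "F \<in> PH" by (simp add: PH_def)
    have "h = to_circle F"
      using F by (intro extensional_circle_eqI h to_circle_extensional) (simp add: to_circle_proj[OF PH] is_lift_def)
    then show "h \<in> to_circle ` PH" using PH by blast
  qed
qed

lemma AC_circle_mult:
  assumes "f \<in> PH" "g \<in> PH"
  shows "to_circle f \<otimes>\<^bsub>AC_circle\<^esub> to_circle g = to_circle (f \<circ> g)"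
proof -
  have "to_circle f \<in> Bij circle" if "f \<in> PH" for f
  proof -
    have "bij_betw (to_circle f) circle circle"
      by (rule bij_betwI[where g = "to_circle (rinv f)"])
        (use to_circle_inverse[OF that] to_circle_inverse(3)[OF PH_inv[OF that]] in blast)+
    then show ?thesis by (simp add: Bij_def to_circle_extensional)
  qed
  then show ?thesis
    using assms by (simp add: AC_circle_def BijGroup_def to_circle_comp)
qed

lemma AC_circle_one: "\<one>\<^bsub>AC_circle\<^esub> = to_circle id"
  by (simp add: AC_circle_def BijGroup_def to_circle_id)

lemma PH_sub_NH: "PH \<subseteq> NH"
  by (auto simp: PH_NH)

lemma AC_circle_group: "group AC_circle"
  and AC_circle_inv: "f \<in> PH \<Longrightarrow> inv\<^bsub>AC_circle\<^esub> (to_circle f) = to_circle (rinv f)"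
  using group_image[OF carrier_AC_circle AC_circle_one AC_circle_mult PH_id PH_comp PH_inv PH_sub_NH] by blast+

text \<open>Every element comes from a map with value at 0 between 0 and 1, for which the linear
  bound on lengths is a constant.\<close>

lemma AC_circle_strongly_bounded: "strongly_bounded AC_circle"
  unfolding strongly_bounded_def
proof (intro allI impI)
  fix L assume "length_function AC_circle L"
  then have L: "\<forall>f\<in>PH. \<forall>g\<in>PH. L (to_circle f \<otimes>\<^bsub>AC_circle\<^esub> to_circle g) \<le> L (to_circle f) + L (to_circle g)"
    "\<forall>f\<in>PH. L (inv\<^bsub>AC_circle\<^esub> (to_circle f)) \<le> L (to_circle f)"
    unfolding length_function_def carrier_AC_circle by blast+
  have comp: "L (to_circle (f \<circ> g)) \<le> L (to_circle f) + L (to_circle g)" if "f \<in> PH" "g \<in> PH" for f g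
    using L(1)[rule_format, OF that] unfolding AC_circle_mult[OF that] .
  have inv: "L (to_circle (rinv f)) \<le> L (to_circle f)" if "f \<in> PH" for f
    using L(2)[rule_format, OF that] unfolding AC_circle_inv[OF that] .
  have "\<exists>A B. A \<ge> 0 \<and> (\<forall>f\<in>PH. L (to_circle f) \<le> A * \<bar>f 0\<bar> + B)"
    by (rule PH_length_linear[of "\<lambda>f. L (to_circle f)"]) (erule (1) comp, erule inv, blast)
  then obtain A B where AB: "A \<ge> 0" "\<And>f. f \<in> PH \<Longrightarrow> L (to_circle f) \<le> A * \<bar>f 0\<bar> + B"
    by blast
  have "L (to_circle f) \<le> A + B" if f: "f \<in> PH" for f
  proof -
    have "L (to_circle f) \<le> A * \<bar>normalize f 0\<bar> + B"
      using AB(2)[OF normalize_PH[OF f]] by (simp add: to_circle_normalize[OF f])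
    also have "\<dots> \<le> A * 1 + B"
      using normalize_0[of f] AB(1) by (intro add_right_mono mult_left_mono) auto
    finally show ?thesis by simp
  qed
  then show "\<exists>C. \<forall>x\<in>carrier AC_circle. L x \<le> C" by (auto simp: carrier_AC_circle)
qed

text \<open>Outside the circle a fibre is empty and \<open>setdist\<close> is 0, so the bounds hold
  for all arguments. They make the supremum in the metric behave well even off the carrier, where
  nonnegativity is still demanded.\<close>

lemma circle_dist_bounds: "0 \<le> circle_dist x y" "circle_dist x y \<le> 1/2"
proof -
  show "0 \<le> circle_dist x y" by (simp add: circle_dist_def)
  show "circle_dist x y \<le> 1/2"
  proof (cases "x \<in> circle \<and> y \<in> circle")
    case True
    then obtain a b where "x = circle_proj a" "y = circle_proj b" using circle_proj_surj by metis
    then show ?thesis by (simp only: circle_dist_proj dist_int_le_half)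
  next
    case False
    then have "circle_proj -` {x} = {} \<or> circle_proj -` {y} = {}"
      using circle_proj_in_circle by fastforce
    then show ?thesis by (auto simp: circle_dist_def)
  qed
qed

lemma circle_dist_bdd: "bdd_above ((\<lambda>x. circle_dist (f x) (g x)) ` circle)"
  using circle_dist_bounds(2) by (intro bdd_aboveI[of _ "1/2"]) blast

lemma circle_dist_triangle:
  assumes "x \<in> circle" "y \<in> circle" "z \<in> circle"
  shows "circle_dist x z \<le> circle_dist x y + circle_dist y z"
proof -
  obtain a b c where "x = circle_proj a" "y = circle_proj b" "z = circle_proj c"
    using assms by (metis circle_proj_surj)
  then show ?thesis by (simp only: circle_dist_proj dist_int_triangle)
qed

lemma circle_dist_eq_0:
  assumes "x \<in> circle" "y \<in> circle" shows "circle_dist x y = 0 \<longleftrightarrow> x = y"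
proof -
  obtain a b where "x = circle_proj a" "y = circle_proj b"
    using assms by (metis circle_proj_surj)
  then show ?thesis by (auto simp: circle_dist_proj dist_int_eq_0 circle_proj_eq algebra_simps)
qed

lemma Metric_space_AC_circle: "Metric_space (carrier AC_circle) AC_circle_dist"
proof
  let ?s = "\<lambda>f g. SUP x\<in>circle. circle_dist (f x) (g x)"
  have s_ge: "circle_dist (f x) (g x) \<le> ?s f g" if "x \<in> circle" for f g x
    using circle_dist_bdd that by (intro cSUP_upper) auto
  have one: "(1::complex) \<in> circle" by simp
  have s0: "0 \<le> ?s f g" for f g
    using s_ge[OF one, of f g] circle_dist_bounds(1)[of "f 1" "g 1"] by linarith
  have l0: "0 \<le> deriv_L1_dist x y" for x y
    unfolding deriv_L1_dist_def set_lebesgue_integral_def by (intro integral_nonneg_AE) auto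
  show "0 \<le> AC_circle_dist f g" for f g
    unfolding AC_circle_dist_def using s0 l0 by (intro add_nonneg_nonneg) auto
  show "AC_circle_dist f g = AC_circle_dist g f" for f g
    by (simp add: AC_circle_dist_def deriv_L1_dist_def abs_minus_commute circle_dist_def setdist_sym)
  have mem: "f x \<in> circle" if "f \<in> carrier AC_circle" "x \<in> circle" for f x
    using that to_circle_inverse(3) by (auto simp: carrier_AC_circle)
  have lift: "circle_lift f \<in> NH" if fA: "f \<in> carrier AC_circle" for f
  proof -
    obtain F where F: "F \<in> PH" "f = to_circle F" using fA unfolding carrier_AC_circle by blast
    then have "circle_lift f = normalize F" by (simp add: circle_lift_eq is_lift_normalize)
    then show ?thesis using normalize_PH[OF F(1)] by (simp add: PH_NH)
  qed
  have ext: "f \<in> extensional circle" if "f \<in> carrier AC_circle" for f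
    using that to_circle_extensional by (auto simp: carrier_AC_circle)
  show "AC_circle_dist f g = 0 \<longleftrightarrow> f = g" if f: "f \<in> carrier AC_circle" and g: "g \<in> carrier AC_circle" for f g
  proof
    assume "AC_circle_dist f g = 0"
    then have "?s f g = 0" using s0[of f g] l0[of "circle_lift f" "circle_lift g"] by (simp add: AC_circle_dist_def)
    then have "circle_dist (f x) (g x) = 0" if "x \<in> circle" for x
      using s_ge[OF that, of f g] circle_dist_bounds(1)[of "f x" "g x"] by simp
    then show "f = g" using mem f g by (intro extensionalityI[OF ext ext]) (auto simp: circle_dist_eq_0)
  next
    assume "f = g"
    then have "circle_dist (f x) (g x) = 0" if "x \<in> circle" for x
      using mem[OF f that] by (simp add: circle_dist_eq_0)
    then have "?s f g = (SUP x\<in>circle. 0)" by (intro SUP_cong) auto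
    also have "\<dots> = 0" using one by (intro cSUP_const) blast
    finally show "AC_circle_dist f g = 0"
      using \<open>f = g\<close> by (simp add: AC_circle_dist_def deriv_L1_dist_def set_lebesgue_integral_def)
  qed
  show "AC_circle_dist f h \<le> AC_circle_dist f g + AC_circle_dist g h"
    if fgh: "f \<in> carrier AC_circle" "g \<in> carrier AC_circle" "h \<in> carrier AC_circle" for f g h
  proof -
    have "?s f h \<le> ?s f g + ?s g h"
    proof (rule cSUP_least)
      show "circle \<noteq> {}" using one by blast
      fix x assume x: "x \<in> circle"
      then show "circle_dist (f x) (h x) \<le> ?s f g + ?s g h"
        using circle_dist_triangle[of "f x" "g x" "h x"] mem fgh s_ge[OF x, of f g] s_ge[OF x, of g h] by fastforce
    qed
    moreover have "deriv_L1_dist (circle_lift f) (circle_lift h) \<le>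
        deriv_L1_dist (circle_lift f) (circle_lift g) + deriv_L1_dist (circle_lift g) (circle_lift h)"
      using L1dist_real_triangle[OF lift[OF fgh(1)] lift[OF fgh(2)] lift[OF fgh(3)]] fgh
      by (simp add: deriv_L1_dist_eq lift)
    ultimately show ?thesis unfolding AC_circle_dist_def by linarith
  qed
qed

section \<open>The quasi-isometry type of the group on the line\<close>

text \<open>Every element stays within 1 of the translation by its value at 0. That value therefore
  describes the element up to bounded error.\<close>

lemma PH_displacement:
  assumes "f \<in> PH" shows "\<bar>f t - f 0 - t\<bar> \<le> 1"
proof -
  obtain k s where t: "t = of_int k + s" "0 \<le> s" "s < 1" by (rule real_int_frac)
  have "f 0 \<le> f s" "f s \<le> f 1" using NH_le[OF PH_NH[OF assms]] t by simp_all
  then have "f 0 \<le> f s" "f s \<le> f 0 + 1" using PH_shift[OF assms, of 0 1] by simp_all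
  moreover have "f t = f s + of_int k" using PH_shift[OF assms, of s k] by (simp add: t(1) add.commute)
  ultimately show ?thesis using t by linarith
qed

lemma AC_line_length_linear:
  assumes "length_function AC_line L"
  obtains A B where "A \<ge> 0" "B \<ge> 0" "\<And>f. f \<in> PH \<Longrightarrow> L f \<le> A * \<bar>f 0\<bar> + B"
proof -
  have "L (f \<circ> g) \<le> L f + L g" if "f \<in> PH" "g \<in> PH" for f g
    using assms that by (simp add: length_function_def carrier_AC_line flip: mult_AC_line)
  moreover have "L (rinv f) \<le> L f" if "f \<in> PH" for f
    using assms that by (simp add: length_function_def carrier_AC_line flip: inv_AC_line)
  ultimately show thesis using PH_length_linear[of L] that by blast
qed

text \<open>The word length of \<open>h\<close> is comparable with \<open>\<bar>h 0\<bar>\<close>: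
  from below through the left-invariant metric, in which \<open>S\<close> is bounded, and from above
  because word length is a length function. The quasi-isometry takes the integer part of the value
  at 0.\<close>

lemma AC_line_quasi_isometric:
  assumes cb: "coarsely_bounded_in AC_line AC_line_top S" and gen: "generate AC_line S = carrier AC_line"
  shows "quasi_isometric (carrier AC_line) (word_dist AC_line S) (UNIV :: int set) (\<lambda>m n. real_of_int \<bar>m - n\<bar>)"
proof -
  interpret group AC_line by (rule group_AC_line)
  interpret M: Metric_space PH left_dist by (rule Metric_space_left_dist)
  have S: "S \<subseteq> carrier AC_line" using cb by (simp add: coarsely_bounded_in_def)
  note cl = left_dist_compatible
  have "M.mbounded S" using cb cl by (simp add: coarsely_bounded_in_def carrier_AC_line)
  then obtain f B0 where f: "S \<subseteq> M.mcball f B0" by (auto simp: M.mbounded_def)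
  define len where "len = left_dist id"
  have len: "length_function AC_line len"
    using length_function_invariant_metric[OF cl] by (simp add: len_def one_AC_line)
  \<comment> \<open>The identity and \<open>rinv h\<close> are compared at the point
    \<open>h 0\<close>, which \<open>rinv h\<close> sends to 0.\<close>
  have len_ge: "\<bar>h 0\<bar> \<le> len h" if "h \<in> PH" for h
    using AC_line_dist_ge[OF PH_id PH_inv[OF that], of "h 0"] that
    by (simp add: len_def left_dist_def PH_NH)
  define B where "B = \<bar>left_dist id f + B0\<bar>"
  have B: "len s \<le> B" if "s \<in> S" for s
  proof -
    have "f \<in> PH" "s \<in> PH" "left_dist f s \<le> B0" using f that by auto
    then show ?thesis using M.triangle[OF PH_id, of f s] by (simp add: len_def B_def)
  qed
  have len_one: "len \<one>\<^bsub>AC_line\<^esub> \<le> 0" using M.mdist_zero[OF PH_id] by (simp add: len_def one_AC_line)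
  have up: "\<bar>h 0\<bar> \<le> B * word_length AC_line S h" if "h \<in> PH" for h
    using length_le_word_length[OF len S gen B len_one, of h] len_ge[OF that] that by (simp add: carrier_AC_line)
  obtain A C where AC: "A \<ge> 0" "C \<ge> 0" "\<And>h. h \<in> PH \<Longrightarrow> word_length AC_line S h \<le> A * \<bar>h 0\<bar> + C"
    using AC_line_length_linear[OF length_function_word_length[OF S gen]] by blast
  \<comment> \<open>\<open>K\<close> dominates both linear rates and is at least 1, so constants
    survive division by it. In \<open>D\<close> the summand 2 covers one unit of rounding and one
    unit from \<open>PH_displacement\<close>; \<open>2 * A + C\<close> is the corresponding error in
    the other direction.\<close>
  define K where "K = 1 + A + B"
  define D where "D = 2 + 2 * A + C"
  have B0: "B \<ge> 0" by (simp add: B_def)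
  have K: "K \<ge> 1" "K \<ge> A" "K \<ge> B" using AC B0 by (auto simp: K_def)
  have main: "word_dist AC_line S x y / K - D \<le> real_of_int \<bar>\<lfloor>x 0\<rfloor> - \<lfloor>y 0\<rfloor>\<bar> \<and>
      real_of_int \<bar>\<lfloor>x 0\<rfloor> - \<lfloor>y 0\<rfloor>\<bar> \<le> K * word_dist AC_line S x y + D" if x: "x \<in> PH" and y: "y \<in> PH" for x y
  proof -
    define h where "h = rinv x \<circ> y"
    have h: "h \<in> PH" using x y by (simp add: h_def PH_inv PH_comp)
    define w where "w = word_dist AC_line S x y"
    have w: "w = word_length AC_line S h"
      using x y by (simp add: w_def word_dist_word_length inv_AC_line mult_AC_line PH_inv h_def)
    have w0: "w \<ge> 0" by (simp add: w word_length_def)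
    have "y 0 = x (h 0)" using x by (simp add: h_def PH_NH)
    then have d1: "\<bar>y 0 - x 0 - h 0\<bar> \<le> 1" using PH_displacement[OF x, of "h 0"] by simp
    define q where "q = real_of_int \<bar>\<lfloor>x 0\<rfloor> - \<lfloor>y 0\<rfloor>\<bar>"
    have q: "q \<le> \<bar>x 0 - y 0\<bar> + 1" "\<bar>x 0 - y 0\<bar> \<le> q + 1"
      unfolding q_def by linarith+
    have "q \<le> \<bar>h 0\<bar> + 2" using q d1 by linarith
    also have "\<dots> \<le> B * w + 2" using up[OF h] by (simp add: w)
    also have "\<dots> \<le> K * w + D" using K w0 AC by (intro add_mono mult_right_mono) (auto simp: D_def)
    finally have 1: "q \<le> K * w + D" .
    have "w \<le> A * \<bar>h 0\<bar> + C" using AC(3)[OF h] by (simp add: w)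
    also have "\<dots> \<le> A * (q + 2) + C" using q d1 AC(1) by (intro add_right_mono mult_left_mono) linarith+
    also have "\<dots> = A * q + (2 * A + C)" by (simp add: algebra_simps)
    also have "\<dots> \<le> K * q + K * (2 * A + C)"
      using K AC by (intro add_mono mult_right_mono) (auto simp: q_def mult_le_cancel_right1)
    finally have "w / K \<le> q + (2 * A + C)" using K by (simp add: field_simps)
    then have "w / K - D \<le> q" by (simp add: D_def)
    then show ?thesis using 1 by (simp add: w_def q_def)
  qed
  show ?thesis
    unfolding quasi_isometric_def
  proof (rule exI[of _ "\<lambda>f. \<lfloor>f 0\<rfloor>"], rule exI[of _ K], rule exI[of _ D], intro conjI ballI)
    show "K \<ge> 1" "D \<ge> 0" using K AC by (auto simp: D_def)
    fix x y assume "x \<in> carrier AC_line" "y \<in> carrier AC_line"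
    then show "word_dist AC_line S x y / K - D \<le> real_of_int \<bar>\<lfloor>x 0\<rfloor> - \<lfloor>y 0\<rfloor>\<bar>"
      "real_of_int \<bar>\<lfloor>x 0\<rfloor> - \<lfloor>y 0\<rfloor>\<bar> \<le> K * word_dist AC_line S x y + D"
      using main by (auto simp: carrier_AC_line)
  next
    fix n :: int
    have "(\<lambda>x. x + of_int n) \<in> carrier AC_line" by (simp add: carrier_AC_line PH_translation)
    moreover have "real_of_int \<bar>\<lfloor>(0::real) + of_int n\<rfloor> - n\<bar> \<le> D" using AC by (simp add: D_def)
    ultimately show "\<exists>x\<in>carrier AC_line. real_of_int \<bar>\<lfloor>x 0\<rfloor> - n\<bar> \<le> D" by (intro bexI) auto
  qed simp
qed

text \<open>The set contains the translations by 1 and -1 as well as all normalised maps, and every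
  element is an integer translation composed with a normalised one. It is closed because evaluation
  at 0 is 1-Lipschitz for the metric.\<close>

lemma AC_line_generating_set:
  defines "S \<equiv> {f \<in> PH. \<bar>f 0\<bar> \<le> 1}"
  shows "closedin AC_line_top S" "coarsely_bounded_in AC_line AC_line_top S" "generate AC_line S = carrier AC_line"
proof -
  interpret group AC_line by (rule group_AC_line)
  interpret M: Metric_space PH AC_line_dist by (rule Metric_space_line)
  have top: "AC_line_top = M.mtopology" by (simp add: AC_line_top_def carrier_AC_line)
  have S: "S \<subseteq> carrier AC_line" by (auto simp: S_def carrier_AC_line)
  show "closedin AC_line_top S"
    unfolding top closedin_def M.topspace_mtopology M.openin_mtopology
  proof (intro conjI allI impI)
    fix f assume f: "f \<in> PH - S"
    then have f: "f \<in> PH" "\<bar>f 0\<bar> > 1" by (auto simp: S_def)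
    have "M.mball f (\<bar>f 0\<bar> - 1) \<subseteq> PH - S"
    proof
      fix g assume "g \<in> M.mball f (\<bar>f 0\<bar> - 1)"
      then have "g \<in> PH" "AC_line_dist f g < \<bar>f 0\<bar> - 1" by auto
      then show "g \<in> PH - S" using AC_line_dist_ge[OF f(1), of g 0] by (auto simp: S_def)
    qed
    then show "\<exists>r>0. M.mball f r \<subseteq> PH - S" using f(2) by (intro exI[of _ "\<bar>f 0\<bar> - 1"]) auto
  qed (auto simp: S_def)
  show "coarsely_bounded_in AC_line AC_line_top S"
  proof (rule coarsely_bounded_inI[OF S])
    fix L assume "length_function AC_line L"
    then obtain A B where AB: "A \<ge> 0" "\<And>f. f \<in> PH \<Longrightarrow> L f \<le> A * \<bar>f 0\<bar> + B"
      using AC_line_length_linear by blast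
    have "L f \<le> A + B" if "f \<in> S" for f
    proof -
      have "L f \<le> A * \<bar>f 0\<bar> + B" using AB that by (simp add: S_def)
      also have "\<dots> \<le> A * 1 + B" using that AB(1) by (intro add_right_mono mult_left_mono) (auto simp: S_def)
      finally show ?thesis by simp
    qed
    then show "\<exists>C. \<forall>x\<in>S. L x \<le> C" by blast
  qed
  show "generate AC_line S = carrier AC_line"
  proof
    show "generate AC_line S \<subseteq> carrier AC_line" using S by (rule generate_incl)
    let ?T = "\<lambda>a x. x + (a::real)"
    have gmult: "f \<circ> g \<in> generate AC_line S"
      if "f \<in> generate AC_line S" "g \<in> generate AC_line S" for f g
      using generate.eng[OF that] generate_in_carrier[OF S] that by (simp add: carrier_AC_line mult_AC_line)
    have step: "?T 1 \<in> generate AC_line S" "?T (- 1) \<in> generate AC_line S"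
      using PH_translation[of 1] PH_translation[of "- 1"] by (auto intro!: generate.incl simp: S_def)
    have T: "?T (real k) \<in> generate AC_line S \<and> ?T (- real k) \<in> generate AC_line S" for k
    proof (induction k)
      case 0
      have "id \<in> generate AC_line S" using generate.one[of AC_line S] by (simp add: one_AC_line)
      then show ?case by (simp add: id_def)
    next
      case (Suc k)
      have "?T (real (Suc k)) = ?T 1 \<circ> ?T (real k)" "?T (- real (Suc k)) = ?T (- 1) \<circ> ?T (- real k)" by auto
      then show ?case using gmult step Suc by metis
    qed
    have Tint: "?T (of_int n) \<in> generate AC_line S" for n
      using T[of "nat n"] T[of "nat (- n)"] by (cases "n \<ge> 0") auto
    show "carrier AC_line \<subseteq> generate AC_line S"
    proof
      fix f assume "f \<in> carrier AC_line"
      then have f: "f \<in> PH" by (simp add: carrier_AC_line)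
      have "normalize f \<in> S" using normalize_PH[OF f] normalize_0[of f] by (auto simp: S_def)
      then have "?T (of_int \<lfloor>f 0\<rfloor>) \<circ> normalize f \<in> generate AC_line S"
        by (intro gmult Tint generate.incl)
      moreover have "?T (of_int \<lfloor>f 0\<rfloor>) \<circ> normalize f = f" by (auto simp: normalize_def)
      ultimately show "f \<in> generate AC_line S" by simp
    qed
  qed
qed

theorem theorem1:
  shows "generated_by_coarsely_bounded AC_interval AC_interval_top \<and>
    generated_by_coarsely_bounded AC_circle AC_circle_top \<and>
    generated_by_coarsely_bounded AC_line AC_line_top \<and>
    has_quasi_isometry_type AC_interval AC_interval_top {()} (\<lambda>_ _. 0) \<and>
    coarsely_bounded_group AC_interval AC_interval_top \<and>
    has_quasi_isometry_type AC_circle AC_circle_top {()} (\<lambda>_ _. 0) \<and>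
    coarsely_bounded_group AC_circle AC_circle_top \<and>
    has_quasi_isometry_type AC_line AC_line_top (UNIV :: int set) (\<lambda>m n. real_of_int \<bar>m - n\<bar>)"
proof -
  note interval = group.strongly_bounded_quasi_isometry_type[OF AC_interval_group(1)
      AC_interval_strongly_bounded Metric_space_AC_interval AC_interval_top_def]
  note circle = group.strongly_bounded_quasi_isometry_type[OF AC_circle_group
      AC_circle_strongly_bounded Metric_space_AC_circle AC_circle_top_def]
  have "generated_by_coarsely_bounded AC_line AC_line_top"
    unfolding generated_by_coarsely_bounded_def using AC_line_generating_set by blast
  moreover have "has_quasi_isometry_type AC_line AC_line_top (UNIV :: int set) (\<lambda>m n. real_of_int \<bar>m - n\<bar>)"
    unfolding has_quasi_isometry_type_def using AC_line_generating_set AC_line_quasi_isometric by blast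
  ultimately show ?thesis using interval circle by blast
qed

end
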